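(* There are no finite groups whose character tables differ by only one row or only one column. That is, let $G$ and $H$ be finite groups having the same number $k$ of conjugacy classes, and let $X, Y\in\mathbb{C}^{k\times k}$ be character tables of $G$ and $H$ respectively, with respect to some orderings of the irreducible characters and of the conjugacy classes. Suppose that $X$ and $Y$ agree in all entries outside a single row (i.e. there is an $r\in\{1,\dots,k\}$ with $X_{ij}=Y_{ij}$ for all $i\neq r$ and all $j$), or that $X$ and $Y$ agree in all entries outside a single column (i.e. there is an $s\in\{1,\dots,k\}$ with $X_{ij}=Y_{ij}$ for all $i$ and all $j\neq s$). Then $X$ and $Y$ are identical as character tables, i.e. $Y$ is obtained from $X$ by a permutation of rows and a permutation of columns.
   Context: The character table of a finite group $G$ with $k$ conjugacy classes is the complex $k\times k$ matrix $(\chi_i(g_j))_{i,j}$, where $\chi_1,\dots,\chi_k$ are the irreducible complex characters of $G$ and $g_1,\dots,g_k$ are representatives of the conjugacy classes of $G$, both listed in an arbitrary order. Only the matrix entries are regarded as part of the table (no class sizes, element orders, power maps, or labelling of the trivial character or the identity element are attached). Character tables are considered identical if they differ only by permuting rows and columns. *)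

theory Defs
  imports
    "HOL-Algebra.Group_Action"
    "HOL-Combinatorics.Permutations"
    "Jordan_Normal_Form.VS_Connect"
begin

text \<open>Complex matrix representations of degree \<open>n\<close>: homomorphisms into the general linear
  group, rendered as the group of units of the ring of complex \<open>n \<times> n\<close> matrices.
  Only the values on \<^term>\<open>carrier G\<close> matter.\<close>

definition representation ::
    "('a, 'm) monoid_scheme \<Rightarrow> nat \<Rightarrow> ('a \<Rightarrow> complex mat) \<Rightarrow> bool" where
  "representation G n \<rho> \<longleftrightarrow> \<rho> \<in> hom G (units_of (ring_mat TYPE(complex) n ()))"

definition irreducible_representation ::
    "('a, 'm) monoid_scheme \<Rightarrow> nat \<Rightarrow> ('a \<Rightarrow> complex mat) \<Rightarrow> bool" where
  "irreducible_representation G n \<rho> \<longleftrightarrow>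
     representation G n \<rho> \<and> n > 0 \<and>
     (\<forall>W. VectorSpace.subspace class_ring W (module_vec TYPE(complex) n) \<longrightarrow>
          (\<forall>g\<in>carrier G. \<forall>w\<in>W. \<rho> g *\<^sub>v w \<in> W) \<longrightarrow>
          W = {0\<^sub>v n} \<or> W = carrier_vec n)"

definition trace :: "complex mat \<Rightarrow> complex" where
  "trace A = (\<Sum>i<dim_row A. A $$ (i, i))"

text \<open>Characters are restricted to the carrier (with value \<^const>\<open>undefined\<close> outside), so that
  equality in \<open>Irr G\<close> is equality as functions on the group.\<close>

definition Irr :: "('a, 'm) monoid_scheme \<Rightarrow> ('a \<Rightarrow> complex) set" where
  "Irr G = {\<lambda>g\<in>carrier G. trace (\<rho> g) | n \<rho>. irreducible_representation G n \<rho>}"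

definition conjugation :: "('a, 'm) monoid_scheme \<Rightarrow> 'a \<Rightarrow> 'a \<Rightarrow> 'a" where
  "conjugation G g = (\<lambda>h\<in>carrier G. g \<otimes>\<^bsub>G\<^esub> h \<otimes>\<^bsub>G\<^esub> inv\<^bsub>G\<^esub> g)"

definition conjugacy_class :: "('a, 'm) monoid_scheme \<Rightarrow> 'a \<Rightarrow> 'a set" where
  "conjugacy_class G x = orbit G (conjugation G) x"

definition conjugacy_classes :: "('a, 'm) monoid_scheme \<Rightarrow> 'a set set" where
  "conjugacy_classes G = orbits G (carrier G) (conjugation G)"

text \<open>Rows and columns are indexed from \<open>0\<close>. The functions \<open>\<chi>\<close> and \<open>g\<close> are arbitrary
  enumerations, without repetition, of the irreducible characters and of representatives of the
  conjugacy classes.\<close>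

definition is_character_table :: "('a, 'm) monoid_scheme \<Rightarrow> complex mat \<Rightarrow> bool" where
  "is_character_table G X \<longleftrightarrow>
     (\<exists>k \<chi> g. k = card (conjugacy_classes G) \<and>
        bij_betw \<chi> {..<k} (Irr G) \<and>
        (\<forall>j<k. g j \<in> carrier G) \<and>
        bij_betw (\<lambda>j. conjugacy_class G (g j)) {..<k} (conjugacy_classes G) \<and>
        X = mat k k (\<lambda>(i, j). \<chi> i (g j)))"

end

theory Submission
  imports Defs "Jordan_Normal_Form.Schur_Decomposition" "HOL-Algebra.Multiplicative_Group"
    "HOL-Algebra.Sylow" "HOL-Number_Theory.Cong"
begin

text \<open>If the tables differ in one column, column orthogonality makes the two versions of that column
  proportional, and comparing degrees and class sizes leaves only an exchange of two rows.

  If they differ in one row, the products of two distinct entries of that row are the same in both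
  tables. Either the tables are identical, or the exceptional rows \<open>u\<close> and \<open>v\<close> vanish outside two
  columns, one of them the identity column. Then these two columns form a normal subgroup \<open>N\<close> of \<open>G\<close>
  whose nonidentity elements are conjugate, \<open>N\<close> is a \<open>p\<close>-group of order \<open>t + 1\<close>, \<open>u\<close> takes the values
  \<open>m t\<close> and \<open>- m\<close> on \<open>N\<close>, and \<open>m\<close> is a power of \<open>p\<close> (Gagola). In the same way \<open>H\<close> yields \<open>K\<close>, \<open>q\<close>, \<open>m'\<close>
  and \<open>t'\<close> with \<open>m\<^sup>2 t = m'\<^sup>2 t'\<close>, so that \<open>u\<close> and \<open>v\<close> have the same degree if \<open>p = q\<close>.

  Suppose \<open>p \<noteq> q\<close> and \<open>m' = q\<^sup>f > 1\<close>. Then \<open>q\<close>-elements of \<open>G\<close> act on \<open>N\<close> without fixed points, hence a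
  Sylow \<open>q\<close>-subgroup of \<open>G\<close>, which has order \<open>m'\<^sup>2\<close>, contains no noncyclic abelian subgroup and so has an
  element \<open>x\<close> of order at least \<open>q\<^bsup>f+1\<^esup>\<close>. In \<open>H\<close>, on the other hand, \<open>y\<^bsup>m'\<^esup>\<close> lies in \<open>K\<close> for every
  \<open>q\<close>-element \<open>y\<close>. Powers prime to the group orders can be read off the table, so \<open>x\<close> is conjugate to
  \<open>x\<^bsup>k\<^esup>\<close> for some \<open>k\<close> with \<open>k - 1\<close> exactly divisible by a \<open>q\<close>-th of the order of \<open>x\<close>, which is
  impossible for \<open>x\<close> of maximal \<open>q\<close>-power order.\<close>

section \<open>Traces of complex matrices\<close>

text \<open>The common rows are characters that are trivial on \<open>N\<close> and on
  \<open>K\<close>, so they say nothing about these subgroups themselves. What links the two groups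
  is one number, \<open>m^2 * t\<close>, the negative of the product of the two nonzero entries of
  the exceptional row. As \<open>p\<close> is prime to \<open>t\<close>, it determines
  \<open>m\<close> when \<open>p = q\<close>; when the primes differ, it suffices that both
  multipliers are 1, and the argument for one of them is applied twice with the groups exchanged.

  A table carries no power map. The exponent \<open>k\<close> is therefore coprime to both orders,
  so that \<open>x^k\<close> can be followed through the table, and \<open>y^(k-1)\<close> falls
  into \<open>K\<close>, where the common characters cannot tell \<open>y^k\<close> from
  \<open>y\<close>; in \<open>G\<close>, however, \<open>x^(k-1)\<close> has order \<open>q\<close>.
  The bound \<open>q^(f+1)\<close> on the order of \<open>x\<close> leaves room for both, and since
  the Sylow subgroup has order \<open>q^(2f)\<close>, it means that the square of the order of
  \<open>x\<close> exceeds that of the subgroup.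

  A table does not mark the identity either: the two exceptional columns may be exchanged between
  \<open>G\<close> and \<open>H\<close>. This is why \<open>e\<close>, \<open>f\<close> and
  \<open>e'\<close>, \<open>f'\<close> are kept apart throughout.\<close>

lemma index_mult_mat_sum:
  assumes "A \<in> carrier_mat n m" "B \<in> carrier_mat m l" "i < n" "j < l"
  shows "(A * B) $$ (i, j) = (\<Sum>k<m. A $$ (i, k) * B $$ (k, j))"
  using assms by (auto simp: scalar_prod_def atLeast0LessThan intro!: sum.cong)

lemma trace_mult_comm:
  assumes "A \<in> carrier_mat n m" "B \<in> carrier_mat m n"
  shows "trace (A * B) = trace (B * A)"
proof -
  have "trace (A * B) = (\<Sum>i<n. \<Sum>k<m. A $$ (i, k) * B $$ (k, i))"
    using assms unfolding trace_def by (auto intro!: sum.cong simp: index_mult_mat_sum simp del: index_mult_mat(1))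
  also have "\<dots> = (\<Sum>k<m. \<Sum>i<n. B $$ (k, i) * A $$ (i, k))"
    by (subst sum.swap) (simp add: mult.commute)
  also have "\<dots> = trace (B * A)"
    using assms unfolding trace_def by (auto intro!: sum.cong simp: index_mult_mat_sum simp del: index_mult_mat(1))
  finally show ?thesis .
qed

lemma trace_conjugate:
  assumes "P \<in> carrier_mat n n" "Q \<in> carrier_mat n n" "B \<in> carrier_mat n n" "Q * P = 1\<^sub>m n"
  shows "trace (P * B * Q) = trace B"
proof -
  have "trace (P * B * Q) = trace (Q * (P * B))"
    using assms by (intro trace_mult_comm[of _ n n]) auto
  also have "Q * (P * B) = (Q * P) * B"
    using assms by (intro assoc_mult_mat[symmetric])
  finally show ?thesis using assms by simp
qed

lemma pow_mat_commute:
  fixes A :: "'a :: semiring_1 mat"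
  assumes "A \<in> carrier_mat n n"
  shows "A * A ^\<^sub>m k = A ^\<^sub>m k * A"
proof (induction k)
  case (Suc k)
  have "A * (A ^\<^sub>m k * A) = A * A ^\<^sub>m k * A"
    using assms by (intro assoc_mult_mat[symmetric]) auto
  thus ?case using Suc by simp
qed (use assms in simp)

lemma trace_one: "trace (1\<^sub>m n) = of_nat n"
  by (simp add: trace_def)

lemma upper_triangular_mult:
  fixes A B :: "'a :: semiring_1 mat"
  assumes A: "A \<in> carrier_mat n n" "upper_triangular A" and B: "B \<in> carrier_mat n n" "upper_triangular B"
  shows "upper_triangular (A * B)" and "\<And>i. i < n \<Longrightarrow> (A * B) $$ (i, i) = A $$ (i, i) * B $$ (i, i)"
proof -
  have *: "(A * B) $$ (i, j) = (\<Sum>k<n. A $$ (i, k) * B $$ (k, j))" if "i < n" "j < n" for i j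
    using index_mult_mat_sum[of A n n B n i j] assms that
    by (auto simp: scalar_prod_def atLeast0LessThan intro!: sum.cong)
  show "upper_triangular (A * B)"
  proof (rule upper_triangularI)
    fix i j assume ij: "j < i" "i < dim_row (A * B)"
    hence i: "i < n" using A by simp
    have "A $$ (i, k) * B $$ (k, j) = 0" if "k < n" for k
    proof (cases "k < i")
      case True
      thus ?thesis using upper_triangularD[OF A(2), of k i] A i by simp
    next
      case False
      thus ?thesis using upper_triangularD[OF B(2), of j k] B that ij by simp
    qed
    thus "(A * B) $$ (i, j) = 0" using * [of i j] ij i by simp
  qed
  fix i assume i: "i < n"
  have "A $$ (i, k) * B $$ (k, i) = 0" if "k < n" "k \<noteq> i" for k
  proof (cases "k < i")
    case True
    thus ?thesis using upper_triangularD[OF A(2), of k i] A i by simp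
  next
    case False
    thus ?thesis using upper_triangularD[OF B(2), of i k] B that by simp
  qed
  thus "(A * B) $$ (i, i) = A $$ (i, i) * B $$ (i, i)"
    using *[OF i i] i sum.remove[of "{..<n}" i "\<lambda>k. A $$ (i, k) * B $$ (k, i)"] by simp
qed

lemma upper_triangular_pow:
  fixes A :: "'a :: semiring_1 mat"
  assumes A: "A \<in> carrier_mat n n" "upper_triangular A"
  shows "upper_triangular (A ^\<^sub>m k) \<and> (\<forall>i<n. (A ^\<^sub>m k) $$ (i, i) = A $$ (i, i) ^ k)"
proof (induction k)
  case 0
  then show ?case using A by simp
next
  case (Suc k)
  have "A ^\<^sub>m k \<in> carrier_mat n n" using A by simp
  then show ?case using upper_triangular_mult[of "A ^\<^sub>m k" n A] A Suc
    by (simp add: power_commutes del: index_mult_mat(1))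
qed

lemma complex_triangularizable:
  fixes A :: "complex mat"
  assumes A: "A \<in> carrier_mat n n"
  obtains B P Q where "B \<in> carrier_mat n n" "P \<in> carrier_mat n n" "Q \<in> carrier_mat n n"
    "P * Q = 1\<^sub>m n" "Q * P = 1\<^sub>m n" "upper_triangular B" "similar_mat_wit A B P Q"
proof -
  obtain es where es: "char_poly A = (\<Prod>e\<leftarrow>es. [:- e, 1:])"
    using char_poly_factorized[OF A] by blast
  obtain B P Q where "schur_decomposition A es = (B, P, Q)"
    by (cases "schur_decomposition A es") auto
  from schur_decomposition[OF A es this] have w: "similar_mat_wit A B P Q" "upper_triangular B" by auto
  show ?thesis using that similar_mat_witD2[OF A w(1)] w by blast
qed

text \<open>A triangular form is enough: the diagonal of a power consists of the powers of the
  diagonal entries. The last clause says that a unipotent complex matrix of finite order is trivial;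
  it comes from summing the powers of the triangular form.\<close>

lemma trace_pow_eigenvalues:
  fixes A :: "complex mat"
  assumes A: "A \<in> carrier_mat n n" and A1: "A ^\<^sub>m N = 1\<^sub>m n" and N: "N > 0"
  obtains bs where "length bs = n" "\<And>b. b \<in> set bs \<Longrightarrow> b ^ N = 1"
    "\<And>i. trace (A ^\<^sub>m i) = (\<Sum>b\<leftarrow>bs. b ^ i)"
    "(\<And>b. b \<in> set bs \<Longrightarrow> b = 1) \<Longrightarrow> A = 1\<^sub>m n"
proof -
  obtain B P Q where B: "B \<in> carrier_mat n n" "P \<in> carrier_mat n n" "Q \<in> carrier_mat n n"
    "P * Q = 1\<^sub>m n" "Q * P = 1\<^sub>m n" "upper_triangular B" and w: "similar_mat_wit A B P Q"
    by (rule complex_triangularizable[OF A])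
  have Bk: "B ^\<^sub>m k \<in> carrier_mat n n" for k using B by simp
  have pw: "A ^\<^sub>m k = P * B ^\<^sub>m k * Q" for k using similar_mat_wit_pow_id[OF w] .
  have BN: "B ^\<^sub>m N = 1\<^sub>m n"
  proof -
    have "B ^\<^sub>m N = Q * A ^\<^sub>m N * P"
      using similar_mat_wit_pow_id[OF similar_mat_wit_sym[OF w]] .
    thus ?thesis using A1 B by simp
  qed
  define bs where "bs = map (\<lambda>i. B $$ (i, i)) [0..<n]"
  show ?thesis
  proof (rule that[of bs])
    show "length bs = n" by (simp add: bs_def)
    show "b ^ N = 1" if b: "b \<in> set bs" for b
    proof -
      obtain i where i: "i < n" "b = B $$ (i, i)" using b by (auto simp: bs_def)
      have "b ^ N = (B ^\<^sub>m N) $$ (i, i)" using upper_triangular_pow[OF B(1,6), of N] i by simp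
      thus ?thesis using BN i by simp
    qed
    show "trace (A ^\<^sub>m i) = (\<Sum>b\<leftarrow>bs. b ^ i)" for i
    proof -
      have "trace (A ^\<^sub>m i) = trace (B ^\<^sub>m i)"
        using pw trace_conjugate[OF B(2,3) Bk B(5)] by metis
      also have "\<dots> = (\<Sum>k<n. B $$ (k, k) ^ i)"
        using upper_triangular_pow[OF B(1,6), of i] B(1) unfolding trace_def by (auto intro!: sum.cong)
      finally show ?thesis unfolding bs_def
        by (simp add: comp_def interv_sum_list_conv_sum_set_nat atLeast0LessThan)
    qed
    assume "\<And>b. b \<in> set bs \<Longrightarrow> b = 1"
    hence diag: "B $$ (i, i) = 1" if "i < n" for i using that by (auto simp: bs_def)
    \<comment> \<open>\<open>S\<close>, the sum of the powers of \<open>B\<close>, satisfies \<open>B S = S\<close> and has the nonzero diagonal entries \<open>N\<close>.\<close>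
    define S where "S = mat n n (\<lambda>(i, j). \<Sum>k<N. (B ^\<^sub>m k) $$ (i, j))"
    have S: "S \<in> carrier_mat n n" by (simp add: S_def)
    have "B * S = S"
    proof (rule eq_matI)
      fix i j assume "i < dim_row S" "j < dim_col S"
      hence ij: "i < n" "j < n" by (auto simp: S_def)
      have "(B * S) $$ (i, j) = (\<Sum>l<n. \<Sum>k<N. B $$ (i, l) * (B ^\<^sub>m k) $$ (l, j))"
        by (subst index_mult_mat_sum[OF B(1) S ij]) (simp add: S_def ij sum_distrib_left)
      also have "\<dots> = (\<Sum>k<N. (B * B ^\<^sub>m k) $$ (i, j))"
        by (subst sum.swap) (simp add: index_mult_mat_sum[OF B(1) Bk ij] del: index_mult_mat(1))
      also have "\<dots> = (\<Sum>k<N. (B ^\<^sub>m Suc k) $$ (i, j))"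
        by (simp add: pow_mat_commute[OF B(1)] del: index_mult_mat(1))
      \<comment> \<open>Shifting the index changes only the end terms, the powers with exponents
        \<open>N\<close> and 0, and both are the identity.\<close>
      also have "\<dots> = (\<Sum>k<N. (B ^\<^sub>m k) $$ (i, j))"
        using sum.lessThan_Suc_shift[of "\<lambda>k. (B ^\<^sub>m k) $$ (i, j)" N] sum.lessThan_Suc[of "\<lambda>k. (B ^\<^sub>m k) $$ (i, j)" N]
          BN B(1) ij by simp
      finally show "(B * S) $$ (i, j) = S $$ (i, j)" using ij by (simp add: S_def)
    qed (use B S in auto)
    have "upper_triangular S"
      by (rule upper_triangularI) (use upper_triangular_pow[OF B(1,6)] B(1) in \<open>auto simp: S_def upper_triangularD intro!: sum.neutral\<close>)
    moreover have "S $$ (i, i) = of_nat N" if "i < n" for i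
      using upper_triangular_pow[OF B(1,6)] that diag by (simp add: S_def)
    ultimately have "det S \<noteq> 0"
      using det_upper_triangular[OF _ S] N S by (auto simp: diag_mat_def prod_list_zero_iff)
    then obtain R where R: "R \<in> carrier_mat n n" "S * R = 1\<^sub>m n"
      using det_non_zero_imp_unit[OF S, of "()"] by (auto simp: Units_def ring_mat_simps)
    have "B = B * (S * R)" using R B by simp
    also have "\<dots> = B * S * R" using R B S by (simp add: assoc_mult_mat[of _ n n _ n _ n])
    also have "\<dots> = 1\<^sub>m n" using \<open>B * S = S\<close> R by simp
    finally show "A = 1\<^sub>m n" using pw[of 1] A B by simp
  qed
qed

text \<open>In a triangular form each diagonal entry \<open>b\<close> satisfies
  \<open>b * b = c * b\<close>, so it is 0 or \<open>c\<close>, and the trace counts the entries of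
  the second kind.\<close>

lemma trace_quasi_idempotent:
  fixes A :: "complex mat"
  assumes A: "A \<in> carrier_mat n n" and A2: "A * A = c \<cdot>\<^sub>m A"
  shows "\<exists>k::nat. trace A = of_nat k * c"
proof -
  obtain B P Q where B: "B \<in> carrier_mat n n" "P \<in> carrier_mat n n" "Q \<in> carrier_mat n n"
    "P * Q = 1\<^sub>m n" "Q * P = 1\<^sub>m n" "upper_triangular B" and w: "similar_mat_wit A B P Q"
    by (rule complex_triangularizable[OF A])
  have AB: "A = P * B * Q" using similar_mat_witD2[OF A w] by simp
  have BA: "B = Q * A * P" using similar_mat_witD2[OF _ similar_mat_wit_sym[OF w]] B by blast
  have "P * (Q * (A * P)) = A * P"
    using A B assoc_mult_mat[of P n n Q n "A * P" n] by simp
  hence "B * B = Q * A * (A * P)"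
    using A B BA by (simp add: assoc_mult_mat[of _ n n _ n _ n])
  also have "\<dots> = Q * (A * A) * P"
    using A B by (simp add: assoc_mult_mat[of _ n n _ n _ n])
  also have "\<dots> = c \<cdot>\<^sub>m B"
    unfolding A2 BA using A B
    by (simp add: mult_smult_distrib[of Q n n A n] mult_smult_assoc_mat[of "Q * A" n n P n]
        assoc_mult_mat[of _ n n _ n _ n])
  finally have B2: "B * B = c \<cdot>\<^sub>m B" .
  have "B $$ (i, i) = 0 \<or> B $$ (i, i) = c" if "i < n" for i
  proof -
    have "(c \<cdot>\<^sub>m B) $$ (i, i) = B $$ (i, i) * B $$ (i, i)"
      using upper_triangular_mult(2)[OF B(1,6) B(1,6) that] unfolding B2 .
    thus ?thesis using B(1) that by auto
  qed
  hence "(\<Sum>i<n. B $$ (i, i)) = (\<Sum>i<n. of_nat (if B $$ (i, i) = 0 then 0 else 1) * c)"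
    by (intro sum.cong) auto
  also have "\<dots> = of_nat (\<Sum>i<n. if B $$ (i, i) = 0 then 0 else 1) * c"
    by (simp add: sum_distrib_right)
  finally have "trace B = of_nat (\<Sum>i<n. if B $$ (i, i) = 0 then 0 else 1) * c"
    using B(1) by (simp add: trace_def)
  thus ?thesis using AB trace_conjugate[OF B(2,3,1,5)] by metis
qed

section \<open>Schur's lemma and orthogonality\<close>

lemma subspace_vecI:
  fixes W :: "complex vec set"
  assumes "W \<subseteq> carrier_vec n" "0\<^sub>v n \<in> W" "\<And>v w. v \<in> W \<Longrightarrow> w \<in> W \<Longrightarrow> v + w \<in> W"
    "\<And>c v. v \<in> W \<Longrightarrow> c \<cdot>\<^sub>v v \<in> W"
  shows "VectorSpace.subspace class_ring W (module_vec TYPE(complex) n)"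
  using assms vec_vs[of n] vec_module[of n]
  by (auto simp: VectorSpace.subspace_def LinearCombinations.submodule_def module_vec_simps)

lemma zero_mat_mult_vec: "v \<in> carrier_vec m \<Longrightarrow> 0\<^sub>m n m *\<^sub>v v = 0\<^sub>v n"
  by (rule eq_vecI) (simp_all add: scalar_prod_def)

lemma mat_mult_zero_vec: "A \<in> carrier_mat n m \<Longrightarrow> A *\<^sub>v 0\<^sub>v m = 0\<^sub>v n"
  by (rule eq_vecI) (simp_all add: scalar_prod_def)

lemma zero_mat_if_kernel:
  fixes A :: "complex mat"
  assumes A: "A \<in> carrier_mat n m" and "\<And>v. v \<in> carrier_vec m \<Longrightarrow> A *\<^sub>v v = 0\<^sub>v n"
  shows "A = 0\<^sub>m n m"
proof (rule eq_matI)
  fix i j assume ij: "i < dim_row (0\<^sub>m n m)" "j < dim_col (0\<^sub>m n m)"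
  have "A $$ (i, j) = (A *\<^sub>v unit_vec m j) $ i" using A ij by simp
  also have "\<dots> = 0" using assms(2)[of "unit_vec m j"] ij by simp
  finally show "A $$ (i, j) = 0\<^sub>m n m $$ (i, j)" using ij by simp
qed (use A in auto)

section \<open>Matrix representations of a finite group\<close>

locale finite_group = group G for G :: "('a, 'm) monoid_scheme" (structure) +
  assumes fin: "finite (carrier G)"
begin

lemma order_pos: "Coset.order G > 0"
  using fin one_closed by (auto simp: Coset.order_def card_gt_0_iff)

lemma pow_order: "x \<in> carrier G \<Longrightarrow> x [^] Coset.order G = \<one>"
  by (rule pow_order_eq_1)

lemma inv_eq_pow: "x \<in> carrier G \<Longrightarrow> inv x = x [^] (Coset.order G - 1)"
  using inv_equality[of "x [^] (Coset.order G - 1)" x] nat_pow_Suc[of x "Coset.order G - 1"]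
    order_pos pow_order[of x] by simp

lemma sum_translate:
  assumes "h \<in> carrier G"
  shows "(\<Sum>g\<in>carrier G. f (h \<otimes> g)) = (\<Sum>g\<in>carrier G. f g)"
  by (rule sum.reindex_bij_witness[of _ "\<lambda>g. inv h \<otimes> g" "\<lambda>g. h \<otimes> g"])
     (use assms in \<open>auto simp: m_assoc[symmetric]\<close>)

context
  fixes n \<rho>
  assumes rep: "representation G n \<rho>"
begin

lemma rep_carrier: "g \<in> carrier G \<Longrightarrow> \<rho> g \<in> carrier_mat n n"
  using rep by (auto simp: representation_def hom_def units_of_def Units_def ring_mat_simps)

lemma rep_mult: "g \<in> carrier G \<Longrightarrow> h \<in> carrier G \<Longrightarrow> \<rho> (g \<otimes> h) = \<rho> g * \<rho> h"
  using rep by (auto simp: representation_def hom_def units_of_def ring_mat_simps)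

lemma rep_one: "\<rho> \<one> = 1\<^sub>m n"
proof -
  interpret R: ring "ring_mat TYPE(complex) n ()" by (rule ring_mat)
  interpret U: group "units_of (ring_mat TYPE(complex) n ())" by (rule R.units_group)
  interpret group_hom G "units_of (ring_mat TYPE(complex) n ())" \<rho>
    by unfold_locales (use rep in \<open>simp add: representation_def\<close>)
  show ?thesis using hom_one by (simp add: units_of_def ring_mat_simps)
qed

lemma rep_inv: "g \<in> carrier G \<Longrightarrow> \<rho> g * \<rho> (inv g) = 1\<^sub>m n"
  using rep_mult[of g "inv g"] by (simp add: rep_one)

lemma rep_pow: "g \<in> carrier G \<Longrightarrow> \<rho> (g [^] (k::nat)) = \<rho> g ^\<^sub>m k"
proof (induction k)
  case 0
  thus ?case using rep_carrier[of g] by (simp add: rep_one)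
next
  case (Suc k)
  thus ?case by (simp add: rep_mult)
qed

lemma rep_entry_mult:
  assumes "g \<in> carrier G" "h \<in> carrier G" "i < n" "j < n"
  shows "\<rho> (g \<otimes> h) $$ (i, j) = (\<Sum>k<n. \<rho> g $$ (i, k) * \<rho> h $$ (k, j))"
  using assms rep_carrier by (simp add: rep_mult index_mult_mat_sum[of _ n n _ n] del: index_mult_mat(1))

end

text \<open>Kernel and image of \<open>A\<close> are invariant subspaces, so a nonzero
  \<open>A\<close> is injective and surjective. The inverse is kept explicit because it serves to
  conjugate \<open>\<sigma> g\<close> into \<open>\<rho> g\<close>.\<close>

lemma schur:
  assumes irr\<rho>: "irreducible_representation G n \<rho>" and irr\<sigma>: "irreducible_representation G m \<sigma>"
    and A: "A \<in> carrier_mat n m" and int: "\<And>g. g \<in> carrier G \<Longrightarrow> \<rho> g * A = A * \<sigma> g"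
    and nz: "A \<noteq> 0\<^sub>m n m"
  shows "n = m" and "\<exists>B\<in>carrier_mat m n. A * B = 1\<^sub>m n \<and> B * A = 1\<^sub>m m"
proof -
  have rep: "representation G n \<rho>" "representation G m \<sigma>" and n: "n > 0" "m > 0"
    using irr\<rho> irr\<sigma> by (auto simp: irreducible_representation_def)
  note car\<rho> = rep_carrier[OF rep(1)] and car\<sigma> = rep_carrier[OF rep(2)]
  have invar\<rho>: "W = {0\<^sub>v n} \<or> W = carrier_vec n"
    if "VectorSpace.subspace class_ring W (module_vec TYPE(complex) n)" "\<forall>g\<in>carrier G. \<forall>w\<in>W. \<rho> g *\<^sub>v w \<in> W" for W
    using irr\<rho> that unfolding irreducible_representation_def by blast
  have invar\<sigma>: "W = {0\<^sub>v m} \<or> W = carrier_vec m"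
    if "VectorSpace.subspace class_ring W (module_vec TYPE(complex) m)" "\<forall>g\<in>carrier G. \<forall>w\<in>W. \<sigma> g *\<^sub>v w \<in> W" for W
    using irr\<sigma> that unfolding irreducible_representation_def by blast
  define K where "K = {v \<in> carrier_vec m. A *\<^sub>v v = 0\<^sub>v n}"
  have "VectorSpace.subspace class_ring K (module_vec TYPE(complex) m)"
    by (rule subspace_vecI)
       (use A in \<open>auto simp: K_def mult_add_distrib_mat_vec[of A n m] mult_mat_vec[of A n m]\<close>)
  moreover have "\<sigma> g *\<^sub>v w \<in> K" if "g \<in> carrier G" "w \<in> K" for g w
  proof -
    have w: "w \<in> carrier_vec m" "A *\<^sub>v w = 0\<^sub>v n" using that by (auto simp: K_def)
    have "A *\<^sub>v (\<sigma> g *\<^sub>v w) = \<rho> g *\<^sub>v (A *\<^sub>v w)"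
      using int[OF that(1)] assoc_mult_mat_vec[OF A car\<sigma>[OF that(1)] w(1)]
        assoc_mult_mat_vec[OF car\<rho>[OF that(1)] A w(1)] by simp
    moreover have "\<rho> g *\<^sub>v 0\<^sub>v n = 0\<^sub>v n" by (rule mat_mult_zero_vec[OF car\<rho>[OF that(1)]])
    ultimately show ?thesis using w car\<sigma>[OF that(1)] by (simp add: K_def)
  qed
  ultimately have "K = {0\<^sub>v m} \<or> K = carrier_vec m" using invar\<sigma> by blast
  moreover have "K \<noteq> carrier_vec m" using zero_mat_if_kernel[OF A] nz by (auto simp: K_def)
  ultimately have ker: "K = {0\<^sub>v m}" by blast
  define I where "I = {A *\<^sub>v v | v. v \<in> carrier_vec m}"
  have "VectorSpace.subspace class_ring I (module_vec TYPE(complex) n)"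
  proof (rule subspace_vecI)
    show "I \<subseteq> carrier_vec n" using A by (auto simp: I_def)
    show "0\<^sub>v n \<in> I" using A by (auto simp: I_def intro!: exI[of _ "0\<^sub>v m"])
    show "v + w \<in> I" if "v \<in> I" "w \<in> I" for v w
      using that A by (auto simp: I_def mult_add_distrib_mat_vec[of A n m, symmetric])
    show "c \<cdot>\<^sub>v v \<in> I" if "v \<in> I" for c v
      using that A by (auto simp: I_def mult_mat_vec[of A n m, symmetric])
  qed
  moreover have "\<rho> g *\<^sub>v w \<in> I" if g: "g \<in> carrier G" and w: "w \<in> I" for g w
  proof -
    obtain v where v: "v \<in> carrier_vec m" "w = A *\<^sub>v v" using w by (auto simp: I_def)
    have "\<rho> g *\<^sub>v w = A *\<^sub>v (\<sigma> g *\<^sub>v v)"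
      using int[OF g] assoc_mult_mat_vec[OF A car\<sigma>[OF g] v(1)]
        assoc_mult_mat_vec[OF car\<rho>[OF g] A v(1)] v by simp
    thus ?thesis using v car\<sigma>[OF g] by (auto simp: I_def)
  qed
  ultimately have "I = {0\<^sub>v n} \<or> I = carrier_vec n" using invar\<rho> by blast
  moreover have "I \<noteq> {0\<^sub>v n}"
  proof
    assume "I = {0\<^sub>v n}"
    hence "A *\<^sub>v v = 0\<^sub>v n" if "v \<in> carrier_vec m" for v using that by (auto simp: I_def)
    thus False using zero_mat_if_kernel[OF A] nz by blast
  qed
  ultimately have im: "I = carrier_vec n" by blast
  \<comment> \<open>Surjectivity provides preimages of the unit vectors; they become the columns of
    a right inverse.\<close>
  have "\<forall>j. \<exists>v. j < n \<longrightarrow> v \<in> carrier_vec m \<and> A *\<^sub>v v = unit_vec n j"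
    using im unfolding I_def by (smt (verit) mem_Collect_eq unit_vec_carrier)
  then obtain b where b: "\<And>j. j < n \<Longrightarrow> b j \<in> carrier_vec m \<and> A *\<^sub>v b j = unit_vec n j"
    by metis
  define B where "B = mat m n (\<lambda>(i, j). b j $ i)"
  have B: "B \<in> carrier_mat m n" by (simp add: B_def)
  have colB: "col B j = b j" if "j < n" for j
    using b[OF that] that by (intro eq_vecI) (auto simp: B_def)
  have AB: "A * B = 1\<^sub>m n"
  proof (rule eq_matI)
    fix i j assume ij: "i < dim_row (1\<^sub>m n)" "j < dim_col (1\<^sub>m n)"
    have "(A * B) $$ (i, j) = (A *\<^sub>v b j) $ i" using ij A B colB[of j] by simp
    thus "(A * B) $$ (i, j) = 1\<^sub>m n $$ (i, j)" using b[of j] ij by simp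
  qed (use A B in auto)
  \<comment> \<open>\<open>A\<close> kills every value of \<open>B * A - 1\<close>, so injectivity
    makes \<open>B\<close> a left inverse too, before the dimensions are known to agree.\<close>
  have "A * (B * A - 1\<^sub>m m) = A * (B * A) - A * 1\<^sub>m m"
    using A B by (intro mult_minus_distrib_mat) auto
  also have "A * (B * A) = A"
    using A B AB assoc_mult_mat[OF A B A] by simp
  finally have 0: "A * (B * A - 1\<^sub>m m) = 0\<^sub>m n m" using A by simp
  have D: "B * A - 1\<^sub>m m \<in> carrier_mat m m" by (rule minus_carrier_mat) simp
  have "B * A - 1\<^sub>m m = 0\<^sub>m m m"
  proof (rule zero_mat_if_kernel[OF D])
    fix v :: "complex vec" assume v: "v \<in> carrier_vec m"
    have "A *\<^sub>v ((B * A - 1\<^sub>m m) *\<^sub>v v) = 0\<^sub>v n"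
      using assoc_mult_mat_vec[OF A D v] zero_mat_mult_vec[OF v, of n] 0 by simp
    thus "(B * A - 1\<^sub>m m) *\<^sub>v v = 0\<^sub>v m" using ker mult_mat_vec_carrier[OF D v] unfolding K_def by blast
  qed
  have BA: "B * A = 1\<^sub>m m"
  proof (rule eq_matI)
    fix i j assume ij: "i < dim_row (1\<^sub>m m)" "j < dim_col (1\<^sub>m m)"
    have "(B * A - 1\<^sub>m m) $$ (i, j) = 0" using ij \<open>B * A - 1\<^sub>m m = 0\<^sub>m m m\<close> by simp
    thus "(B * A) $$ (i, j) = 1\<^sub>m m $$ (i, j)" using ij A B by simp
  qed (use A B in auto)
  show "\<exists>B\<in>carrier_mat m n. A * B = 1\<^sub>m n \<and> B * A = 1\<^sub>m m" using AB BA B by blast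
  \<comment> \<open>The traces of \<open>A * B\<close> and \<open>B * A\<close> are \<open>n\<close>
    and \<open>m\<close>.\<close>
  have "of_nat n = (of_nat m :: complex)"
    using trace_mult_comm[OF A B] AB BA by (simp add: trace_one)
  thus "n = m" by simp
qed

text \<open>Over the complex numbers \<open>A\<close> has an eigenvalue \<open>c\<close>; then
  \<open>A - c\<close> is an intertwiner with nonzero kernel, hence not invertible, hence
  zero.\<close>

lemma schur_scalar:
  assumes irr: "irreducible_representation G n \<rho>"
    and A: "A \<in> carrier_mat n n" and int: "\<And>g. g \<in> carrier G \<Longrightarrow> \<rho> g * A = A * \<rho> g"
  shows "\<exists>c. A = c \<cdot>\<^sub>m 1\<^sub>m n"
proof -
  have rep: "representation G n \<rho>" and n: "n > 0"
    using irr by (auto simp: irreducible_representation_def)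
  obtain es where es: "char_poly A = (\<Prod>e\<leftarrow>es. [:- e, 1:])" "length es = n"
    using char_poly_factorized[OF A] by blast
  then obtain c where "c \<in> set es" using n by (cases es) auto
  hence "poly (char_poly A) c = 0" by (auto simp: es poly_prod_list prod_list_zero_iff)
  hence "eigenvalue A c" using eigenvalue_root_char_poly[OF A] by blast
  then obtain v where v: "v \<in> carrier_vec n" "v \<noteq> 0\<^sub>v n" "A *\<^sub>v v = c \<cdot>\<^sub>v v"
    using A by (auto simp: eigenvalue_def eigenvector_def)
  define M where "M = A - c \<cdot>\<^sub>m 1\<^sub>m n"
  have M: "M \<in> carrier_mat n n" unfolding M_def by (rule minus_carrier_mat) simp
  have Mv: "M *\<^sub>v v = 0\<^sub>v n"
  proof -
    have "M *\<^sub>v v = A *\<^sub>v v - (c \<cdot>\<^sub>m 1\<^sub>m n) *\<^sub>v v"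
      unfolding M_def by (rule minus_mult_distrib_mat_vec[OF A _ v(1)]) simp
    also have "(c \<cdot>\<^sub>m 1\<^sub>m n) *\<^sub>v v = c \<cdot>\<^sub>v v"
      using v(1) by (intro eq_vecI) (simp_all add: row_smult)
    finally show ?thesis using v by simp
  qed
  have intM: "\<rho> g * M = M * \<rho> g" if "g \<in> carrier G" for g
  proof -
    have R: "\<rho> g \<in> carrier_mat n n" by (rule rep_carrier[OF rep that])
    have "\<rho> g * M = \<rho> g * A - \<rho> g * (c \<cdot>\<^sub>m 1\<^sub>m n)"
      unfolding M_def by (rule mult_minus_distrib_mat[OF R A]) simp
    also have "\<rho> g * (c \<cdot>\<^sub>m 1\<^sub>m n) = (c \<cdot>\<^sub>m 1\<^sub>m n) * \<rho> g"
      using R mult_smult_distrib[OF R one_carrier_mat, of c] mult_smult_assoc_mat[OF one_carrier_mat R, of c] by simp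
    also have "\<rho> g * A - \<dots> = M * \<rho> g"
      unfolding M_def int[OF that] by (rule minus_mult_distrib_mat[OF A _ R, symmetric]) simp
    finally show ?thesis .
  qed
  have "M = 0\<^sub>m n n"
  proof (rule ccontr)
    assume "M \<noteq> 0\<^sub>m n n"
    then obtain B where B: "B \<in> carrier_mat n n" "B * M = 1\<^sub>m n"
      using schur(2)[OF irr irr M intM] by blast
    have "v = (B * M) *\<^sub>v v" using B v by simp
    also have "\<dots> = B *\<^sub>v (M *\<^sub>v v)" by (rule assoc_mult_mat_vec[OF B(1) M v(1)])
    also have "\<dots> = 0\<^sub>v n" unfolding Mv by (rule mat_mult_zero_vec[OF B(1)])
    finally show False using v by simp
  qed
  hence "A = c \<cdot>\<^sub>m 1\<^sub>m n"
  proof -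
    have "A $$ (i, j) = (c \<cdot>\<^sub>m 1\<^sub>m n) $$ (i, j)" if "i < n" "j < n" for i j
      using arg_cong[OF \<open>M = 0\<^sub>m n n\<close>, of "\<lambda>M. M $$ (i, j)"] that A by (simp add: M_def)
    thus ?thesis using A by (intro eq_matI) auto
  qed
  thus ?thesis by blast
qed

text \<open>\<open>T\<close> is the sum of \<open>\<rho> g * E * \<sigma> (inv g)\<close> over the
  group, for the matrix unit \<open>E\<close> at position \<open>(a, b)\<close>. Its own entry at
  \<open>(a, b)\<close> is the sum of products of diagonal coefficients that occurs in the
  orthogonality relations.\<close>

lemma averaged_intertwiner:
  assumes rep: "representation G n \<rho>" "representation G m \<sigma>" and ab: "a < n" "b < m"
  defines "T \<equiv> mat n m (\<lambda>(i, j). \<Sum>g\<in>carrier G. \<rho> g $$ (i, a) * \<sigma> (inv g) $$ (b, j))"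
  assumes h: "h \<in> carrier G"
  shows "\<rho> h * T = T * \<sigma> h"
proof (rule eq_matI)
  have T: "T \<in> carrier_mat n m" by (simp add: T_def)
  note car = rep_carrier[OF rep(1) h] rep_carrier[OF rep(2) h]
  show "dim_row (\<rho> h * T) = dim_row (T * \<sigma> h)" "dim_col (\<rho> h * T) = dim_col (T * \<sigma> h)"
    using T car by auto
  fix i j assume "i < dim_row (T * \<sigma> h)" "j < dim_col (T * \<sigma> h)"
  hence ij: "i < n" "j < m" using T car by auto
  have "(\<rho> h * T) $$ (i, j) =
      (\<Sum>k<n. \<Sum>g\<in>carrier G. \<rho> h $$ (i, k) * \<rho> g $$ (k, a) * \<sigma> (inv g) $$ (b, j))"
    by (subst index_mult_mat_sum[OF car(1) T ij]) (simp add: T_def ij sum_distrib_left mult.assoc)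
  also have "\<dots> = (\<Sum>g\<in>carrier G. \<rho> (h \<otimes> g) $$ (i, a) * \<sigma> (inv g) $$ (b, j))"
    by (subst sum.swap) (simp add: rep_entry_mult[OF rep(1) h] ij ab sum_distrib_right)
  \<comment> \<open>Writing \<open>inv g\<close> as \<open>inv (h \<otimes> g) \<otimes> h\<close>
    makes the summand a function of \<open>h \<otimes> g\<close>, ready for translation.\<close>
  also have "\<dots> = (\<Sum>g\<in>carrier G. \<rho> (h \<otimes> g) $$ (i, a) * \<sigma> (inv (h \<otimes> g) \<otimes> h) $$ (b, j))"
    by (intro sum.cong refl) (simp add: inv_mult_group m_assoc h)
  also have "\<dots> = (\<Sum>g\<in>carrier G. \<rho> g $$ (i, a) * \<sigma> (inv g \<otimes> h) $$ (b, j))"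
    by (rule sum_translate[OF h])
  also have "\<dots> = (\<Sum>k<m. \<Sum>g\<in>carrier G. \<rho> g $$ (i, a) * \<sigma> (inv g) $$ (b, k) * \<sigma> h $$ (k, j))"
    by (subst sum.swap) (simp add: rep_entry_mult[OF rep(2) _ h] ij ab sum_distrib_left mult.assoc)
  also have "\<dots> = (T * \<sigma> h) $$ (i, j)"
    by (subst index_mult_mat_sum[OF T car(2) ij]) (simp add: T_def ij sum_distrib_right)
  finally show "(\<rho> h * T) $$ (i, j) = (T * \<sigma> h) $$ (i, j)" .
qed

lemma sum_trace_product:
  assumes rep: "representation G n \<rho>" "representation G m \<sigma>"
  shows "(\<Sum>g\<in>carrier G. trace (\<rho> g) * trace (\<sigma> (inv g))) =
    (\<Sum>a<n. \<Sum>b<m. \<Sum>g\<in>carrier G. \<rho> g $$ (a, a) * \<sigma> (inv g) $$ (b, b))"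
proof -
  have "(\<Sum>g\<in>carrier G. trace (\<rho> g) * trace (\<sigma> (inv g))) =
      (\<Sum>g\<in>carrier G. \<Sum>a<n. \<Sum>b<m. \<rho> g $$ (a, a) * \<sigma> (inv g) $$ (b, b))"
  proof (intro sum.cong refl)
    fix g assume g: "g \<in> carrier G"
    have "dim_row (\<rho> g) = n" "dim_row (\<sigma> (inv g)) = m"
      using rep_carrier[OF rep(1) g] rep_carrier[OF rep(2), of "inv g"] g by auto
    thus "trace (\<rho> g) * trace (\<sigma> (inv g)) = (\<Sum>a<n. \<Sum>b<m. \<rho> g $$ (a, a) * \<sigma> (inv g) $$ (b, b))"
      by (simp add: trace_def sum_product)
  qed
  also have "\<dots> = (\<Sum>a<n. \<Sum>b<m. \<Sum>g\<in>carrier G. \<rho> g $$ (a, a) * \<sigma> (inv g) $$ (b, b))"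
    by (subst sum.swap) (intro sum.cong refl sum.swap)
  finally show ?thesis .
qed

lemma trace_orthogonality_neq:
  assumes irr: "irreducible_representation G n \<rho>" "irreducible_representation G m \<sigma>"
    and neq: "\<exists>g\<in>carrier G. trace (\<rho> g) \<noteq> trace (\<sigma> g)"
  shows "(\<Sum>g\<in>carrier G. trace (\<rho> g) * trace (\<sigma> (inv g))) = 0"
proof -
  have rep: "representation G n \<rho>" "representation G m \<sigma>"
    using irr by (auto simp: irreducible_representation_def)
  have entry: "(\<Sum>g\<in>carrier G. \<rho> g $$ (a, a) * \<sigma> (inv g) $$ (b, b)) = 0" if ab: "a < n" "b < m" for a b
  proof -
    define T where "T = mat n m (\<lambda>(i, j). \<Sum>g\<in>carrier G. \<rho> g $$ (i, a) * \<sigma> (inv g) $$ (b, j))"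
    have T: "T \<in> carrier_mat n m" by (simp add: T_def)
    have int: "\<rho> g * T = T * \<sigma> g" if "g \<in> carrier G" for g
      unfolding T_def by (rule averaged_intertwiner[OF rep ab that])
    \<comment> \<open>An invertible intertwiner would make the two representations similar and their
      traces equal.\<close>
    have "T = 0\<^sub>m n m"
    proof (rule ccontr)
      assume nz: "T \<noteq> 0\<^sub>m n m"
      have nm: "n = m" by (rule schur(1)[OF irr T int nz])
      obtain B where B: "B \<in> carrier_mat m n" "T * B = 1\<^sub>m n" "B * T = 1\<^sub>m m"
        using schur(2)[OF irr T int nz] by blast
      have "trace (\<rho> g) = trace (\<sigma> g)" if g: "g \<in> carrier G" for g
      proof -
        have R: "\<rho> g \<in> carrier_mat n n" "\<sigma> g \<in> carrier_mat n n"
          using rep_carrier[OF rep(1) g] rep_carrier[OF rep(2) g] nm by auto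
        have "\<rho> g = \<rho> g * (T * B)" using B R by simp
        also have "\<dots> = T * \<sigma> g * B"
          using assoc_mult_mat[OF R(1) T B(1)] int[OF g] by simp
        finally show ?thesis using trace_conjugate[of T n B "\<sigma> g"] T B R nm by simp
      qed
      thus False using neq by blast
    qed
    hence "T $$ (a, b) = 0" using ab by simp
    thus ?thesis using ab by (simp add: T_def)
  qed
  have "(\<Sum>g\<in>carrier G. trace (\<rho> g) * trace (\<sigma> (inv g))) =
      (\<Sum>a<n. \<Sum>b<m. \<Sum>g\<in>carrier G. \<rho> g $$ (a, a) * \<sigma> (inv g) $$ (b, b))"
    by (rule sum_trace_product[OF rep])
  also have "\<dots> = 0" using entry by simp
  finally show ?thesis .
qed

lemma trace_orthogonality_eq:
  assumes irr: "irreducible_representation G n \<rho>"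
  shows "(\<Sum>g\<in>carrier G. trace (\<rho> g) * trace (\<rho> (inv g))) = of_nat (Coset.order G)"
proof -
  have rep: "representation G n \<rho>" and n: "n > 0"
    using irr by (auto simp: irreducible_representation_def)
  have entry: "(\<Sum>g\<in>carrier G. \<rho> g $$ (a, a) * \<rho> (inv g) $$ (b, b)) = (if a = b then of_nat (Coset.order G) / of_nat n else 0)"
    if ab: "a < n" "b < n" for a b
  proof -
    define T where "T = mat n n (\<lambda>(i, j). \<Sum>g\<in>carrier G. \<rho> g $$ (i, a) * \<rho> (inv g) $$ (b, j))"
    have T: "T \<in> carrier_mat n n" by (simp add: T_def)
    have int: "\<rho> g * T = T * \<rho> g" if "g \<in> carrier G" for g
      unfolding T_def by (rule averaged_intertwiner[OF rep rep ab that])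
    obtain c where c: "T = c \<cdot>\<^sub>m 1\<^sub>m n" using schur_scalar[OF irr T int] by blast
    \<comment> \<open>The scalar is found from the trace, which collapses to entries of
      \<open>\<rho> (inv g \<otimes> g)\<close>, that is, of the identity matrix.\<close>
    have "of_nat n * c = trace T" by (simp add: c trace_def)
    also have "\<dots> = (\<Sum>g\<in>carrier G. \<Sum>i<n. \<rho> (inv g) $$ (b, i) * \<rho> g $$ (i, a))"
      by (subst sum.swap) (simp add: trace_def T_def mult.commute)
    also have "\<dots> = (\<Sum>g\<in>carrier G. \<rho> (inv g \<otimes> g) $$ (b, a))"
      by (intro sum.cong refl rep_entry_mult[OF rep, symmetric]) (use ab in auto)
    also have "\<dots> = (\<Sum>g\<in>carrier G. if a = b then 1 else 0)"
      by (intro sum.cong refl) (use ab in \<open>simp add: rep_one[OF rep]\<close>)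
    also have "\<dots> = (if a = b then of_nat (Coset.order G) else 0)" by (simp add: Coset.order_def)
    finally have c': "c = (if a = b then of_nat (Coset.order G) / of_nat n else 0)"
      using n by (auto simp: field_simps)
    have "(\<Sum>g\<in>carrier G. \<rho> g $$ (a, a) * \<rho> (inv g) $$ (b, b)) = T $$ (a, b)"
      using ab by (simp add: T_def)
    thus ?thesis using ab c c' by simp
  qed
  have "(\<Sum>g\<in>carrier G. trace (\<rho> g) * trace (\<rho> (inv g))) =
      (\<Sum>a<n. \<Sum>b<n. \<Sum>g\<in>carrier G. \<rho> g $$ (a, a) * \<rho> (inv g) $$ (b, b))"
    by (rule sum_trace_product[OF rep rep])
  also have "\<dots> = (\<Sum>a<n. \<Sum>b<n. if a = b then of_nat (Coset.order G) / of_nat n else 0)"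
    using entry by simp
  also have "\<dots> = of_nat (Coset.order G)" using n by (simp add: sum.delta)
  finally show ?thesis .
qed

end

section \<open>Irreducible characters\<close>

lemma norm_root_of_unity:
  fixes b :: complex
  assumes "b ^ N = 1" "N > 0"
  shows "norm b = 1"
proof -
  have "norm b ^ N = 1 ^ N" using assms(1) by (metis norm_one norm_power power_one)
  thus ?thesis using assms(2) power_eq_imp_eq_base[of "norm b" N 1] by simp
qed

lemma sum_roots_of_unity_pow:
  fixes b \<mu> :: complex
  assumes "b ^ N = 1" "\<mu> ^ N = 1" "N > 0"
  shows "(\<Sum>i<N. cnj \<mu> ^ i * b ^ i) = (if b = \<mu> then of_nat N else 0)"
proof -
  have n: "norm \<mu> = 1" by (rule norm_root_of_unity[OF assms(2,3)])
  hence \<mu>: "cnj \<mu> * \<mu> = 1" by (metis complex_norm_square mult.commute of_real_1 power_one)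
  have eq: "cnj \<mu> * b = 1 \<longleftrightarrow> b = \<mu>"
  proof
    assume "cnj \<mu> * b = 1"
    hence "\<mu> * (cnj \<mu> * b) = \<mu>" by simp
    thus "b = \<mu>" using \<mu> by (metis mult.assoc mult.commute mult.left_neutral)
  qed (use \<mu> in simp)
  have "(\<Sum>i<N. cnj \<mu> ^ i * b ^ i) = (\<Sum>i<N. (cnj \<mu> * b) ^ i)" by (simp add: power_mult_distrib)
  also have "\<dots> = (if b = \<mu> then of_nat N else 0)"
  proof (cases "b = \<mu>")
    case True
    thus ?thesis using eq by simp
  next
    case False
    have "(cnj \<mu> * b) ^ N = 1" using assms by (simp add: power_mult_distrib flip: complex_cnj_power)
    thus ?thesis using False eq by (simp add: geometric_sum)
  qed
  finally show ?thesis .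
qed

lemma cnj_root_of_unity:
  fixes b :: complex
  assumes "b ^ N = 1" "N > 0"
  shows "b ^ (N - 1) = cnj b"
proof -
  have "norm b = 1" by (rule norm_root_of_unity[OF assms])
  hence "cnj b * b = 1" by (metis complex_norm_square mult.commute of_real_1 power_one)
  moreover have "b ^ (N - 1) * b = 1" using assms by (metis power_minus_mult)
  moreover have "b \<noteq> 0" using \<open>norm b = 1\<close> by auto
  ultimately show ?thesis by (metis mult_right_cancel)
qed

text \<open>Equality in the triangle inequality: the real parts are at most 1 and add up to the
  length, so each is 1.\<close>

lemma sum_list_eigenvalues_eq_length:
  fixes bs :: "complex list"
  assumes "\<And>b. b \<in> set bs \<Longrightarrow> norm b = 1" "(\<Sum>b\<leftarrow>bs. b) = of_nat (length bs)" "b \<in> set bs"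
  shows "b = 1"
proof -
  have re: "Re (\<Sum>b\<leftarrow>bs. b) = (\<Sum>b\<leftarrow>bs. Re b)" for bs :: "complex list" by (induction bs) auto
  have "(\<Sum>b\<leftarrow>bs. 1 - Re b) = 0"
    using re[of bs] assms(2) by (simp add: sum_list_subtractf sum_list_triv)
  moreover have "1 - Re b \<ge> 0" if "b \<in> set bs" for b
    using complex_Re_le_cmod[of b] assms(1)[OF that] by simp
  ultimately have "1 - Re b = 0"
    using assms(3) sum_list_nonneg_eq_0_iff[of "map (\<lambda>b. 1 - Re b) bs"] by fastforce
  moreover have "norm b = 1" by (rule assms(1)[OF assms(3)])
  ultimately have "Re b = 1" "(Re b)\<^sup>2 + (Im b)\<^sup>2 = 1" by (auto simp: cmod_def)
  thus ?thesis by (simp add: complex_eq_iff)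
qed

context finite_group
begin

lemma IrrE:
  assumes "\<chi> \<in> Irr G"
  obtains n \<rho> where "irreducible_representation G n \<rho>" "representation G n \<rho>" "n > 0"
    "\<And>g. g \<in> carrier G \<Longrightarrow> \<chi> g = trace (\<rho> g)" "\<chi> = (\<lambda>g\<in>carrier G. trace (\<rho> g))"
  using assms by (auto simp: Irr_def irreducible_representation_def)

lemma Irr_eqI:
  assumes "\<chi> \<in> Irr G" "\<psi> \<in> Irr G" "\<And>g. g \<in> carrier G \<Longrightarrow> \<chi> g = \<psi> g"
  shows "\<chi> = \<psi>"
  using assms by (auto elim!: IrrE simp: fun_eq_iff restrict_def)

text \<open>A single list, the eigenvalues of \<open>x\<close>, serves all powers of
  \<open>x\<close> at once; the multiplicity sums and the congruences modulo primes rest on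
  this.\<close>

lemma Irr_eigenvalues:
  assumes \<chi>: "\<chi> \<in> Irr G" and x: "x \<in> carrier G"
  obtains bs where "\<chi> \<one> = of_nat (length bs)" "bs \<noteq> []"
    "\<And>b N. b \<in> set bs \<Longrightarrow> N > 0 \<Longrightarrow> x [^] (N::nat) = \<one> \<Longrightarrow> b ^ N = 1"
    "\<And>i. \<chi> (x [^] (i::nat)) = (\<Sum>b\<leftarrow>bs. b ^ i)"
    "\<And>b. b \<in> set bs \<Longrightarrow> norm b = 1"
proof -
  obtain n \<rho> where rep: "representation G n \<rho>" "n > 0" "\<And>g. g \<in> carrier G \<Longrightarrow> \<chi> g = trace (\<rho> g)"
    using IrrE[OF \<chi>] by metis
  define N where "N = ord x"
  have N: "N > 0" using ord_ge_1[OF fin x] by (simp add: N_def)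
  have car: "\<rho> x \<in> carrier_mat n n" by (rule rep_carrier[OF rep(1) x])
  have "\<rho> x ^\<^sub>m N = 1\<^sub>m n"
    using rep_pow[OF rep(1) x, of N] rep_one[OF rep(1)] x by (simp add: N_def)
  from trace_pow_eigenvalues[OF car this N] obtain bs where bs: "length bs = n"
    "\<And>b. b \<in> set bs \<Longrightarrow> b ^ N = 1" "\<And>i. trace (\<rho> x ^\<^sub>m i) = (\<Sum>b\<leftarrow>bs. b ^ i)" by metis
  show ?thesis
  proof (rule that[of bs])
    show "\<chi> \<one> = of_nat (length bs)" by (simp add: rep rep_one[OF rep(1)] trace_one bs)
    show "bs \<noteq> []" using bs rep by auto
    show "b ^ M = 1" if b: "b \<in> set bs" and M: "M > 0" "x [^] M = \<one>" for b M
    proof -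
      have "N dvd M" using M x pow_eq_id N_def by metis
      thus ?thesis using bs(2)[OF b] by (auto simp: power_mult elim!: dvdE)
    qed
    show "\<chi> (x [^] i) = (\<Sum>b\<leftarrow>bs. b ^ i)" for i :: nat
      using rep(3)[of "x [^] i"] x rep_pow[OF rep(1) x] bs(3) by simp
    show "norm b = 1" if "b \<in> set bs" for b by (rule norm_root_of_unity[OF bs(2)[OF that] N])
  qed
qed

lemma Irr_one: 
  assumes "\<chi> \<in> Irr G"
  shows "\<exists>d::nat. d > 0 \<and> \<chi> \<one> = of_nat d"
  using Irr_eigenvalues[OF assms one_closed] by (metis length_greater_0_conv)

lemma norm_Irr_le:
  assumes "\<chi> \<in> Irr G" "x \<in> carrier G"
  shows "norm (\<chi> x) \<le> Re (\<chi> \<one>)"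
proof -
  obtain bs where bs: "\<chi> \<one> = of_nat (length bs)" "\<And>i. \<chi> (x [^] (i::nat)) = (\<Sum>b\<leftarrow>bs. b ^ i)"
    "\<And>b. b \<in> set bs \<Longrightarrow> norm b = 1" using Irr_eigenvalues[OF assms] by metis
  have "norm (\<Sum>b\<leftarrow>bs. b) \<le> (\<Sum>b\<leftarrow>bs. norm b)" by (induction bs) (auto intro: order_trans[OF norm_triangle_ineq])
  also have "(\<Sum>b\<leftarrow>bs. norm b) = (\<Sum>b\<leftarrow>bs. 1)" using bs(3) by (intro arg_cong[of _ _ sum_list] map_cong) auto
  finally show ?thesis using bs(1) bs(2)[of 1] assms(2) by (simp add: sum_list_triv)
qed

lemma Irr_inv:
  assumes "\<chi> \<in> Irr G" "x \<in> carrier G"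
  shows "\<chi> (inv x) = cnj (\<chi> x)"
proof -
  obtain bs where bs: "\<And>b N. b \<in> set bs \<Longrightarrow> N > 0 \<Longrightarrow> x [^] (N::nat) = \<one> \<Longrightarrow> b ^ N = 1" 
    "\<And>i. \<chi> (x [^] (i::nat)) = (\<Sum>b\<leftarrow>bs. b ^ i)" using Irr_eigenvalues[OF assms] by metis
  have "\<chi> (inv x) = (\<Sum>b\<leftarrow>bs. b ^ (Coset.order G - 1))"
    using bs(2) inv_eq_pow assms(2) by simp
  also have "\<dots> = (\<Sum>b\<leftarrow>bs. cnj b)"
    using bs(1) pow_order[OF assms(2)] order_pos
    by (intro arg_cong[of _ _ sum_list] map_cong refl cnj_root_of_unity) auto
  also have "\<dots> = cnj (\<Sum>b\<leftarrow>bs. b)" by (induction bs) auto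
  finally show ?thesis using bs(2)[of 1] assms(2) by simp
qed

lemma Irr_conj:
  assumes \<chi>: "\<chi> \<in> Irr G" and "g \<in> carrier G" "x \<in> carrier G"
  shows "\<chi> (g \<otimes> x \<otimes> inv g) = \<chi> x"
proof -
  obtain n \<rho> where rep: "representation G n \<rho>" "\<And>g. g \<in> carrier G \<Longrightarrow> \<chi> g = trace (\<rho> g)"
    using IrrE[OF \<chi>] by metis
  have "trace (\<rho> g * \<rho> x * \<rho> (inv g)) = trace (\<rho> x)"
    using trace_conjugate[of "\<rho> g" n "\<rho> (inv g)" "\<rho> x"] rep_carrier[OF rep(1)] rep_inv[OF rep(1), of "inv g"] assms
    by simp
  thus ?thesis using assms rep(2) rep_mult[OF rep(1)] by simp
qed

text \<open>\<open>c\<close> is the multiplicity of the eigenvalue \<open>\<mu>\<close> of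
  \<open>x\<close>. Integrality of such multiplicities is the source of the later divisibilities by
  the order of an element modulo \<open>N\<close>.\<close>

lemma Irr_multiplicity:
  assumes \<chi>: "\<chi> \<in> Irr G" and x: "x \<in> carrier G" and N: "N > 0" "x [^] (N::nat) = \<one>" and \<mu>: "\<mu> ^ N = 1"
  shows "\<exists>c::nat. (\<Sum>i<N. cnj \<mu> ^ i * \<chi> (x [^] i)) = of_nat (N * c)"
proof -
  obtain bs where bs: "\<And>b N. b \<in> set bs \<Longrightarrow> N > 0 \<Longrightarrow> x [^] (N::nat) = \<one> \<Longrightarrow> b ^ N = 1" 
    "\<And>i. \<chi> (x [^] (i::nat)) = (\<Sum>b\<leftarrow>bs. b ^ i)" using Irr_eigenvalues[OF \<chi> x] by metis
  have "(\<Sum>i<N. cnj \<mu> ^ i * (\<Sum>b\<leftarrow>cs. b ^ i)) = of_nat (N * count_list cs \<mu>)" if "\<forall>b\<in>set cs. b ^ N = 1" for cs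
    using that
  proof (induction cs)
    case (Cons b cs)
    have "(\<Sum>i<N. cnj \<mu> ^ i * (\<Sum>b\<leftarrow>b # cs. b ^ i)) =
        (\<Sum>i<N. cnj \<mu> ^ i * b ^ i) + (\<Sum>i<N. cnj \<mu> ^ i * (\<Sum>b\<leftarrow>cs. b ^ i))"
      by (simp add: distrib_left sum.distrib)
    thus ?case using Cons sum_roots_of_unity_pow[of b N \<mu>] N \<mu> by (simp add: algebra_simps)
  qed simp
  thus ?thesis using bs N by fastforce
qed

text \<open>At the value \<open>\<chi> \<one>\<close> all eigenvalues are 1, and a matrix of finite
  order with only this eigenvalue is the identity.\<close>

lemma Irr_kernel:
  assumes \<chi>: "\<chi> \<in> Irr G"
  shows "subgroup {z \<in> carrier G. \<chi> z = \<chi> \<one>} G"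
    and "\<And>x z. x \<in> carrier G \<Longrightarrow> z \<in> carrier G \<Longrightarrow> \<chi> z = \<chi> \<one> \<Longrightarrow> \<chi> (x \<otimes> z) = \<chi> x"
proof -
  obtain n \<rho> where rep: "representation G n \<rho>" "\<And>g. g \<in> carrier G \<Longrightarrow> \<chi> g = trace (\<rho> g)"
    using IrrE[OF \<chi>] by metis
  have triv: "\<rho> z = 1\<^sub>m n" if z: "z \<in> carrier G" "\<chi> z = \<chi> \<one>" for z
  proof -
    have car: "\<rho> z \<in> carrier_mat n n" by (rule rep_carrier[OF rep(1) z(1)])
    have "\<rho> z ^\<^sub>m Coset.order G = 1\<^sub>m n"
      using rep_pow[OF rep(1) z(1)] rep_one[OF rep(1)] pow_order[OF z(1)] by metis
    from trace_pow_eigenvalues[OF car this order_pos] obtain bs where bs: "length bs = n"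
      "\<And>b. b \<in> set bs \<Longrightarrow> b ^ Coset.order G = 1" "\<And>i. trace (\<rho> z ^\<^sub>m i) = (\<Sum>b\<leftarrow>bs. b ^ i)"
      "(\<And>b. b \<in> set bs \<Longrightarrow> b = 1) \<Longrightarrow> \<rho> z = 1\<^sub>m n" by metis
    have "norm b = 1" if "b \<in> set bs" for b by (rule norm_root_of_unity[OF bs(2)[OF that] order_pos])
    moreover have "(\<Sum>b\<leftarrow>bs. b) = of_nat (length bs)"
      using bs(1) bs(3)[of 1] car z rep(2)[OF z(1)] rep(2)[OF one_closed] by (simp add: rep_one[OF rep(1)] trace_one)
    ultimately show ?thesis using bs(4) sum_list_eigenvalues_eq_length[of bs] by blast
  qed
  show *: "\<chi> (x \<otimes> z) = \<chi> x" if "x \<in> carrier G" "z \<in> carrier G" "\<chi> z = \<chi> \<one>" for x z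
    using that triv[of z] rep rep_carrier[OF rep(1), of x] by (simp add: rep_mult[OF rep(1)])
  show "subgroup {z \<in> carrier G. \<chi> z = \<chi> \<one>} G"
  proof (rule subgroupI)
    fix z assume "z \<in> {z \<in> carrier G. \<chi> z = \<chi> \<one>}"
    thus "inv z \<in> {z \<in> carrier G. \<chi> z = \<chi> \<one>}" using *[of "inv z" z] by simp
  qed (use * in auto)
qed

text \<open>The sum of the \<open>\<rho> s\<close> is \<open>card S\<close> times a projection, so
  \<open>c\<close> is the multiplicity of the trivial character in the restriction to
  \<open>S\<close>.\<close>

lemma Irr_subgroup_sum:
  assumes \<chi>: "\<chi> \<in> Irr G" and S: "subgroup S G"
  shows "\<exists>c::nat. (\<Sum>s\<in>S. \<chi> s) = of_nat (c * card S)"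
proof -
  interpret S: subgroup S G by (rule S)
  obtain n \<rho> where rep: "representation G n \<rho>" "\<And>g. g \<in> carrier G \<Longrightarrow> \<chi> g = trace (\<rho> g)"
    using IrrE[OF \<chi>] by metis
  define T where "T = mat n n (\<lambda>(i, j). \<Sum>s\<in>S. \<rho> s $$ (i, j))"
  have T: "T \<in> carrier_mat n n" by (simp add: T_def)
  have "T * T = of_nat (card S) \<cdot>\<^sub>m T"
  proof (rule eq_matI)
    fix i j assume "i < dim_row (of_nat (card S) \<cdot>\<^sub>m T)" "j < dim_col (of_nat (card S) \<cdot>\<^sub>m T)"
    hence ij: "i < n" "j < n" by (auto simp: T_def)
    have "(T * T) $$ (i, j) = (\<Sum>k<n. \<Sum>s\<in>S. \<Sum>t\<in>S. \<rho> s $$ (i, k) * \<rho> t $$ (k, j))"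
      by (subst index_mult_mat_sum[OF T T ij]) (simp add: T_def ij sum_product)
    also have "\<dots> = (\<Sum>s\<in>S. \<Sum>k<n. \<Sum>t\<in>S. \<rho> s $$ (i, k) * \<rho> t $$ (k, j))" by (rule sum.swap)
    also have "\<dots> = (\<Sum>s\<in>S. \<Sum>t\<in>S. \<Sum>k<n. \<rho> s $$ (i, k) * \<rho> t $$ (k, j))"
      by (intro sum.cong refl sum.swap)
    also have "\<dots> = (\<Sum>s\<in>S. \<Sum>t\<in>S. \<rho> (s \<otimes> t) $$ (i, j))"
      by (intro sum.cong refl rep_entry_mult[OF rep(1), symmetric] ij) auto
    also have "\<dots> = (\<Sum>s\<in>S. \<Sum>t\<in>S. \<rho> t $$ (i, j))"
    proof (rule sum.cong[OF refl])
      fix s assume s: "s \<in> S"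
      show "(\<Sum>t\<in>S. \<rho> (s \<otimes> t) $$ (i, j)) = (\<Sum>t\<in>S. \<rho> t $$ (i, j))"
        by (rule sum.reindex_bij_witness[of _ "\<lambda>g. inv s \<otimes> g" "\<lambda>g. s \<otimes> g"])
           (use s in \<open>auto simp: m_assoc[symmetric]\<close>)
    qed
    also have "\<dots> = (of_nat (card S) \<cdot>\<^sub>m T) $$ (i, j)" using ij by (simp add: T_def)
    finally show "(T * T) $$ (i, j) = (of_nat (card S) \<cdot>\<^sub>m T) $$ (i, j)" .
  qed (simp_all add: T_def)
  from trace_quasi_idempotent[OF T this] obtain k :: nat where "trace T = of_nat k * of_nat (card S)" by blast
  moreover have "trace T = (\<Sum>s\<in>S. \<chi> s)"
  proof -
    have "(\<Sum>s\<in>S. \<chi> s) = (\<Sum>s\<in>S. \<Sum>i<n. \<rho> s $$ (i, i))"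
    proof (rule sum.cong[OF refl])
      fix s assume "s \<in> S"
      hence s: "s \<in> carrier G" by simp
      show "\<chi> s = (\<Sum>i<n. \<rho> s $$ (i, i))"
        using rep(2)[OF s] rep_carrier[OF rep(1) s] by (auto simp: trace_def)
    qed
    also have "\<dots> = (\<Sum>i<n. \<Sum>s\<in>S. \<rho> s $$ (i, i))" by (rule sum.swap)
    finally show ?thesis by (simp add: trace_def T_def)
  qed
  ultimately show ?thesis by auto
qed

lemma Irr_orthogonality:
  assumes "\<chi> \<in> Irr G" "\<psi> \<in> Irr G"
  shows "(\<Sum>g\<in>carrier G. \<chi> g * cnj (\<psi> g)) = (if \<chi> = \<psi> then of_nat (Coset.order G) else 0)"
proof -
  obtain n \<rho> where \<rho>: "irreducible_representation G n \<rho>" "\<And>g. g \<in> carrier G \<Longrightarrow> \<chi> g = trace (\<rho> g)"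
    using IrrE[OF assms(1)] by metis
  obtain m \<sigma> where \<sigma>: "irreducible_representation G m \<sigma>" "\<And>g. g \<in> carrier G \<Longrightarrow> \<psi> g = trace (\<sigma> g)"
    using IrrE[OF assms(2)] by metis
  show ?thesis
  proof (cases "\<chi> = \<psi>")
    case True
    have inv: "cnj (\<chi> g) = trace (\<rho> (inv g))" if "g \<in> carrier G" for g
      using Irr_inv[OF assms(1) that] \<rho>(2)[of "inv g"] that by simp
    have "(\<Sum>g\<in>carrier G. \<chi> g * cnj (\<chi> g)) = (\<Sum>g\<in>carrier G. trace (\<rho> g) * trace (\<rho> (inv g)))"
      by (intro sum.cong refl) (metis inv \<rho>(2))
    thus ?thesis using True trace_orthogonality_eq[OF \<rho>(1)] by simp
  next
    case False
    hence "\<exists>g\<in>carrier G. trace (\<rho> g) \<noteq> trace (\<sigma> g)" using Irr_eqI[OF assms] \<rho> \<sigma> by metis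
    moreover have inv: "cnj (\<psi> g) = trace (\<sigma> (inv g))" if "g \<in> carrier G" for g
      using Irr_inv[OF assms(2) that] \<sigma>(2)[of "inv g"] that by simp
    have "(\<Sum>g\<in>carrier G. \<chi> g * cnj (\<psi> g)) = (\<Sum>g\<in>carrier G. trace (\<rho> g) * trace (\<sigma> (inv g)))"
      by (intro sum.cong refl) (simp add: inv \<rho>)
    ultimately show ?thesis using False trace_orthogonality_neq[OF \<rho>(1) \<sigma>(1)] by simp
  qed
qed

lemma trivial_Irr: "(\<lambda>g\<in>carrier G. 1) \<in> Irr G"
proof -
  have U: "1\<^sub>m 1 \<in> Units (ring_mat TYPE(complex) 1 ())"
    by (auto simp: Units_def ring_mat_simps intro!: bexI[of _ "1\<^sub>m 1"])
  have "representation G 1 (\<lambda>_. 1\<^sub>m 1)"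
    unfolding representation_def by (rule homI) (use U in \<open>auto simp: units_of_def ring_mat_simps\<close>)
  moreover have "W = {0\<^sub>v 1} \<or> W = carrier_vec 1"
    if W: "VectorSpace.subspace class_ring W (module_vec TYPE(complex) 1)" for W
  proof (cases "W = {0\<^sub>v 1}")
    case False
    have sub: "W \<subseteq> carrier_vec 1" "0\<^sub>v 1 \<in> W" "\<And>c v. v \<in> W \<Longrightarrow> c \<cdot>\<^sub>v v \<in> W"
      using W by (auto simp: VectorSpace.subspace_def LinearCombinations.submodule_def module_vec_simps)
    then obtain w where w: "w \<in> W" "w \<noteq> 0\<^sub>v 1" using False by blast
    hence wc: "w \<in> carrier_vec 1" using sub by blast
    hence nz: "w $ 0 \<noteq> 0" using w(2) by auto
    have "v \<in> W" if v: "v \<in> carrier_vec 1" for v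
    proof -
      have "v = (v $ 0 / w $ 0) \<cdot>\<^sub>v w" using v wc nz by (intro eq_vecI) auto
      thus ?thesis using sub(3)[OF w(1)] by metis
    qed
    thus ?thesis using sub(1) by blast
  qed simp
  ultimately have "irreducible_representation G 1 (\<lambda>_. 1\<^sub>m 1)"
    by (auto simp: irreducible_representation_def)
  moreover have "trace (1\<^sub>m 1) = 1" by (simp add: trace_one)
  ultimately show ?thesis unfolding Irr_def by (auto intro!: exI[of _ "1::nat"] exI[of _ "\<lambda>_. 1\<^sub>m 1"])
qed

end

section \<open>Congruences between sums of roots of unity\<close>

hide_const (open) up_ring.coeff up_ring.monom

text \<open>The ring generated by \<open>\<zeta>\<close>. It is used with a root of unity chosen so
  that the characters of both groups take their values in it.\<close>

definition int_span :: "complex \<Rightarrow> complex set" where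
  "int_span \<zeta> = range (\<lambda>p. poly (of_int_poly p) \<zeta>)"

lemma int_span_add: "a \<in> int_span \<zeta> \<Longrightarrow> b \<in> int_span \<zeta> \<Longrightarrow> a + b \<in> int_span \<zeta>"
  unfolding int_span_def by (auto simp flip: poly_add of_int_poly_hom.hom_add)

lemma int_span_diff: "a \<in> int_span \<zeta> \<Longrightarrow> b \<in> int_span \<zeta> \<Longrightarrow> a - b \<in> int_span \<zeta>"
  unfolding int_span_def by (auto simp flip: poly_diff of_int_poly_hom.hom_minus)

lemma int_span_mult: "a \<in> int_span \<zeta> \<Longrightarrow> b \<in> int_span \<zeta> \<Longrightarrow> a * b \<in> int_span \<zeta>"
  unfolding int_span_def by (auto simp flip: poly_mult of_int_poly_hom.hom_mult)

lemma int_span_of_int: "of_int c \<in> int_span \<zeta>"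
  unfolding int_span_def by (rule range_eqI[of _ _ "[:c:]"]) (simp add: of_int_hom.map_poly_pCons_hom)

lemma int_span_of_nat: "of_nat c \<in> int_span \<zeta>"
  using int_span_of_int[of "int c"] by simp

lemma int_span_0: "0 \<in> int_span \<zeta>" and int_span_1: "1 \<in> int_span \<zeta>"
  using int_span_of_int[of 0] int_span_of_int[of 1] by simp_all

lemma int_span_self: "\<zeta> \<in> int_span \<zeta>"
  unfolding int_span_def by (rule range_eqI[of _ _ "[:0, 1:]"]) (simp add: of_int_hom.map_poly_pCons_hom)

lemma int_span_power: "a \<in> int_span \<zeta> \<Longrightarrow> a ^ n \<in> int_span \<zeta>"
  by (induction n) (auto intro: int_span_1 int_span_mult)

lemma int_span_sum: "(\<And>i. i \<in> I \<Longrightarrow> f i \<in> int_span \<zeta>) \<Longrightarrow> (\<Sum>i\<in>I. f i) \<in> int_span \<zeta>"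
  by (induction I rule: infinite_finite_induct) (auto intro: int_span_0 int_span_add)

lemma int_span_sum_list: "(\<And>b. b \<in> set bs \<Longrightarrow> f b \<in> int_span \<zeta>) \<Longrightarrow> (\<Sum>b\<leftarrow>bs. f b) \<in> int_span \<zeta>"
  by (induction bs) (auto intro: int_span_0 int_span_add)

lemma root_of_unity_int_span:
  assumes "b ^ M = 1" "M > 0"
  shows "b \<in> int_span (cis (2 * pi / M))"
proof -
  have "b \<in> (\<lambda>k. cis (2 * pi * real k / real M)) ` {..<M}"
    using bij_betw_roots_unity[OF assms(2)] assms(1) by (auto simp: bij_betw_def)
  then obtain k where "b = cis (2 * pi * real k / real M)" by blast
  also have "\<dots> = cis (2 * pi / M) ^ k" by (simp add: DeMoivre mult_ac)
  finally show ?thesis using int_span_power[OF int_span_self] by simp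
qed

text \<open>Multiplication by \<open>w\<close> acts on the vector of powers of
  \<open>\<zeta>\<close> through an integer matrix, so \<open>w\<close> is an eigenvalue of it and a
  root of a monic integer polynomial. The vector is an eigenvector whether or not the powers are
  linearly independent.\<close>

lemma int_span_algebraic_int:
  assumes w: "w \<in> int_span \<zeta>" and \<zeta>: "\<zeta> ^ M = 1" and M: "M > 0"
  shows "algebraic_int w"
proof -
  obtain p where p: "w = poly (of_int_poly p) \<zeta>" using w by (auto simp: int_span_def)
  \<comment> \<open>Row \<open>r\<close> expresses \<open>w * \<zeta> ^ r\<close> through the powers
    below \<open>M\<close>, with exponents reduced modulo \<open>M\<close>.\<close>
  define A where "A = mat M M (\<lambda>(r, s). \<Sum>i | i \<le> degree p \<and> (i + r) mod M = s. coeff p i)"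
  have A: "A \<in> carrier_mat M M" by (simp add: A_def)
  define v where "v = vec M (\<lambda>s. \<zeta> ^ s)"
  have red: "\<zeta> ^ k = \<zeta> ^ (k mod M)" for k
    using \<zeta> by (metis mult.left_neutral mod_mult_div_eq power_add power_mult power_one mult.commute)
  have "map_mat of_int A *\<^sub>v v = w \<cdot>\<^sub>v v"
  proof (rule eq_vecI)
    fix r assume "r < dim_vec (w \<cdot>\<^sub>v v)"
    hence r: "r < M" by (simp add: v_def)
    have "(map_mat of_int A *\<^sub>v v) $ r = (\<Sum>s<M. of_int (A $$ (r, s)) * \<zeta> ^ s)"
      using A r by (simp add: scalar_prod_def v_def atLeast0LessThan)
    also have "\<dots> = (\<Sum>s<M. \<Sum>i | i \<in> {..degree p} \<and> (i + r) mod M = s. of_int (coeff p i) * \<zeta> ^ (i + r))"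
    proof (rule sum.cong[OF refl])
      fix s assume "s \<in> {..<M}"
      hence "of_int (A $$ (r, s)) * \<zeta> ^ s = (\<Sum>i | i \<in> {..degree p} \<and> (i + r) mod M = s. of_int (coeff p i) * \<zeta> ^ s)"
        using r by (simp add: A_def sum_distrib_right)
      also have "\<dots> = (\<Sum>i | i \<in> {..degree p} \<and> (i + r) mod M = s. of_int (coeff p i) * \<zeta> ^ (i + r))"
        by (rule sum.cong[OF refl]) (metis (mono_tags, lifting) mem_Collect_eq red)
      finally show "of_int (A $$ (r, s)) * \<zeta> ^ s = \<dots>" .
    qed
    also have "\<dots> = (\<Sum>i\<le>degree p. of_int (coeff p i) * \<zeta> ^ (i + r))"
      by (rule sum.group) (use M in auto)
    also have "\<dots> = w * \<zeta> ^ r"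
      by (simp add: p poly_altdef sum_distrib_right power_add mult.assoc)
    finally show "(map_mat of_int A *\<^sub>v v) $ r = (w \<cdot>\<^sub>v v) $ r" using r by (simp add: v_def)
  qed (use A in \<open>simp add: v_def\<close>)
  moreover have "v \<noteq> 0\<^sub>v M"
  proof
    assume "v = 0\<^sub>v M"
    hence "v $ 0 = 0" using M by simp
    thus False using M by (simp add: v_def)
  qed
  ultimately have "eigenvalue (map_mat of_int A) w"
    using A unfolding eigenvalue_def eigenvector_def by (intro exI[of _ v]) (auto simp: v_def)
  hence "poly (char_poly (map_mat of_int A)) w = 0"
    using eigenvalue_root_char_poly[of "map_mat of_int A" M w] A by simp
  hence "poly (of_int_poly (char_poly A)) w = 0" by (simp add: of_int_hom.char_poly_hom[OF A])
  moreover have "lead_coeff (char_poly A) = 1" using degree_monic_char_poly[OF A] by simp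
  ultimately show ?thesis by (auto simp: algebraic_int_altdef_ipoly)
qed

text \<open>\<open>w\<close> is rational and an algebraic integer, hence an integer.\<close>

lemma int_dvd_if_int_span:
  assumes w: "w \<in> int_span \<zeta>" and \<zeta>: "\<zeta> ^ M = 1" and M: "M > 0"
    and eq: "of_int c = of_int l * w" and l: "l \<noteq> 0"
  shows "l dvd c"
proof -
  have w': "w = of_int c / of_int l" using eq l by (simp add: field_simps)
  hence "w \<in> \<rat>" by simp
  hence "w \<in> \<int>" using rational_algebraic_int_is_int int_span_algebraic_int[OF w \<zeta> M] by blast
  then obtain z where "w = of_int z" by (auto elim: Ints_cases)
  hence "(of_int c :: complex) = of_int (l * z)" using eq by simp
  hence "c = l * z" by (simp only: of_int_eq_iff)
  thus ?thesis by simp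
qed

lemma int_span_frobenius_add:
  assumes "prime l" "a \<in> int_span \<zeta>" "b \<in> int_span \<zeta>"
  shows "\<exists>w\<in>int_span \<zeta>. (a + b) ^ l = a ^ l + b ^ l + of_nat l * w"
proof -
  have l: "l > 0" using assms(1) by (simp add: prime_gt_0_nat)
  have "(a + b) ^ l = (\<Sum>k\<le>l. of_nat (l choose k) * a ^ k * b ^ (l - k))" by (rule binomial_ring)
  also have "{..l} = insert 0 (insert l {0<..<l})" by auto
  also have "(\<Sum>k\<in>\<dots>. of_nat (l choose k) * a ^ k * b ^ (l - k)) =
      b ^ l + (a ^ l + (\<Sum>k\<in>{0<..<l}. of_nat (l choose k) * a ^ k * b ^ (l - k)))"
    using l by simp
  also have "(\<Sum>k\<in>{0<..<l}. of_nat (l choose k) * a ^ k * b ^ (l - k)) =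
      of_nat l * (\<Sum>k\<in>{0<..<l}. of_nat ((l choose k) div l) * a ^ k * b ^ (l - k))"
    unfolding sum_distrib_left
  proof (rule sum.cong[OF refl])
    fix k assume "k \<in> {0<..<l}"
    hence "l dvd l choose k" using assms(1) by (intro dvd_choose_prime) auto
    hence "of_nat (l choose k) = (of_nat l * of_nat ((l choose k) div l) :: complex)"
      by (metis dvd_mult_div_cancel of_nat_mult)
    thus "of_nat (l choose k) * a ^ k * b ^ (l - k) = of_nat l * (of_nat ((l choose k) div l) * a ^ k * b ^ (l - k))"
      by simp
  qed
  finally show ?thesis
    using assms by (intro bexI[of _ "\<Sum>k\<in>{0<..<l}. of_nat ((l choose k) div l) * a ^ k * b ^ (l - k)"])
      (auto simp: algebra_simps intro!: int_span_sum int_span_mult int_span_power int_span_of_nat)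
qed

lemma int_span_frobenius_sum_list:
  assumes "prime l" "\<forall>b\<in>set bs. b \<in> int_span \<zeta>"
  shows "\<exists>w\<in>int_span \<zeta>. (\<Sum>b\<leftarrow>bs. b) ^ l = (\<Sum>b\<leftarrow>bs. b ^ l) + of_nat l * w"
  using assms(2)
proof (induction bs)
  case Nil
  thus ?case using assms(1) by (intro bexI[of _ 0] int_span_0) (auto simp: prime_gt_0_nat)
next
  case (Cons b bs)
  obtain w where w: "w \<in> int_span \<zeta>" "(\<Sum>b\<leftarrow>bs. b) ^ l = (\<Sum>b\<leftarrow>bs. b ^ l) + of_nat l * w"
    using Cons by auto
  have "(\<Sum>b\<leftarrow>bs. b) \<in> int_span \<zeta>" using Cons.prems int_span_sum_list[of bs "\<lambda>b. b"] by simp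
  then obtain w' where w': "w' \<in> int_span \<zeta>"
    "(b + (\<Sum>b\<leftarrow>bs. b)) ^ l = b ^ l + (\<Sum>b\<leftarrow>bs. b) ^ l + of_nat l * w'"
    using int_span_frobenius_add[OF assms(1), of b \<zeta> "\<Sum>b\<leftarrow>bs. b"] Cons.prems by auto
  have "w + w' \<in> int_span \<zeta>" using w w' by (simp add: int_span_add)
  thus ?case using w w' by (intro bexI[of _ "w + w'"]) (auto simp: algebra_simps)
qed

lemma (in finite_group) Irr_int_span:
  assumes \<chi>: "\<chi> \<in> Irr G" and x: "x \<in> carrier G" and M: "Coset.order G dvd M" "M > 0"
  shows "\<chi> x \<in> int_span (cis (2 * pi / M))"
    and "prime l \<Longrightarrow> \<exists>w\<in>int_span (cis (2 * pi / M)). \<chi> x ^ l = \<chi> (x [^] (l::nat)) + of_nat l * w"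
proof -
  obtain bs where bs: "\<And>b N. b \<in> set bs \<Longrightarrow> N > 0 \<Longrightarrow> x [^] (N::nat) = \<one> \<Longrightarrow> b ^ N = 1" 
    "\<And>i. \<chi> (x [^] (i::nat)) = (\<Sum>b\<leftarrow>bs. b ^ i)" using Irr_eigenvalues[OF \<chi> x] by metis
  have b: "b \<in> int_span (cis (2 * pi / M))" if "b \<in> set bs" for b
  proof -
    have "b ^ Coset.order G = 1" using bs(1)[OF that] order_pos pow_order[OF x] by blast
    hence "b ^ M = 1" using M by (auto simp: power_mult elim!: dvdE)
    thus ?thesis using root_of_unity_int_span M by blast
  qed
  have x1: "\<chi> x = (\<Sum>b\<leftarrow>bs. b)" using bs(2)[of 1] x by simp
  show "\<chi> x \<in> int_span (cis (2 * pi / M))" unfolding x1 using int_span_sum_list[of bs "\<lambda>b. b"] b by blast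
  show "\<exists>w\<in>int_span (cis (2 * pi / M)). \<chi> x ^ l = \<chi> (x [^] (l::nat)) + of_nat l * w" if "prime l"
    unfolding x1 bs(2) using int_span_frobenius_sum_list[OF that] b by blast
qed

section \<open>Elements of prime power order\<close>

context finite_group
begin

text \<open>If no orbit were a singleton, all orbit lengths would be divisible by \<open>q\<close>,
  and so would \<open>card \<Delta>\<close>. The action is given as a plain function and restricted
  to \<open>\<Delta>\<close> to obtain a homomorphism into its bijections.\<close>

lemma p_group_fixed_point:
  assumes q: "prime q" and card: "Coset.order G = q ^ n" and fin\<Delta>: "finite \<Delta>"
    and act: "\<And>g D. g \<in> carrier G \<Longrightarrow> D \<in> \<Delta> \<Longrightarrow> act g D \<in> \<Delta>"
      "\<And>D. D \<in> \<Delta> \<Longrightarrow> act \<one> D = D"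
      "\<And>g h D. g \<in> carrier G \<Longrightarrow> h \<in> carrier G \<Longrightarrow> D \<in> \<Delta> \<Longrightarrow> act (g \<otimes> h) D = act g (act h D)"
    and nd: "\<not> q dvd card \<Delta>"
  shows "\<exists>D\<in>\<Delta>. \<forall>g\<in>carrier G. act g D = D"
proof -
  define \<phi> where "\<phi> = (\<lambda>g. \<lambda>D\<in>\<Delta>. act g D)"
  have inv: "act (inv g) (act g D) = D" "act g (act (inv g) D) = D" if "g \<in> carrier G" "D \<in> \<Delta>" for g D
    using that act(2) act(3)[of "inv g" g D] act(3)[of g "inv g" D] by simp_all
  have bij: "\<phi> g \<in> Bij \<Delta>" if g: "g \<in> carrier G" for g
  proof -
    have "bij_betw (act g) \<Delta> \<Delta>"
      by (rule bij_betw_byWitness[of _ "act (inv g)"]) (use inv[OF g] act(1) g in auto)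
    thus ?thesis by (simp add: Bij_def \<phi>_def)
  qed
  have "group_hom G (BijGroup \<Delta>) \<phi>"
  proof (intro group_hom.intro group_hom_axioms.intro is_group group_BijGroup homI)
    show "\<phi> g \<in> carrier (BijGroup \<Delta>)" if "g \<in> carrier G" for g using bij[OF that] by (simp add: BijGroup_def)
    fix g h assume gh: "g \<in> carrier G" "h \<in> carrier G"
    show "\<phi> (g \<otimes> h) = \<phi> g \<otimes>\<^bsub>BijGroup \<Delta>\<^esub> \<phi> h"
      using gh bij act by (auto simp: BijGroup_def \<phi>_def compose_def fun_eq_iff)
  qed
  then interpret A: group_action G \<Delta> \<phi> by (rule group_action.intro)
  show ?thesis
  proof (rule ccontr)
    assume no: "\<not> ?thesis"
    have "q dvd card Ob" if Ob: "Ob \<in> orbits G \<Delta> \<phi>" for Ob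
    proof -
      obtain D where D: "D \<in> \<Delta>" "Ob = orbit G \<phi> D" using Ob by (auto simp: orbits_def)
      have "card Ob dvd q ^ n" using A.orbit_stabilizer_theorem[OF D(1)] D(2) card by (metis dvd_triv_left)
      then obtain i where i: "card Ob = q ^ i" using q divides_primepow_nat by blast
      moreover have "i \<noteq> 0"
      proof
        assume "i = 0"
        hence "card Ob = 1" using i by simp
        moreover have "D \<in> Ob" using D A.orbit_refl by simp
        ultimately have "Ob = {D}" by (metis card_1_singletonE singletonD)
        moreover have "act g D \<in> Ob" if "g \<in> carrier G" for g
          using that D by (auto simp: orbit_def \<phi>_def intro!: exI[of _ g])
        ultimately show False using no D by blast
      qed
      ultimately show ?thesis by simp
    qed
    hence "q dvd (\<Sum>Ob\<in>orbits G \<Delta> \<phi>. card Ob)" by (intro dvd_sum) blast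
    moreover have "card \<Delta> = (\<Sum>Ob\<in>orbits G \<Delta> \<phi>. card Ob)"
    proof -
      have U: "\<Union> (orbits G \<Delta> \<phi>) = \<Delta>"
        using A.orbit_partition by (simp add: partition.partition_coverture)
      have "card (\<Union> (orbits G \<Delta> \<phi>)) = (\<Sum>Ob\<in>orbits G \<Delta> \<phi>. card Ob)"
      proof (rule card_Union_disjoint)
        show "pairwise disjnt (orbits G \<Delta> \<phi>)"
          using A.disjoint_union by (auto simp: pairwise_def disjnt_def)
        show "finite Ob" if "Ob \<in> orbits G \<Delta> \<phi>" for Ob
          by (rule finite_subset[OF _ fin\<Delta>]) (use that U in blast)
      qed
      thus ?thesis using U by simp
    qed
    ultimately show False using nd by simp
  qed
qed

section \<open>Commutation, conjugation and orders of elements\<close>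

lemma inv_mult_cancel [simp]:
  assumes "x \<in> carrier G" "b \<in> carrier G"
  shows "inv x \<otimes> (x \<otimes> b) = b" "x \<otimes> (inv x \<otimes> b) = b"
  using assms by (simp_all add: m_assoc[symmetric])

lemma commute_inv:
  assumes "x \<in> carrier G" "a \<in> carrier G" "a \<otimes> x = x \<otimes> a"
  shows "a \<otimes> inv x = inv x \<otimes> a"
proof -
  have "inv x \<otimes> (a \<otimes> x) \<otimes> inv x = inv x \<otimes> (x \<otimes> a) \<otimes> inv x" using assms by simp
  thus ?thesis using assms(1,2) by (simp add: m_assoc)
qed

lemma commute_mult:
  assumes "x \<in> carrier G" "a \<in> carrier G" "b \<in> carrier G" "a \<otimes> x = x \<otimes> a" "b \<otimes> x = x \<otimes> b"
  shows "a \<otimes> b \<otimes> x = x \<otimes> (a \<otimes> b)"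
proof -
  have "a \<otimes> b \<otimes> x = a \<otimes> (b \<otimes> x)" using assms(2,3,1) by (rule m_assoc)
  also have "\<dots> = a \<otimes> x \<otimes> b" by (simp add: assms(1-3,5) m_assoc)
  also have "a \<otimes> x \<otimes> b = x \<otimes> a \<otimes> b" by (simp only: assms(4))
  finally show ?thesis using assms(1-3) by (simp add: m_assoc)
qed

lemma conj_eq_one_iff:
  assumes "g \<in> carrier G" "x \<in> carrier G"
  shows "g \<otimes> x \<otimes> inv g = \<one> \<longleftrightarrow> x = \<one>"
proof
  assume "g \<otimes> x \<otimes> inv g = \<one>"
  hence "inv g \<otimes> (g \<otimes> x \<otimes> inv g) \<otimes> g = inv g \<otimes> \<one> \<otimes> g" by simp
  thus "x = \<one>" using assms by (simp add: m_assoc)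
qed (use assms in simp)

lemma conj_pow:
  assumes "g \<in> carrier G" "x \<in> carrier G"
  shows "g \<otimes> x [^] (k::nat) \<otimes> inv g = (g \<otimes> x \<otimes> inv g) [^] k"
proof (induction k)
  case (Suc k)
  have "g \<otimes> x [^] Suc k \<otimes> inv g = (g \<otimes> x [^] k \<otimes> inv g) \<otimes> (g \<otimes> x \<otimes> inv g)"
    using assms by (simp add: m_assoc)
  thus ?case using Suc by simp
qed (use assms in simp)

lemma ord_conj:
  assumes "g \<in> carrier G" "x \<in> carrier G"
  shows "ord (g \<otimes> x \<otimes> inv g) = ord x"
proof -
  have "(g \<otimes> x \<otimes> inv g) [^] n = \<one> \<longleftrightarrow> x [^] n = \<one>" for n :: nat
    using conj_pow[OF assms] conj_eq_one_iff[of g "x [^] n"] assms by simp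
  thus ?thesis using ord_unique[of "g \<otimes> x \<otimes> inv g" "ord x"] pow_eq_id[of x] assms by simp
qed

lemma ord_prime_power:
  assumes "prime q" "x \<in> carrier G" "x [^] (q ^ i) = \<one>"
  obtains j where "ord x = q ^ j" "j \<le> i"
proof -
  have "ord x dvd q ^ i" using assms pow_eq_id by blast
  thus ?thesis using that divides_primepow_nat assms(1) by blast
qed

lemma card_powers:
  assumes "a \<in> carrier G"
  shows "subgroup (range (\<lambda>i::nat. a [^] i)) G" "card (range (\<lambda>i::nat. a [^] i)) = ord a"
proof -
  have eq: "generate G {a} = range (\<lambda>i::nat. a [^] i)"
    using generate_pow_nat[OF assms] ord_ge_1[OF fin assms] by (auto simp: full_SetCompr_eq)
  show "subgroup (range (\<lambda>i::nat. a [^] i)) G"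
    using generate_is_subgroup[of "{a}"] assms eq by simp
  show "card (range (\<lambda>i::nat. a [^] i)) = ord a" using generate_pow_card[OF assms] eq by simp
qed

text \<open>For a prime \<open>q\<close> this excludes subgroups that are products of two cyclic
  groups of order \<open>q\<close>. Formulated with elements and powers, the condition passes
  directly to subgroups.\<close>

definition comparable_elements :: "nat \<Rightarrow> bool" where
  "comparable_elements q \<longleftrightarrow> (\<forall>x\<in>carrier G. \<forall>y\<in>carrier G. x [^] q = \<one> \<longrightarrow> y [^] q = \<one> \<longrightarrow> y \<noteq> \<one> \<longrightarrow>
     x \<otimes> y = y \<otimes> x \<longrightarrow> x \<in> range (\<lambda>j::nat. y [^] j))"

text \<open>Induction on the order of \<open>a\<close>: by induction \<open>a [^] q\<close> is a
  power of \<open>b\<close>, in fact the \<open>q\<close>-th power of one. Dividing \<open>a\<close>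
  by that root leaves an element of order dividing \<open>q\<close>, to which comparability
  applies.\<close>

lemma commuting_q_elements:
  assumes q: "prime q" and NC: "comparable_elements q"
    and a: "a \<in> carrier G" "ord a = q ^ i" and b: "b \<in> carrier G" "ord b = q ^ n"
    and ab: "a \<otimes> b = b \<otimes> a" and "i \<le> n"
  shows "a \<in> range (\<lambda>j::nat. b [^] j)"
  using a ab \<open>i \<le> n\<close>
proof (induction i arbitrary: a)
  case 0
  hence "a = b [^] (0::nat)" using ord_eq_1[of a] by simp
  thus ?case by blast
next
  case (Suc i)
  note a = Suc.prems
  have q1: "q > 1" using q prime_gt_1_nat by blast
  have "ord (a [^] q) = q ^ i" using ord_pow[of a q] a q1 by simp
  moreover have comm: "a [^] q \<otimes> b = b \<otimes> a [^] q"
    using a b by (metis group_commutes_pow)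
  ultimately obtain s :: nat where s: "a [^] q = b [^] s" using Suc.IH[of "a [^] q"] a by auto
  \<comment> \<open>Otherwise \<open>b [^] s\<close> would have the full order \<open>q ^ n\<close>,
    more than the order of \<open>a [^] q\<close>.\<close>
  have "q dvd s"
  proof (rule ccontr)
    assume "\<not> q dvd s"
    hence "coprime s (q ^ n)" using q by (metis coprime_commute coprime_power_right_iff prime_imp_coprime)
    hence "ord (b [^] s) = q ^ n" using pow_ord_eq_ord_iff[OF fin b(1), of s] b(2) by simp
    hence "q ^ n = q ^ i" using s \<open>ord (a [^] q) = q ^ i\<close> by simp
    thus False using q1 a by simp
  qed
  then obtain s' where s': "s = q * s'" by blast
  define c where "c = a \<otimes> inv (b [^] s')"
  have ab': "a \<otimes> b [^] s' = b [^] s' \<otimes> a" using a b by (metis group_commutes_pow)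
  have comm2: "a \<otimes> inv (b [^] s') = inv (b [^] s') \<otimes> a"
    using commute_inv[of "b [^] s'" a] a b ab' by simp
  have cq: "c [^] q = \<one>"
  proof -
    have "c [^] q = a [^] q \<otimes> inv (b [^] s') [^] q"
      unfolding c_def using a b comm2 by (intro pow_mult_distrib) auto
    also have "inv (b [^] s') [^] q = inv (b [^] s)"
      using b by (simp add: nat_pow_inv nat_pow_pow s' mult.commute)
    finally show ?thesis using s b by simp
  qed
  \<comment> \<open>An element of order \<open>q\<close> among the powers of \<open>b\<close>, with
    which \<open>c\<close> is to be compared.\<close>
  define y where "y = b [^] (q ^ (n - 1))"
  have n: "n = Suc (n - 1)" using a by simp
  have ordy: "ord y = q"
  proof -
    have "q ^ n = q * q ^ (n - 1)" using n by (metis power_Suc)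
    thus ?thesis unfolding y_def using ord_pow[OF b(1), of "q ^ (n - 1)"] b(2) q1 by simp
  qed
  have y: "y \<in> carrier G" "y [^] q = \<one>" "y \<noteq> \<one>"
    using b ordy q1 pow_ord_eq_1[of y] ord_eq_1[of y] by (auto simp: y_def)
  have c: "c \<in> carrier G" using a b by (simp add: c_def)
  have "b \<otimes> b [^] s' = b [^] s' \<otimes> b" using group_commutes_pow[OF refl b(1) b(1), of s'] by simp
  hence "inv (b [^] s') \<otimes> b = b \<otimes> inv (b [^] s')" using commute_inv[of "b [^] s'" b] b by simp
  hence "c \<otimes> b = b \<otimes> c" unfolding c_def using a b by (intro commute_mult) auto
  hence "c \<otimes> y = y \<otimes> c" using group_commutes_pow[of b c "q ^ (n - 1)"] b c by (simp add: y_def)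
  then obtain j :: nat where "c = y [^] j" using NC y c cq unfolding comparable_elements_def by blast
  hence "a = b [^] (q ^ (n - 1) * j) \<otimes> b [^] s'"
    using a b by (metis c_def inv_closed inv_solve_right m_closed nat_pow_closed nat_pow_pow y_def)
  hence "a = b [^] (q ^ (n - 1) * j + s')" using b by (simp add: nat_pow_mult)
  thus ?case by blast
qed

section \<open>Centralizers and normal cyclic subgroups\<close>

definition centralizer :: "'a \<Rightarrow> 'a set" where
  "centralizer a = {c \<in> carrier G. c \<otimes> a = a \<otimes> c}"

lemma subgroup_centralizer:
  assumes a: "a \<in> carrier G"
  shows "subgroup (centralizer a) G"
proof (rule subgroupI)
  show "inv c \<in> centralizer a" if "c \<in> centralizer a" for c
  proof -
    have c: "c \<in> carrier G" "c \<otimes> a = a \<otimes> c" using that by (auto simp: centralizer_def)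
    hence "inv c \<otimes> (c \<otimes> a) \<otimes> inv c = inv c \<otimes> (a \<otimes> c) \<otimes> inv c" by simp
    hence "a \<otimes> inv c = inv c \<otimes> a" using c(1) a by (simp add: m_assoc)
    thus ?thesis using c by (simp add: centralizer_def)
  qed
  show "c \<otimes> d \<in> centralizer a" if "c \<in> centralizer a" "d \<in> centralizer a" for c d
  proof -
    have cd: "c \<in> carrier G" "c \<otimes> a = a \<otimes> c" "d \<in> carrier G" "d \<otimes> a = a \<otimes> d"
      using that by (auto simp: centralizer_def)
    have "c \<otimes> d \<otimes> a = c \<otimes> (a \<otimes> d)" using cd a by (simp add: m_assoc)
    also have "\<dots> = a \<otimes> (c \<otimes> d)" using cd a by (simp add: m_assoc[symmetric])
    finally show ?thesis using cd by (simp add: centralizer_def)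
  qed
qed (use a in \<open>auto simp: centralizer_def\<close>)

lemma card_class_centralizer:
  assumes a: "a \<in> carrier G"
  shows "card {g \<otimes> a \<otimes> inv g | g. g \<in> carrier G} * card (centralizer a) = Coset.order G"
proof -
  let ?\<phi> = "\<lambda>g. \<lambda>h\<in>carrier G. g \<otimes> h \<otimes> inv g"
  interpret A: group_action G "carrier G" ?\<phi> by (rule action_by_conjugation)
  have "orbit G ?\<phi> a = {g \<otimes> a \<otimes> inv g | g. g \<in> carrier G}"
    using a by (simp add: orbit_def)
  moreover have "stabilizer G ?\<phi> a = centralizer a"
    using a by (auto simp: stabilizer_def centralizer_def inv_solve_right')
  ultimately show ?thesis using A.orbit_stabilizer_theorem[OF a] by simp
qed

text \<open>A normal cyclic subgroup \<open>A\<close> of maximal order is its own centralizer: a coset of \<open>A\<close> in its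
  centralizer fixed under conjugation would generate a larger one. The number of
  conjugates of a generator of \<open>A\<close> is thus the index of \<open>A\<close>, and they all lie in \<open>A\<close>.\<close>

lemma exists_large_order:
  assumes q: "prime q" and card: "Coset.order G = q ^ n" and n: "n > 0" and NC: "comparable_elements q"
  shows "\<exists>x\<in>carrier G. Coset.order G < ord x * ord x"
proof -
  have qpow: "\<exists>i. ord x = q ^ i" if "x \<in> carrier G" for x
    using ord_prime_power[OF q that] pow_order[OF that] card by metis
  \<comment> \<open>\<open>P\<close> consists of the elements whose powers form a normal
    subgroup.\<close>
  define P where "P = {a \<in> carrier G. \<forall>s\<in>carrier G. s \<otimes> a \<otimes> inv s \<in> range (\<lambda>i::nat. a [^] i)}"
  have "\<one> \<in> P" by (auto simp: P_def intro!: range_eqI[of _ _ 0])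
  moreover have finP: "finite P" using fin by (simp add: P_def)
  ultimately have "Max (ord ` P) \<in> ord ` P" by (intro Max_in) auto
  then obtain a where aP: "a \<in> P" and "ord a = Max (ord ` P)" by auto
  hence max: "ord b \<le> ord a" if "b \<in> P" for b using that finP by simp
  have a: "a \<in> carrier G" using aP by (simp add: P_def)
  define A where "A = range (\<lambda>i::nat. a [^] i)"
  have A: "subgroup A G" "card A = ord a" using card_powers[OF a] by (simp_all add: A_def)
  interpret A: subgroup A G by (rule A)
  define C where "C = centralizer a"
  have C: "subgroup C G" unfolding C_def by (rule subgroup_centralizer[OF a])
  have CI: "c \<in> carrier G \<Longrightarrow> c \<otimes> a = a \<otimes> c \<Longrightarrow> c \<in> C" and CD: "c \<in> C \<Longrightarrow> c \<in> carrier G \<and> c \<otimes> a = a \<otimes> c" for c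
    unfolding C_def centralizer_def by blast+
  interpret C: subgroup C G by (rule C)
  have AC: "A \<subseteq> C"
  proof
    fix x assume "x \<in> A"
    then obtain i :: nat where "x = a [^] i" by (auto simp: A_def)
    thus "x \<in> C" using group_commutes_pow[OF refl a a, of i] a by (intro CI) auto
  qed
  have finC: "finite C" by (rule finite_subset[OF C.subset fin])
  have C_A: "C = A"
  proof (rule ccontr)
    assume ne: "C \<noteq> A"
    interpret GC: group "G\<lparr>carrier := C\<rparr>" by (rule C.subgroup_is_group[OF is_group])
    have AGC: "subgroup A (G\<lparr>carrier := C\<rparr>)"
      using subgroup_incl[OF A(1) C AC] .
    define R where "R = rcosets\<^bsub>G\<lparr>carrier := C\<rparr>\<^esub> A"
    have lag: "card R * card A = card C"
      using GC.lagrange_finite[OF _ AGC] finC by (simp add: R_def Coset.order_def)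
    have R: "R = (\<lambda>c. A #> c) ` C" by (auto simp: R_def RCOSETS_def r_coset_def)
    have finR: "finite R" using finC by (simp add: R)
    have "card C dvd q ^ n" using lagrange[OF C] card by (metis dvd_triv_right)
    hence "card R dvd q ^ n" using lag by (metis dvd_trans dvd_triv_left)
    then obtain i where i: "card R = q ^ i" using q divides_primepow_nat by blast
    have "i \<noteq> 0"
    proof
      assume "i = 0"
      hence "card A = card C" using i lag by simp
      thus False using AC finC ne card_subset_eq by metis
    qed
    have AR: "A \<in> R" using A.subset by (auto simp: R intro!: image_eqI[of _ _ \<one>])
    \<comment> \<open>The coset \<open>A\<close> is fixed under conjugation. Without it the number
      of cosets is prime to \<open>q\<close>, so another one is fixed as well.\<close>
    define \<Delta> where "\<Delta> = R - {A}"
    have "Suc (card \<Delta>) = q ^ i" using card_Suc_Diff1[OF finR AR, folded \<Delta>_def] i by simp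
    moreover have "q dvd q ^ i" using \<open>i \<noteq> 0\<close> by simp
    ultimately have nd: "\<not> q dvd card \<Delta>"
      using q by (metis dvd_add_right_iff plus_1_eq_Suc not_prime_unit Suc_eq_plus1)
    define act where "act = (\<lambda>s D. (\<lambda>d. s \<otimes> d \<otimes> inv s) ` D)"
    have norm: "s \<otimes> b \<otimes> inv s \<in> A" if s: "s \<in> carrier G" and b: "b \<in> A" for s b
    proof -
      obtain k :: nat where "b = a [^] k" using b unfolding A_def by blast
      moreover obtain i :: nat where "s \<otimes> a \<otimes> inv s = a [^] i" using aP s by (auto simp: P_def)
      ultimately show ?thesis using conj_pow[OF s a] a by (auto simp: A_def nat_pow_pow)
    qed
    have act_A: "act s A = A" if s: "s \<in> carrier G" for s
    proof
      show "act s A \<subseteq> A" using norm[OF s] by (auto simp: act_def)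
      show "A \<subseteq> act s A"
      proof
        fix b assume b: "b \<in> A"
        have "b = s \<otimes> (inv s \<otimes> b \<otimes> inv (inv s)) \<otimes> inv s"
          using s b by (simp add: m_assoc)
        thus "b \<in> act s A" using norm[of "inv s" b] s b unfolding act_def by blast
      qed
    qed
    have act_coset: "act s (A #> c) = A #> (s \<otimes> c \<otimes> inv s)" if s: "s \<in> carrier G" and c: "c \<in> carrier G" for s c
    proof -
      have eq: "s \<otimes> (b \<otimes> c) \<otimes> inv s = (s \<otimes> b \<otimes> inv s) \<otimes> (s \<otimes> c \<otimes> inv s)" if "b \<in> carrier G" for b
        using that s c by (simp add: m_assoc)
      have "act s (A #> c) = (\<lambda>b. (s \<otimes> b \<otimes> inv s) \<otimes> (s \<otimes> c \<otimes> inv s)) ` A"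
        unfolding act_def r_coset_def using eq A.subset by (auto simp: image_iff)
      also have "\<dots> = (\<lambda>b. b \<otimes> (s \<otimes> c \<otimes> inv s)) ` act s A" by (simp add: act_def image_image)
      finally show ?thesis unfolding act_A[OF s] by (auto simp: r_coset_def)
    qed
    \<comment> \<open>Commuting with \<open>a\<close> amounts to commuting with all its powers, and
      conjugation permutes these; hence \<open>C\<close> is normal.\<close>
    have conjC: "s \<otimes> c \<otimes> inv s \<in> C" if s: "s \<in> carrier G" and c: "c \<in> C" for s c
    proof -
      have cc: "c \<in> carrier G" "c \<otimes> a = a \<otimes> c" using CD[OF c] by auto
      obtain i :: nat where i: "inv s \<otimes> a \<otimes> inv (inv s) = a [^] i"
        using aP inv_closed[OF s] unfolding P_def by blast
      have "c \<otimes> (inv s \<otimes> a \<otimes> s) = (inv s \<otimes> a \<otimes> s) \<otimes> c"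
        using i s group_commutes_pow[OF cc(2)[symmetric] a cc(1), of i] by simp
      hence "s \<otimes> (c \<otimes> (inv s \<otimes> a \<otimes> s)) \<otimes> inv s = s \<otimes> ((inv s \<otimes> a \<otimes> s) \<otimes> c) \<otimes> inv s" by simp
      hence "(s \<otimes> c \<otimes> inv s) \<otimes> a = a \<otimes> (s \<otimes> c \<otimes> inv s)"
        using s cc a by (simp add: m_assoc)
      thus ?thesis using s cc by (intro CI) auto
    qed
    have "\<exists>D\<in>\<Delta>. \<forall>g\<in>carrier G. act g D = D"
    proof (rule p_group_fixed_point[OF q card _ _ _ _ nd])
      show "finite \<Delta>" using finR by (simp add: \<Delta>_def)
      fix D assume D: "D \<in> \<Delta>"
      then obtain c where c: "c \<in> C" "D = A #> c" "D \<noteq> A" by (auto simp: \<Delta>_def R)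
      have Dsub: "D \<subseteq> carrier G" using c A.subset r_coset_subset_G by auto
      show "act \<one> D = D" using Dsub by (auto simp: act_def image_iff subset_iff)
      show assoc: "act (g \<otimes> h) D = act g (act h D)" if "g \<in> carrier G" "h \<in> carrier G" for g h
      proof -
        have "(g \<otimes> h) \<otimes> d \<otimes> inv (g \<otimes> h) = g \<otimes> (h \<otimes> d \<otimes> inv h) \<otimes> inv g" if "d \<in> D" for d
          using that \<open>g \<in> carrier G\<close> \<open>h \<in> carrier G\<close> Dsub by (auto simp: inv_mult_group m_assoc)
        thus ?thesis unfolding act_def image_image by (intro image_cong) auto
      qed
      fix g assume g: "g \<in> carrier G"
      have "act g D \<in> R" using act_coset[OF g] c conjC[OF g c(1)] by (auto simp: R)
      moreover have "act g D \<noteq> A"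
      proof
        assume "act g D = A"
        hence "act (inv g) (act g D) = A" using act_A[of "inv g"] g by simp
        moreover have "act (inv g) (act g D) = D"
          unfolding act_def image_image
          using g Dsub by (force simp: m_assoc subset_iff image_iff)
        ultimately show False using c by simp
      qed
      ultimately show "act g D \<in> \<Delta>" by (simp add: \<Delta>_def)
    qed
    then obtain D where D: "D \<in> \<Delta>" "\<And>g. g \<in> carrier G \<Longrightarrow> act g D = D" by blast
    then obtain c where c: "c \<in> C" "D = A #> c" "D \<noteq> A" by (auto simp: \<Delta>_def R)
    hence cc: "c \<in> carrier G" "c \<otimes> a = a \<otimes> c" using CD[OF c(1)] by auto
    have cA: "c \<notin> A"
      using c(2,3) A.subset by (metis A(1) coset_join2 cc(1))
    obtain i j where ij: "ord a = q ^ i" "ord c = q ^ j" using qpow a cc by blast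
    have q1: "q > 1" using q prime_gt_1_nat by blast
    \<comment> \<open>Otherwise \<open>c\<close> would lie in \<open>A\<close>. With the orders this
      way round, \<open>a\<close> becomes a power of \<open>c\<close>.\<close>
    have "i < j"
    proof (rule ccontr)
      assume "\<not> i < j"
      hence "c \<in> A" unfolding A_def using commuting_q_elements[OF q NC cc(1) ij(2) a ij(1) cc(2)] by simp
      thus False using cA by simp
    qed
    then obtain t :: nat where t: "a = c [^] t"
      using commuting_q_elements[OF q NC a ij(1) cc(1) ij(2) cc(2)[symmetric]] by auto
    \<comment> \<open>As its coset is fixed, a conjugate of \<open>c\<close> is a power of
      \<open>a\<close> times \<open>c\<close>, hence a power of \<open>c\<close>. This contradicts
      the maximal order of \<open>a\<close>.\<close>
    have "c \<in> P"
    proof -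
      have "s \<otimes> c \<otimes> inv s \<in> range (\<lambda>i::nat. c [^] i)" if s: "s \<in> carrier G" for s
      proof -
        have "c \<in> D" using c(2) cc(1) A.one_closed by (auto simp: r_coset_def intro!: bexI[of _ \<one>])
        hence "s \<otimes> c \<otimes> inv s \<in> D" using D(2)[OF s] by (auto simp: act_def)
        then obtain k :: nat where "s \<otimes> c \<otimes> inv s = a [^] k \<otimes> c" using c(2) by (auto simp: r_coset_def A_def)
        hence "s \<otimes> c \<otimes> inv s = c [^] (t * k + 1)" using t cc by (simp add: nat_pow_pow nat_pow_mult[symmetric])
        thus ?thesis by blast
      qed
      thus ?thesis using cc by (simp add: P_def)
    qed
    hence "q ^ j \<le> q ^ i" using max ij by metis
    thus False using \<open>i < j\<close> q1 by simp
  qed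
  have card_C: "card C = ord a" using A C_A by simp
  have a1: "a \<noteq> \<one>"
  proof
    assume "a = \<one>"
    hence "card C = 1" "carrier G \<subseteq> C" using card_C CI by auto
    hence "C = carrier G" "card C = 1" using C.subset by auto
    hence "q ^ n = 1" using card by (simp add: Coset.order_def)
    thus False using n q by (simp add: prime_gt_1_nat)
  qed
  \<comment> \<open>The absence of the identity among the conjugates of \<open>a\<close> makes the
    final inequality strict.\<close>
  have "{s \<otimes> a \<otimes> inv s | s. s \<in> carrier G} \<subseteq> A - {\<one>}"
    using aP a1 conj_eq_one_iff[OF _ a] by (auto simp: P_def A_def)
  hence "card {s \<otimes> a \<otimes> inv s | s. s \<in> carrier G} \<le> card (A - {\<one>})"
    using finC C_A by (intro card_mono) auto
  also have "card (A - {\<one>}) = ord a - 1" using A finC C_A by simp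
  finally have le: "card {s \<otimes> a \<otimes> inv s | s. s \<in> carrier G} \<le> ord a - 1" .
  have "Coset.order G = card {s \<otimes> a \<otimes> inv s | s. s \<in> carrier G} * ord a"
    using card_class_centralizer[OF a] card_C unfolding C_def by simp
  also have "\<dots> \<le> (ord a - 1) * ord a" by (rule mult_le_mono1[OF le])
  also have "(ord a - 1) * ord a < ord a * ord a" using ord_ge_1[OF fin a] by simp
  finally show ?thesis using a by blast
qed

text \<open>\<open>d\<close> is the commutator of \<open>w\<close> and \<open>y\<close> and commutes
  with both. Moving \<open>y\<close> past \<open>w [^] j\<close> costs \<open>j\<close> factors
  \<open>d\<close>, and these costs add up to a triangular number.\<close>

lemma heisenberg_pow:
  assumes yw: "y \<in> carrier G" "w \<in> carrier G" "d \<in> carrier G"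
    and comm: "w \<otimes> y = y \<otimes> w \<otimes> d" "d \<otimes> y = y \<otimes> d" "d \<otimes> w = w \<otimes> d"
  shows "(y \<otimes> w) [^] (j::nat) = y [^] j \<otimes> w [^] j \<otimes> d [^] (j * (j - 1) div 2)"
    and "w [^] j \<otimes> y = y \<otimes> w [^] j \<otimes> d [^] j"
proof -
  have dw: "d \<otimes> w [^] j = w [^] j \<otimes> d" for j :: nat
    using group_commutes_pow[OF comm(3)[symmetric] yw(2,3)] by simp
  have dpw: "d [^] i \<otimes> w = w \<otimes> d [^] i" "d [^] i \<otimes> y = y \<otimes> d [^] i" for i :: nat
    using group_commutes_pow comm yw by auto
  show *: "w [^] j \<otimes> y = y \<otimes> w [^] j \<otimes> d [^] j" for j :: nat
  proof (induction j)
    case (Suc j)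
    have "w [^] Suc j \<otimes> y = w [^] j \<otimes> (w \<otimes> y)" using yw by (simp add: m_assoc)
    also have "\<dots> = (w [^] j \<otimes> y) \<otimes> w \<otimes> d" using comm(1) yw by (simp add: m_assoc)
    also have "\<dots> = y \<otimes> w [^] j \<otimes> (d [^] j \<otimes> w) \<otimes> d" using Suc yw by (simp add: m_assoc)
    also have "\<dots> = y \<otimes> w [^] Suc j \<otimes> d [^] Suc j" using dpw yw by (simp add: m_assoc)
    finally show ?case .
  qed (use yw in simp)
  show "(y \<otimes> w) [^] j = y [^] j \<otimes> w [^] j \<otimes> d [^] (j * (j - 1) div 2)"
  proof (induction j)
    case (Suc j)
    define T where "T = j * (j - 1) div 2"
    have e1: "d [^] j \<otimes> (w \<otimes> d [^] T) = w \<otimes> (d [^] j \<otimes> d [^] T)"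
      using yw dpw(1)[of j] by (simp add: m_assoc[symmetric])
    have T: "Suc j * (Suc j - 1) div 2 = T + j"
    proof -
      have "Suc j * j = j * (j - 1) + 2 * j" by (cases j) auto
      thus ?thesis by (simp add: T_def)
    qed
    have "(y \<otimes> w) [^] Suc j = y [^] j \<otimes> w [^] j \<otimes> d [^] T \<otimes> (y \<otimes> w)" using Suc by (simp add: T_def)
    also have "\<dots> = y [^] j \<otimes> w [^] j \<otimes> (d [^] T \<otimes> y) \<otimes> w" using yw by (simp add: m_assoc)
    also have "\<dots> = y [^] j \<otimes> (w [^] j \<otimes> y) \<otimes> (d [^] T \<otimes> w)" unfolding dpw(2) using yw by (simp add: m_assoc)
    also have "\<dots> = y [^] j \<otimes> (y \<otimes> w [^] j) \<otimes> (d [^] j \<otimes> w) \<otimes> d [^] T" unfolding * dpw(1)[of T]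
      using yw e1 dpw(1)[of j] by (simp add: m_assoc)
    also have "\<dots> = y [^] Suc j \<otimes> w [^] Suc j \<otimes> (d [^] j \<otimes> d [^] T)" unfolding dpw(1) using yw by (simp add: m_assoc)
    also have "d [^] j \<otimes> d [^] T = d [^] (T + j)" using yw by (simp add: nat_pow_mult add.commute)
    finally show ?case unfolding T .
  qed (use yw in simp)
qed

end

lemma exists_cong_zero:
  fixes u n s :: nat
  assumes "coprime u n" "n > 0"
  shows "\<exists>k. n dvd s + k * u"
proof -
  obtain x where x: "[u * x = 1] (mod n)" using cong_solve_coprime_nat[OF assms(1)] by auto
  have "[s + (x * ((n - 1) * s)) * u = s + (n - 1) * s] (mod n)"
    using cong_add[OF cong_refl[of s n] cong_scalar_right[OF x, of "(n - 1) * s"]] by (simp add: mult_ac)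
  moreover have "s + (n - 1) * s = n * s" using assms(2) by (cases n) auto
  ultimately have "[s + (x * ((n - 1) * s)) * u = 0] (mod n)" by (simp add: cong_def)
  thus ?thesis by (auto simp: cong_0_iff)
qed

lemma even_card_if_involution:
  assumes "finite A" "\<And>x. x \<in> A \<Longrightarrow> f x \<in> A" "\<And>x. x \<in> A \<Longrightarrow> f (f x) = x" "\<And>x. x \<in> A \<Longrightarrow> f x \<noteq> x"
  shows "even (card A)"
  using assms
proof (induction "card A" arbitrary: A rule: less_induct)
  case less
  show ?case
  proof (cases "A = {}")
    case False
    then obtain x where x: "x \<in> A" by blast
    have "card {x, f x} = 2" using less.prems(4)[OF x] by (metis card_2_iff)
    hence card: "card A = card (A - {x, f x}) + 2"
      using card_Diff_subset[of "{x, f x}" A] card_mono[of A "{x, f x}"] less.prems(1,2) x by auto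
    have "even (card (A - {x, f x}))"
    proof (rule less.hyps)
      fix y assume y: "y \<in> A - {x, f x}"
      hence "f y \<noteq> x" "f y \<noteq> f x"
        using less.prems(3)[of y] less.prems(3)[of x] x by (metis DiffE insertCI)+
      thus "f y \<in> A - {x, f x}" using less.prems(2)[of y] y by simp
    qed (use less.prems card in auto)
    thus ?thesis using card by simp
  qed simp
qed

context finite_group
begin

text \<open>Inversion maps the class of \<open>x\<close> to itself and fixes none of its elements,
  as they have order 4; so the class has even length. The centralizer contains the four powers of
  \<open>x\<close>, and the two factors multiply to the group order.\<close>

lemma inverting_element_order_4:
  assumes x: "x \<in> carrier G" "ord x = 4" and g: "g \<in> carrier G" "g \<otimes> x \<otimes> inv g = inv x"
  shows "8 dvd Coset.order G"
proof -
  define K where "K = {h \<otimes> x \<otimes> inv h | h. h \<in> carrier G}"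
  have "even (card K)"
  proof (rule even_card_if_involution[of _ "\<lambda>y. inv y"])
    show "finite K" using fin by (simp add: K_def)
    fix y assume "y \<in> K"
    then obtain h where h: "h \<in> carrier G" "y = h \<otimes> x \<otimes> inv h" by (auto simp: K_def)
    have y: "y \<in> carrier G" using h x by simp
    have "inv y = h \<otimes> (g \<otimes> x \<otimes> inv g) \<otimes> inv h" unfolding g(2) using h x by (simp add: inv_mult_group m_assoc)
    also have "\<dots> = (h \<otimes> g) \<otimes> x \<otimes> inv (h \<otimes> g)" using h g(1) x(1) by (simp add: inv_mult_group m_assoc)
    finally show "inv y \<in> K" using h g by (auto simp: K_def)
    show "inv (inv y) = y" using y by simp
    show "inv y \<noteq> y"
    proof
      assume "inv y = y"
      hence "y [^] (2::nat) = \<one>" using y r_inv[OF y] by (simp add: numeral_2_eq_2)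
      hence "4 dvd (2::nat)" using pow_eq_id[OF y, of 2] ord_conj[OF h(1) x(1)] h(2) x(2) by simp
      thus False by simp
    qed
  qed
  moreover have "4 dvd card (centralizer x)"
  proof -
    have sub: "range (\<lambda>i::nat. x [^] i) \<subseteq> centralizer x"
      using group_commutes_pow[OF refl x(1) x(1)] x(1) by (simp add: centralizer_def image_subset_iff)
    interpret C: group "G\<lparr>carrier := centralizer x\<rparr>"
      by (rule subgroup.subgroup_is_group[OF subgroup_centralizer[OF x(1)] is_group])
    have "subgroup (range (\<lambda>i::nat. x [^] i)) (G\<lparr>carrier := centralizer x\<rparr>)"
      by (rule subgroup_incl[OF card_powers(1)[OF x(1)] subgroup_centralizer[OF x(1)] sub])
    from C.lagrange[OF this] show ?thesis
      using card_powers(2)[OF x(1)] x(2) by (simp add: Coset.order_def) (metis dvd_triv_right)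
  qed
  ultimately have "2 * 4 dvd card K * card (centralizer x)" by (rule mult_dvd_mono)
  thus ?thesis using card_class_centralizer[OF x(1)] by (simp add: K_def)
qed

text \<open>A \<open>q\<close>-element \<open>w\<close> conjugates \<open>x\<close> to \<open>x e\<close> with \<open>e\<close> a central power of \<open>x\<close> of order \<open>q\<close>. Multiplying
  \<open>w\<close> by a suitable power of \<open>x\<close> gives an element of order dividing \<open>q\<close> that commutes with \<open>e\<close>, hence is a
  power of \<open>e\<close>. Only the dihedral and quaternion configuration \<open>q = \<alpha> = 2\<close> needs a separate count.\<close>

lemma no_modular_conjugation:
  assumes q: "prime q" and NC: "comparable_elements q"
    and x: "x \<in> carrier G" "ord x = q ^ \<alpha>" and \<alpha>: "\<alpha> \<ge> 2"
    and max: "\<And>y i. y \<in> carrier G \<Longrightarrow> ord y = q ^ i \<Longrightarrow> i \<le> \<alpha>"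
    and g: "g \<in> carrier G" "g \<otimes> x \<otimes> inv g = x [^] (1 + q ^ (\<alpha> - 1) * L)" and L: "\<not> q dvd L"
    and small: "q = 2 \<Longrightarrow> \<alpha> = 2 \<Longrightarrow> \<not> 8 dvd Coset.order G"
  shows False
proof -
  have q1: "q > 1" using q prime_gt_1_nat by blast
  have x_one: "x [^] n = \<one>" if "q ^ \<alpha> dvd n" for n :: nat
    using that x pow_eq_id by simp
  have q\<alpha>: "q ^ \<alpha> = q * q ^ (\<alpha> - 1)" "q ^ (\<alpha> - 1) = q * q ^ (\<alpha> - 2)"
    using \<alpha> by (simp_all flip: power_Suc add: Suc_diff_le Suc_diff_Suc numeral_2_eq_2)
  \<comment> \<open>The factor by which conjugation by \<open>g\<close> changes \<open>x\<close>, a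
    power of \<open>x\<close> of order dividing \<open>q\<close>.\<close>
  define z where "z = x [^] (q ^ (\<alpha> - 1) * L)"
  have z: "z \<in> carrier G" using x by (simp add: z_def)
  have zq: "z [^] q = \<one>"
    unfolding z_def using x by (simp add: nat_pow_pow x_one q\<alpha>)
  have gxz: "g \<otimes> x \<otimes> inv g = x \<otimes> z"
    unfolding g(2) z_def using x
    by (metis nat_pow_Suc2 plus_1_eq_Suc)
  have xz: "x \<otimes> z = z \<otimes> x"
    unfolding z_def by (rule group_commutes_pow[OF refl x(1) x(1), symmetric])
  \<comment> \<open>Conjugation by \<open>g\<close> fixes \<open>x [^] q\<close>, and
    \<open>z\<close> is a power of \<open>x [^] q\<close> because \<open>\<alpha>\<close> is at
    least 2.\<close>
  have gz: "g \<otimes> z \<otimes> inv g = z"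
  proof -
    have "(x \<otimes> z) [^] q = x [^] q"
      using pow_mult_distrib[OF xz x(1) z, of q] zq x by simp
    hence "g \<otimes> x [^] q \<otimes> inv g = x [^] q" using conj_pow[OF g(1) x(1), of q] gxz by simp
    moreover have "z = (x [^] q) [^] (q ^ (\<alpha> - 2) * L)"
      unfolding z_def using x q\<alpha>(2) by (simp add: nat_pow_pow mult.assoc)
    ultimately show ?thesis using conj_pow[OF g(1), of "x [^] q"] x by simp
  qed
  have zg: "z \<otimes> g = g \<otimes> z" using gz g(1) z by (metis inv_solve_right' m_closed)
  have gx: "g \<otimes> x = x \<otimes> g \<otimes> z"
  proof -
    have "g \<otimes> x = x \<otimes> z \<otimes> g" using gxz g(1) x z by (metis inv_solve_right' m_closed)
    thus ?thesis using zg x z g(1) by (simp add: m_assoc)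
  qed
  have "ord g \<noteq> 0" using ord_ge_1[OF fin g(1)] by simp
  \<comment> \<open>Passage to a \<open>q\<close>-element: \<open>w = g [^] l\<close> has
    \<open>q\<close>-power order, and the commutator \<open>z\<close> becomes
    \<open>e = z [^] l\<close>, which stays nontrivial because \<open>q\<close> does not divide
    \<open>L * l\<close>.\<close>
  then obtain l where l: "ord g = q ^ multiplicity q (ord g) * l" "\<not> q dvd l"
    using multiplicity_decompose'[of "ord g" q thesis] not_prime_unit[of q] q by blast
  define \<gamma> where "\<gamma> = multiplicity q (ord g)"
  define w where "w = g [^] l"
  have w: "w \<in> carrier G" "ord w = q ^ \<gamma>"
  proof -
    have "l dvd ord g" "l \<noteq> 0" using l by (metis dvd_triv_right, metis dvd_0_right)
    moreover have "ord g div l = q ^ \<gamma>"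
      using l(1) \<open>l \<noteq> 0\<close> unfolding \<gamma>_def by (metis nonzero_mult_div_cancel_right)
    ultimately show "ord w = q ^ \<gamma>" using ord_pow[OF g(1), of l] by (simp add: w_def)
  qed (use g in \<open>simp add: w_def\<close>)
  define c where "c = L * l"
  have c: "\<not> q dvd c" using L l q by (simp add: c_def prime_dvd_mult_iff)
  define e where "e = x [^] (q ^ (\<alpha> - 1) * c)"
  have e: "e \<in> carrier G" "e [^] q = \<one>"
    unfolding e_def using x by (auto simp: nat_pow_pow x_one q\<alpha>)
  have ez: "e = z [^] l" unfolding e_def z_def c_def using x by (simp add: nat_pow_pow mult.assoc)
  have e1: "e \<noteq> \<one>"
  proof
    assume "e = \<one>"
    hence "q ^ \<alpha> dvd q ^ (\<alpha> - 1) * c" using pow_eq_id[OF x(1)] x(2) by (simp add: e_def)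
    hence "q ^ (\<alpha> - 1) * q dvd q ^ (\<alpha> - 1) * c" using q\<alpha>(1) by (simp add: mult.commute)
    thus False using c q1 by (simp add: nat_mult_dvd_cancel_disj)
  qed
  have wx: "w \<otimes> x = x \<otimes> w \<otimes> e"
    unfolding w_def ez by (rule heisenberg_pow(2)[OF x(1) g(1) z gx xz[symmetric] zg])
  have ex: "e \<otimes> x = x \<otimes> e" unfolding e_def by (rule group_commutes_pow[OF refl x(1) x(1)])
  have ew: "e \<otimes> w = w \<otimes> e"
  proof -
    have "z \<otimes> w = w \<otimes> z" unfolding w_def using group_commutes_pow[OF zg[symmetric] g(1) z] by simp
    thus ?thesis unfolding ez using group_commutes_pow z w by simp
  qed
  have notin: "w \<notin> range (\<lambda>j::nat. x [^] j)"
  proof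
    assume "w \<in> range (\<lambda>j::nat. x [^] j)"
    hence "w \<otimes> x = x \<otimes> w" using group_commutes_pow[OF refl x(1) x(1)] by auto
    hence "x \<otimes> w \<otimes> e = x \<otimes> w" using wx by simp
    hence "e = \<one>" using x w e by simp
    thus False using e1 by simp
  qed
  have wqx: "w [^] q \<otimes> x = x \<otimes> w [^] q"
    using heisenberg_pow(2)[OF x(1) w(1) e(1) wx ex ew, of q] e x w by simp
  have \<gamma>0: "\<gamma> > 0"
  proof (rule ccontr)
    assume "\<not> \<gamma> > 0"
    hence "w = x [^] (0::nat)" using w ord_eq_1[OF w(1)] by simp
    thus False using notin by blast
  qed
  have ordwq: "ord (w [^] q) = q ^ (\<gamma> - 1)"
  proof -
    have "q ^ \<gamma> = q * q ^ (\<gamma> - 1)" using \<gamma>0 by (simp flip: power_Suc)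
    thus ?thesis using ord_pow[of w q] w q1 by simp
  qed
  \<comment> \<open>Maximality makes the order of \<open>w [^] q\<close> smaller than that of
    \<open>x\<close>. As the two commute, \<open>w [^] q\<close> is a power of
    \<open>x\<close>.\<close>
  have \<gamma>\<alpha>: "\<gamma> \<le> \<alpha>" using max w by blast
  have "w [^] q \<in> range (\<lambda>j::nat. x [^] j)"
    using commuting_q_elements[OF q NC _ ordwq x wqx] \<gamma>\<alpha> w by simp
  then obtain s :: nat where s: "w [^] q = x [^] s" by blast
  have "q dvd s"
  proof (rule ccontr)
    assume "\<not> q dvd s"
    hence "coprime s (q ^ \<alpha>)" using q by (metis coprime_commute coprime_power_right_iff prime_imp_coprime)
    hence "ord (x [^] s) = q ^ \<alpha>" using pow_ord_eq_ord_iff[OF fin x(1), of s] x(2) by simp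
    hence "\<gamma> - 1 = \<alpha>" using ordwq s q1 by simp
    thus False using \<gamma>\<alpha> \<alpha> by simp
  qed
  then obtain s' where s': "s = q * s'" by blast
  show False
  proof (cases "q = 2 \<and> \<alpha> = 2")
    case True
    \<comment> \<open>Here \<open>x\<close> has order 4 and the exponent is 3 modulo 4, so
      \<open>g\<close> inverts \<open>x\<close>.\<close>
    have "x [^] (4::nat) = \<one>" using x_one True by simp
    have "odd L" using L True by simp
    then obtain r where "L = 2 * r + 1" by (rule oddE)
    hence kap: "1 + q ^ (\<alpha> - 1) * L = 3 + 4 * r" using True by simp
    have "x [^] (3 + 4 * r) = x [^] (3::nat) \<otimes> (x [^] (4::nat)) [^] r"
      using nat_pow_mult[OF x(1), of 3 "4 * r"] nat_pow_pow[OF x(1), of 4 r] by metis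
    hence "g \<otimes> x \<otimes> inv g = x [^] (3::nat) \<otimes> (x [^] (4::nat)) [^] r"
      using g(2) unfolding kap by simp
    hence "g \<otimes> x \<otimes> inv g = x [^] (3::nat)" using \<open>x [^] (4::nat) = \<one>\<close> x by simp
    moreover have "x [^] (3::nat) \<otimes> x = \<one>" using \<open>x [^] (4::nat) = \<one>\<close> by (simp add: eval_nat_numeral)
    hence "x [^] (3::nat) = inv x" using inv_equality x(1) by simp
    ultimately have "8 dvd Coset.order G" using inverting_element_order_4[of x g] x g(1) True by simp
    thus False using small True by simp
  next
    case False
    \<comment> \<open>\<open>B\<close> is the binomial coefficient "q over 2", the exponent of the
      commutator in a \<open>q\<close>-th power. The number \<open>u\<close> is arranged so that
      \<open>(x [^] k \<otimes> w) [^] q\<close> is \<open>x\<close> to the power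
      \<open>q * (s' + k * u)\<close>; then \<open>k\<close> is chosen to make this trivial.\<close>
    define B where "B = q * (q - 1) div 2"
    define u where "u = 1 + c * q ^ (\<alpha> - 2) * B"
    \<comment> \<open>For odd \<open>q\<close> the factor \<open>B\<close> is divisible by
      \<open>q\<close>; for \<open>q = 2\<close> the excluded case leaves
      \<open>\<alpha> > 2\<close>, and the other factor is even.\<close>
    have "q dvd q ^ (\<alpha> - 2) * B"
    proof (cases "q = 2")
      case True
      hence "q dvd q ^ (\<alpha> - 2)" using False \<alpha> by (simp add: dvd_power)
      thus ?thesis by simp
    next
      case False
      hence "odd q" using q prime_odd_nat[of q] q1 by linarith
      then obtain h where "q = 2 * h + 1" by (rule oddE)
      hence "B = q * h" by (simp add: B_def)
      thus ?thesis by simp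
    qed
    hence "q dvd c * q ^ (\<alpha> - 2) * B" by (simp add: mult.assoc)
    hence "\<not> q dvd u" using q1 unfolding u_def by (metis dvd_add_left_iff nat_dvd_1_iff_1 less_irrefl)
    hence "coprime u (q ^ (\<alpha> - 1))" using q by (metis coprime_commute coprime_power_right_iff prime_imp_coprime)
    then obtain k where k: "q ^ (\<alpha> - 1) dvd s' + k * u" using exists_cong_zero[of u "q ^ (\<alpha> - 1)" s'] q1 by auto
    define y where "y = x [^] k"
    define d where "d = e [^] k"
    have y: "y \<in> carrier G" and d: "d \<in> carrier G" using x e by (auto simp: y_def d_def)
    have wy: "w \<otimes> y = y \<otimes> w \<otimes> d"
    proof -
      have "w \<otimes> x \<otimes> inv w = x \<otimes> e"
        using wx commute_inv[OF w(1) e(1) ew] w(1) x(1) e(1) by (simp add: m_assoc)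
      hence "w \<otimes> y \<otimes> inv w = y \<otimes> d"
        using conj_pow[OF w(1) x(1), of k] pow_mult_distrib[OF ex[symmetric] x(1) e(1), of k] by (simp add: y_def d_def)
      hence "w \<otimes> y = y \<otimes> d \<otimes> w" using w y d by (metis inv_solve_right' m_closed)
      moreover have "d \<otimes> w = w \<otimes> d" unfolding d_def using group_commutes_pow[OF ew e(1) w(1)] .
      ultimately show ?thesis using w y d by (simp add: m_assoc)
    qed
    have dy: "d \<otimes> y = y \<otimes> d" and dw: "d \<otimes> w = w \<otimes> d"
    proof -
      show "d \<otimes> w = w \<otimes> d" unfolding d_def using group_commutes_pow[OF ew e(1) w(1)] .
      have "y \<otimes> e = e \<otimes> y" unfolding y_def using group_commutes_pow[OF ex[symmetric] x(1) e(1)] .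
      thus "d \<otimes> y = y \<otimes> d" unfolding d_def using group_commutes_pow[OF _ e(1) y, of k] by simp
    qed
    have "(y \<otimes> w) [^] q = y [^] q \<otimes> w [^] q \<otimes> d [^] B"
      unfolding B_def by (rule heisenberg_pow(1)[OF y w(1) d wy dy dw])
    also have "\<dots> = x [^] (k * q) \<otimes> x [^] s \<otimes> x [^] (q ^ (\<alpha> - 1) * c * (k * B))"
      using x s by (simp add: y_def d_def e_def nat_pow_pow mult.assoc)
    also have "\<dots> = x [^] (k * q + s + q ^ (\<alpha> - 1) * c * (k * B))" using x by (simp add: nat_pow_mult)
    also have "k * q + s + q ^ (\<alpha> - 1) * c * (k * B) = q * (s' + k * u)"
      unfolding s' q\<alpha>(2) u_def by (simp add: algebra_simps)
    also have "x [^] \<dots> = \<one>" by (rule x_one) (use k q\<alpha>(1) in auto)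
    finally have ywq: "(y \<otimes> w) [^] q = \<one>" .
    have "y \<otimes> e = e \<otimes> y" unfolding y_def using group_commutes_pow[OF ex[symmetric] x(1) e(1)] .
    hence "(y \<otimes> w) \<otimes> e = e \<otimes> (y \<otimes> w)" using commute_mult[OF e(1) y w(1)] ew by simp
    \<comment> \<open>By comparability the corrected element is a power of \<open>e\<close>, hence
      of \<open>x\<close>, and so \<open>w\<close> is one as well, although it does not commute with
      \<open>x\<close>.\<close>
    then obtain j :: nat where j: "y \<otimes> w = e [^] j"
      using NC ywq e e1 y w unfolding comparable_elements_def by blast
    interpret P: subgroup "range (\<lambda>j::nat. x [^] j)" G by (rule card_powers(1)[OF x(1)])
    have "e [^] j \<in> range (\<lambda>j::nat. x [^] j)" unfolding e_def using x by (auto simp: nat_pow_pow)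
    moreover have "inv y \<in> range (\<lambda>j::nat. x [^] j)" by (rule P.m_inv_closed) (auto simp: y_def)
    moreover have "w = inv y \<otimes> e [^] j" using j[symmetric] y w by simp
    ultimately show False using notin P.m_closed by metis
  qed
qed

end

section \<open>Characters vanishing off a single class and the identity\<close>

lemma prime_power_if_unique_prime_divisor:
  assumes "prime (p::nat)" "n > 0" "\<And>r. prime r \<Longrightarrow> r dvd n \<Longrightarrow> r = p"
  shows "\<exists>a. n = p ^ a"
proof -
  obtain y where y: "n = p ^ multiplicity p n * y" "\<not> p dvd y"
    using multiplicity_decompose'[of n p thesis] assms(1,2) not_prime_unit[of p] by blast
  have "y = 1"
  proof (rule ccontr)
    assume "y \<noteq> 1"
    then obtain r where r: "prime r" "r dvd y" using prime_factor_nat by blast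
    hence "r = p" using assms(3) y(1) by (metis dvd_mult)
    thus False using r y(2) by simp
  qed
  thus ?thesis using y(1) by auto
qed

lemma (in comm_monoid) finprod_swap:
  assumes "finite I" "finite J" "\<And>i j. i \<in> I \<Longrightarrow> j \<in> J \<Longrightarrow> f i j \<in> carrier G"
  shows "finprod G (\<lambda>i. finprod G (f i) J) I = finprod G (\<lambda>j. finprod G (\<lambda>i. f i j) I) J"
  using assms(1,3)
proof (induction I rule: finite_induct)
  case empty
  thus ?case by (simp add: finprod_one_eqI)
next
  case (insert k I)
  have "finprod G (\<lambda>j. finprod G (\<lambda>i. f i j) (insert k I)) J = finprod G (\<lambda>j. f k j \<otimes> finprod G (\<lambda>i. f i j) I) J"
    by (rule finprod_cong) (use insert in \<open>auto simp: Pi_def simp_implies_def\<close>)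
  also have "\<dots> = finprod G (f k) J \<otimes> finprod G (\<lambda>j. finprod G (\<lambda>i. f i j) I) J"
    by (rule finprod_multf) (use insert in \<open>auto simp: Pi_def\<close>)
  also have "\<dots> = finprod G (f k) J \<otimes> finprod G (\<lambda>i. finprod G (f i) J) I"
    using insert by simp
  also have "\<dots> = finprod G (\<lambda>i. finprod G (f i) J) (insert k I)"
    by (rule finprod_insert[symmetric]) (use insert in \<open>auto simp: Pi_def\<close>)
  finally show ?case by simp
qed

context finite_group
begin

section \<open>Sylow subgroups and elements of prime order\<close>

lemma finite_group_subgroup:
  assumes "subgroup S G"
  shows "finite_group (G\<lparr>carrier := S\<rparr>)"
proof -
  have "finite S" by (rule finite_subset[OF subgroup.subset[OF assms] fin])
  thus ?thesis
    using subgroup.subgroup_is_group[OF assms is_group] by (simp add: finite_group_def finite_group_axioms_def)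
qed

lemma pow_card_subgroup:
  assumes "subgroup S G" "x \<in> S"
  shows "x [^] card S = \<one>"
proof -
  interpret S: finite_group "G\<lparr>carrier := S\<rparr>" by (rule finite_group_subgroup[OF assms(1)])
  have "x [^]\<^bsub>G\<lparr>carrier := S\<rparr>\<^esub> card S = \<one>" using S.pow_order[of x] assms(2) by (simp add: Coset.order_def)
  thus ?thesis by (simp add: nat_pow_def)
qed

lemma exists_sylow:
  assumes "prime r"
  obtains S where "subgroup S G" "card S = r ^ multiplicity r (Coset.order G)"
proof -
  obtain y where "Coset.order G = r ^ multiplicity r (Coset.order G) * y"
    using multiplicity_dvd by (metis dvd_def)
  from sylow_thm[OF assms is_group this fin] show ?thesis using that by blast
qed

lemma cauchy:
  assumes r: "prime r" "r dvd Coset.order G"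
  obtains x where "x \<in> carrier G" "ord x = r"
proof -
  obtain S where S: "subgroup S G" "card S = r ^ multiplicity r (Coset.order G)" by (rule exists_sylow[OF r(1)])
  have "multiplicity r (Coset.order G) > 0"
    using r order_pos by (simp add: prime_multiplicity_gt_zero_iff)
  hence "card S > 1" using one_less_power[OF prime_gt_1_nat[OF r(1)]] S(2) by metis
  then obtain x where x: "x \<in> S" "x \<noteq> \<one>"
    by (metis card_1_singleton_iff card.empty is_singletonI' is_singleton_altdef less_irrefl not_one_less_zero One_nat_def all_not_in_conv)
  hence xG: "x \<in> carrier G" using subgroup.subset[OF S(1)] by blast
  obtain j where j: "ord x = r ^ j"
    using ord_prime_power[OF r(1) xG] pow_card_subgroup[OF S(1) x(1)] S(2) by metis
  have "j > 0" using j x ord_eq_1[OF xG] by (cases j) auto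
  hence "ord (x [^] (r ^ (j - 1))) = r"
    using ord_pow[OF xG, of "r ^ (j - 1)"] j r(1) by (cases j) (auto simp: prime_gt_0_nat)
  thus ?thesis using that xG by blast
qed

end

text \<open>The situation that an exceptional row leaves behind, freed from the table. The last
  assumption is the orthogonality of \<open>u\<close> to the trivial character.\<close>

locale gagola_character = finite_group G for G :: "('a, 'm) monoid_scheme" (structure) +
  fixes u :: "'a \<Rightarrow> complex" and N :: "'a set"
  assumes u: "u \<in> Irr G" and N: "subgroup N G"
    and N_conj: "\<And>g z. g \<in> carrier G \<Longrightarrow> z \<in> N \<Longrightarrow> g \<otimes> z \<otimes> inv g \<in> N"
    and N_class: "\<And>z z'. z \<in> N \<Longrightarrow> z \<noteq> \<one> \<Longrightarrow> z' \<in> N \<Longrightarrow> z' \<noteq> \<one> \<Longrightarrow> \<exists>g\<in>carrier G. z' = g \<otimes> z \<otimes> inv g"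
    and N_nontriv: "N \<noteq> {\<one>}"
    and u_off: "\<And>g. g \<in> carrier G \<Longrightarrow> g \<notin> N \<Longrightarrow> u g = 0"
    and u_on: "\<And>z. z \<in> N \<Longrightarrow> z \<noteq> \<one> \<Longrightarrow> of_nat (card N - 1) * u z = - u \<one>"
begin

interpretation N: subgroup N G by (rule N)

lemma finite_N: "finite N" by (rule finite_subset[OF N.subset fin])

lemma pow_in_N: "z \<in> N \<Longrightarrow> z [^] (n::nat) \<in> N"
  by (induction n) auto

definition z0 where "z0 = (SOME z. z \<in> N \<and> z \<noteq> \<one>)"

lemma z0: "z0 \<in> N" "z0 \<noteq> \<one>"
proof -
  have "\<exists>z. z \<in> N \<and> z \<noteq> \<one>" using N_nontriv N.one_closed by auto
  from someI_ex[OF this] show "z0 \<in> N" "z0 \<noteq> \<one>" by (auto simp: z0_def)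
qed

definition p where "p = ord z0"

lemma ord_N: "z \<in> N \<Longrightarrow> z \<noteq> \<one> \<Longrightarrow> ord z = p"
  using N_class[OF z0, of z] ord_conj[of _ z0] z0 by (auto simp: p_def)

text \<open>Some power of \<open>z0\<close> has prime order; it is a nonidentity element of
  \<open>N\<close> and therefore conjugate to \<open>z0\<close>.\<close>

lemma prime_p: "prime p"
proof -
  have zc: "z0 \<in> carrier G" using z0 by simp
  have "p \<noteq> 1" "p > 0" using z0 ord_eq_1[OF zc] ord_ge_1[OF fin zc] by (auto simp: p_def)
  then obtain r where r: "prime r" "r dvd p" using prime_factor_nat by blast
  then obtain k where k: "p = r * k" by blast
  hence "k > 0" using \<open>p > 0\<close> by (cases k) auto
  define z1 where "z1 = z0 [^] k"
  have "ord z1 = r" unfolding z1_def using ord_pow[OF zc, of k] k \<open>k > 0\<close> by (simp add: p_def[symmetric])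
  moreover have "z1 \<in> N" unfolding z1_def using pow_in_N z0 by simp
  moreover have "z1 \<noteq> \<one>" using \<open>ord z1 = r\<close> r by auto
  ultimately show ?thesis using ord_N r by metis
qed

lemma p_gt1: "p > 1" using prime_p prime_gt_1_nat by blast

definition t where "t = card N - 1"

lemma card_N: "card N = t + 1"
proof -
  have "card N > 0" using finite_N N.one_closed card_gt_0_iff[of N] by blast
  thus ?thesis by (simp add: t_def)
qed

lemma t_pos: "t > 0"
proof -
  have "card {\<one>, z0} \<le> card N" by (rule card_mono[OF finite_N]) (use z0 N.one_closed in auto)
  thus ?thesis using z0(2) by (auto simp: t_def)
qed

lemma card_N_prime_power: obtains a where "card N = p ^ a" "a > 0"
proof -
  interpret GN: finite_group "G\<lparr>carrier := N\<rparr>" by (rule finite_group_subgroup[OF N])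
  have "r = p" if r: "prime r" "r dvd card N" for r
  proof -
    obtain x where x: "x \<in> N" "GN.ord x = r"
      using GN.cauchy[OF r(1)] r(2) by (auto simp: Coset.order_def)
    have eq: "x [^]\<^bsub>G\<lparr>carrier := N\<rparr>\<^esub> n = x [^] n" for n :: nat by (simp add: nat_pow_def)
    have "x \<noteq> \<one>" using x r GN.ord_eq_1[of x] by auto
    hence p: "ord x = p" using ord_N x by simp
    have "x [^] r = \<one>" using GN.pow_ord_eq_1[of x] x eq by simp
    hence "p dvd r" using pow_eq_id[of x r] p x by simp
    thus "r = p" using r prime_p by (metis primes_dvd_imp_eq)
  qed
  moreover have "card N > 0" using card_N by simp
  ultimately obtain a where a: "card N = p ^ a" using prime_power_if_unique_prime_divisor[OF prime_p, of "card N"] by blast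
  have "a > 0" using a card_N t_pos by (cases a) auto
  thus ?thesis using a that by blast
qed

lemma coprime_t_p: "\<not> p dvd t"
proof
  assume "p dvd t"
  obtain a where "card N = p ^ a" "a > 0" by (rule card_N_prime_power)
  hence "p dvd t + 1" using card_N by (metis dvd_power)
  hence "p dvd 1" using \<open>p dvd t\<close> by (metis dvd_add_right_iff)
  thus False using p_gt1 by simp
qed

lemma u_N: "z \<in> N \<Longrightarrow> z \<noteq> \<one> \<Longrightarrow> u z = u z0"
  using N_class[OF z0, of z] Irr_conj[OF u, of _ z0] z0 by auto

lemma u_one: "u \<one> = - of_nat t * u z0"
  using u_on[OF z0] by (simp add: t_def)

text \<open>\<open>j\<close> is the order of \<open>y\<close> modulo \<open>N\<close>.\<close>

lemma period_dvd:
  assumes y: "y \<in> carrier G" and j: "j > 0" "y [^] j \<in> N" and min: "\<And>i. 0 < i \<Longrightarrow> i < j \<Longrightarrow> y [^] i \<notin> N"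
  shows "y [^] (i::nat) \<in> N \<longleftrightarrow> j dvd i"
proof
  assume i: "y [^] i \<in> N"
  have "y [^] i = y [^] (j * (i div j)) \<otimes> y [^] (i mod j)"
    using y by (simp add: nat_pow_mult)
  moreover have "y [^] (j * (i div j)) \<in> N"
    using pow_in_N[OF j(2)] y by (simp add: nat_pow_pow)
  ultimately have "y [^] (i mod j) = inv (y [^] (j * (i div j))) \<otimes> y [^] i" using y by simp
  hence "y [^] (i mod j) \<in> N" using i \<open>y [^] (j * (i div j)) \<in> N\<close> by simp
  hence "i mod j = 0" using min[of "i mod j"] j by (cases "i mod j = 0") auto
  thus "j dvd i" by auto
next
  assume "j dvd i"
  then obtain k where "i = j * k" by blast
  thus "y [^] i \<in> N" using pow_in_N[OF j(2)] y by (simp add: nat_pow_pow[symmetric])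
qed

text \<open>Compare the multiplicities of two eigenvalues of \<open>y\<close>: one trivial and one nontrivial on
  the power of \<open>y\<close> lying in \<open>N\<close>.\<close>

lemma u_period_dvd:
  assumes y: "y \<in> carrier G" and j: "j > 0" "y [^] j \<in> N" "y [^] j \<noteq> \<one>"
    and min: "\<And>i. 0 < i \<Longrightarrow> i < j \<Longrightarrow> y [^] i \<notin> N"
  shows "\<exists>c::int. - u z0 = of_int (int j * c)"
proof -
  note per = period_dvd[OF y j(1,2) min]
  have ordj: "ord (y [^] j) = p" using ord_N j by simp
  have jp: "j * p > 0" using j p_gt1 by simp
  have y1: "y [^] (j * p) = \<one>"
    using pow_ord_eq_1[of "y [^] j"] ordj y by (simp add: nat_pow_pow)
  \<comment> \<open>Only exponents divisible by \<open>j\<close> contribute, since \<open>u\<close>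
    vanishes off \<open>N\<close>: once the value \<open>u \<one>\<close>, and \<open>u z0\<close>
    for the remaining \<open>p - 1\<close> multiples.\<close>
  have sum: "(\<Sum>i<j * p. cnj \<mu> ^ i * u (y [^] i)) = u \<one> + u z0 * ((\<Sum>l<p. (cnj \<mu> ^ j) ^ l) - 1)" for \<mu>
  proof -
    have "(\<Sum>i<j * p. cnj \<mu> ^ i * u (y [^] i)) = (\<Sum>i\<in>(\<lambda>l. j * l) ` {..<p}. cnj \<mu> ^ i * u (y [^] i))"
    proof (rule sum.mono_neutral_right)
      show "\<forall>i\<in>{..<j * p} - (\<lambda>l. j * l) ` {..<p}. cnj \<mu> ^ i * u (y [^] i) = 0"
      proof
        fix i assume i: "i \<in> {..<j * p} - (\<lambda>l. j * l) ` {..<p}"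
        have "\<not> j dvd i" using i j(1) by (auto elim!: dvdE)
        thus "cnj \<mu> ^ i * u (y [^] i) = 0" using per[of i] u_off y by simp
      qed
    qed (use j in auto)
    also have "\<dots> = (\<Sum>l<p. cnj \<mu> ^ (j * l) * u (y [^] (j * l)))"
      by (subst sum.reindex) (use j in \<open>auto simp: inj_on_def\<close>)
    also have "\<dots> = (\<Sum>l<p. (cnj \<mu> ^ j) ^ l * u ((y [^] j) [^] l))"
      using y by (simp add: nat_pow_pow power_mult)
    also have "\<dots> = u \<one> + (\<Sum>l\<in>{..<p} - {0}. (cnj \<mu> ^ j) ^ l * u ((y [^] j) [^] l))"
      using p_gt1 y by (subst sum.remove[of _ 0]) auto
    also have "(\<Sum>l\<in>{..<p} - {0}. (cnj \<mu> ^ j) ^ l * u ((y [^] j) [^] l)) = (\<Sum>l\<in>{..<p} - {0}. (cnj \<mu> ^ j) ^ l * u z0)"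
    proof (rule sum.cong[OF refl])
      fix l assume l: "l \<in> {..<p} - {0}"
      hence "\<not> p dvd l" by (auto dest: dvd_imp_le)
      hence "(y [^] j) [^] l \<noteq> \<one>" using pow_eq_id[of "y [^] j" l] ordj y by simp
      thus "(cnj \<mu> ^ j) ^ l * u ((y [^] j) [^] l) = (cnj \<mu> ^ j) ^ l * u z0"
        using u_N pow_in_N[OF j(2)] by simp
    qed
    also have "\<dots> = u z0 * ((\<Sum>l<p. (cnj \<mu> ^ j) ^ l) - 1)"
      using p_gt1 by (subst (2) sum.remove[of _ 0]) (auto simp: sum_distrib_left mult.commute)
    finally show ?thesis .
  qed
  obtain c0 :: nat where c0: "(\<Sum>i<j * p. cnj 1 ^ i * u (y [^] i)) = of_nat (j * p * c0)"
    using Irr_multiplicity[OF u y jp y1, of 1] by auto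
  \<comment> \<open>A primitive root of unity of order \<open>j * p\<close>. Its \<open>j\<close>-th
    power is a primitive \<open>p\<close>-th root, so the geometric sum vanishes, whereas for the
    eigenvalue 1 it is \<open>p\<close>.\<close>
  define \<mu> where "\<mu> = cis (2 * pi / real (j * p))"
  have \<mu>1: "\<mu> ^ (j * p) = 1" using jp by (simp add: \<mu>_def DeMoivre)
  obtain c1 :: nat where c1: "(\<Sum>i<j * p. cnj \<mu> ^ i * u (y [^] i)) = of_nat (j * p * c1)"
    using Irr_multiplicity[OF u y jp y1 \<mu>1] by auto
  have \<mu>j: "\<mu> ^ j = cis (2 * pi / p)" using j by (simp add: \<mu>_def DeMoivre)
  have "(\<Sum>l<p. (cnj \<mu> ^ j) ^ l) = 0"
  proof -
    have "\<mu> ^ j \<noteq> 1"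
    proof
      assume "\<mu> ^ j = 1"
      hence "cis (2 * pi * real 1 / real p) = cis (2 * pi * real 0 / real p)" using \<mu>j by simp
      moreover have "inj_on (\<lambda>k. cis (2 * pi * real k / real p)) {..<p}"
        using bij_betw_roots_unity[of p] p_gt1 by (auto simp: bij_betw_def)
      ultimately have "(1::nat) = 0" 
        using p_gt1 inj_onD[of "\<lambda>k. cis (2 * pi * real k / real p)" "{..<p}" 1 0] by simp
      thus False by simp
    qed
    hence "1 \<noteq> cnj (\<mu> ^ j)" by (metis complex_cnj_cnj complex_cnj_one)
    moreover have "1 ^ p = (1::complex)" "cnj (\<mu> ^ j) ^ p = 1" using \<mu>1 by (simp_all add: power_mult flip: complex_cnj_power)
    ultimately show ?thesis using sum_roots_of_unity_pow[of "cnj (\<mu> ^ j)" p 1] p_gt1 by simp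
  qed
  hence A: "of_nat (j * p * c1) = u \<one> - u z0" using c1 sum[of \<mu>] by simp
  have B: "of_nat (j * p * c0) = u \<one> + u z0 * (of_nat p - 1)" using c0 sum[of 1] by simp
  \<comment> \<open>The difference of the two multiplicity sums eliminates
    \<open>u \<one>\<close>.\<close>
  have "of_nat p * (- u z0) = of_nat (j * p * c1) - of_nat (j * p * c0)" unfolding A B by (simp add: algebra_simps)
  also have "\<dots> = of_nat p * of_int (int j * (int c1 - int c0))" by (simp add: algebra_simps)
  finally have "- u z0 = of_int (int j * (int c1 - int c0))"
    using p_gt1 by (subst (asm) mult_cancel_left) auto
  thus ?thesis by blast
qed

text \<open>The floor is only a conversion of type: \<open>- u z0\<close> turns out to be a positive
  integer.\<close>

definition m where "m = nat (floor (Re (- u z0)))"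

lemma u_z0: "u z0 = - of_nat m" and m_pos: "m > 0"
proof -
  \<comment> \<open>With \<open>y = z0\<close> and \<open>j = 1\<close> minimality is vacuous, and
    the divisibility reduces to integrality.\<close>
  have "\<exists>c::int. - u z0 = of_int (int 1 * c)"
    by (rule u_period_dvd[of z0 1]) (use z0 in auto)
  then obtain c where c: "- u z0 = of_int c" by auto
  obtain d :: nat where d: "d > 0" "u \<one> = of_nat d" using Irr_one[OF u] by blast
  have "u \<one> = of_nat t * (- u z0)" using u_one by simp
  hence "(of_int (int d) :: complex) = of_int (int t * c)" unfolding c d by simp
  hence "int d = int t * c" by (simp only: of_int_eq_iff)
  hence "c > 0" using d t_pos by (metis mult_le_0_iff not_le of_nat_0_le_iff of_nat_0_less_iff)
  moreover have "m = nat c" using c by (simp add: m_def)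
  ultimately show "m > 0" "u z0 = - of_nat m" using c by (auto simp: minus_equation_iff)
qed

lemma u_one_eq: "u \<one> = of_nat (m * t)"
  using u_one u_z0 by simp

text \<open>The orthogonality relation of \<open>u\<close> with itself, where only \<open>N\<close>
  contributes.\<close>

lemma order_G: "Coset.order G = m\<^sup>2 * t * (t + 1)"
proof -
  have "of_nat (Coset.order G) = (\<Sum>g\<in>carrier G. u g * cnj (u g))"
    using Irr_orthogonality[OF u u] by simp
  also have "\<dots> = (\<Sum>g\<in>N. u g * cnj (u g))"
    by (rule sum.mono_neutral_right) (use fin u_off in auto)
  also have "\<dots> = u \<one> * cnj (u \<one>) + (\<Sum>g\<in>N - {\<one>}. u g * cnj (u g))"
    using finite_N N.one_closed by (rule sum.remove)
  also have "(\<Sum>g\<in>N - {\<one>}. u g * cnj (u g)) = (\<Sum>g\<in>N - {\<one>}. of_nat (m\<^sup>2))"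
    by (rule sum.cong[OF refl]) (use u_N u_z0 in \<open>auto simp: power2_eq_square\<close>)
  also have "\<dots> = of_nat (t * m\<^sup>2)"
    using finite_N N.one_closed by (simp add: t_def card_Diff_singleton)
  also have "u \<one> * cnj (u \<one>) + of_nat (t * m\<^sup>2) = of_nat (m * t * (m * t) + t * m\<^sup>2)"
    by (simp add: u_one_eq)
  also have "m * t * (m * t) + t * m\<^sup>2 = m\<^sup>2 * t * (t + 1)"
    by (simp add: power2_eq_square algebra_simps)
  finally show ?thesis by (simp only: of_nat_eq_iff)
qed

text \<open>On a Sylow subgroup for a prime \<open>q\<close> other than \<open>p\<close>, the
  character \<open>u\<close> vanishes off the identity, so the order \<open>q ^ k\<close> of this
  subgroup divides \<open>u \<one> = m * t\<close>. If \<open>q\<close> also divided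
  \<open>m\<close>, then \<open>q ^ (k + 1)\<close> would divide \<open>m^2 * t\<close> and hence
  the group order.\<close>

lemma prime_dvd_m: 
  assumes q: "prime q" "q dvd m"
  shows "q = p"
proof (rule ccontr)
  assume ne: "q \<noteq> p"
  define k where "k = multiplicity q (Coset.order G)"
  obtain S where S: "subgroup S G" "card S = q ^ k" unfolding k_def by (rule exists_sylow[OF q(1)])
  interpret S: subgroup S G by (rule S(1))
  have off: "s \<notin> N" if s: "s \<in> S" "s \<noteq> \<one>" for s
  proof
    assume "s \<in> N"
    hence "ord s = p" using ord_N s by simp
    moreover obtain i where "ord s = q ^ i"
      using ord_prime_power[OF q(1), of s k] pow_card_subgroup[OF S(1) s(1)] S(2) s by auto
    ultimately have "p = q ^ i" by simp
    hence "p dvd q ^ i" by simp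
    hence "p dvd q" using prime_p prime_dvd_power by blast
    thus False using ne q(1) prime_p by (metis primes_dvd_imp_eq)
  qed
  have finS: "finite S" by (rule finite_subset[OF S.subset fin])
  have "(\<Sum>s\<in>S. u s) = u \<one> + (\<Sum>s\<in>S - {\<one>}. u s)"
    using finS S.one_closed by (rule sum.remove)
  also have "(\<Sum>s\<in>S - {\<one>}. u s) = 0" using off u_off S.subset by (intro sum.neutral) blast
  finally have eq: "(\<Sum>s\<in>S. u s) = of_nat (m * t)" by (simp add: u_one_eq)
  obtain c :: nat where "(\<Sum>s\<in>S. u s) = of_nat (c * card S)"
    using Irr_subgroup_sum[OF u S(1)] by blast
  hence "m * t = c * q ^ k" using eq S(2) by (simp only: of_nat_eq_iff)
  hence "q ^ k dvd m * t" by simp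
  hence "q * q ^ k dvd m * (m * t)" using q(2) by (intro mult_dvd_mono)
  hence "q ^ Suc k dvd Coset.order G" unfolding order_G by (simp add: power2_eq_square mult.assoc dvd_mult2 flip: mult.assoc)
  hence "Suc k \<le> k" unfolding k_def using order_pos q(1) not_prime_unit
    by (intro multiplicity_geI) auto
  thus False by simp
qed

text \<open>A nonidentity \<open>v\<close> has \<open>t\<close> conjugates, so its centralizer has
  order \<open>m^2 * (t + 1)\<close>, a number with no prime divisor except \<open>p\<close>. Thus
  elements of order \<open>q\<close> act on \<open>N\<close> without nontrivial fixed
  points.\<close>

lemma no_commuting_q_element:
  assumes q: "prime q" "q \<noteq> p" and x: "x \<in> carrier G" "ord x = q" and v: "v \<in> N" "v \<otimes> x = x \<otimes> v"
  shows "v = \<one>"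
proof (rule ccontr)
  assume v1: "v \<noteq> \<one>"
  have vc: "v \<in> carrier G" using v by simp
  have "{g \<otimes> v \<otimes> inv g | g. g \<in> carrier G} = N - {\<one>}"
    using N_class[OF v(1) v1] N_conj[OF _ v(1)] conj_eq_one_iff[OF _ vc] v1 by auto
  moreover have "card (N - {\<one>}) = t" using finite_N N.one_closed by (simp add: t_def card_Diff_singleton)
  ultimately have "t * card (centralizer v) = m\<^sup>2 * t * (t + 1)"
    using card_class_centralizer[OF vc] order_G by simp
  hence "t * card (centralizer v) = t * (m\<^sup>2 * (t + 1))" by (simp only: mult_ac)
  hence card: "card (centralizer v) = m\<^sup>2 * (t + 1)" using t_pos by (simp only: mult_cancel1) simp
  have "x \<in> centralizer v" using x v by (simp add: centralizer_def)
  hence "x [^] card (centralizer v) = \<one>" by (rule pow_card_subgroup[OF subgroup_centralizer[OF vc]])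
  hence "q dvd m\<^sup>2 * (t + 1)" using pow_eq_id[OF x(1)] x(2) card by simp
  hence "q dvd m \<or> q dvd card N" 
    using prime_dvd_mult_iff[OF q(1), of "m\<^sup>2" "t + 1"] prime_dvd_power[OF q(1), of m 2] card_N by auto
  moreover have "\<not> q dvd card N"
  proof
    assume "q dvd card N"
    moreover obtain a where "card N = p ^ a" by (rule card_N_prime_power)
    ultimately have "q dvd p" using q(1) prime_dvd_power by metis
    thus False using q prime_p by (metis primes_dvd_imp_eq)
  qed
  ultimately show False using prime_dvd_m q by blast
qed

text \<open>The \<open>p\<close>-group \<open>N\<close> has a nonidentity central element, and all
  nonidentity elements of \<open>N\<close> are conjugate to it in \<open>G\<close>.\<close>

lemma N_abelian:
  assumes "v \<in> N" "w \<in> N"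
  shows "v \<otimes> w = w \<otimes> v"
proof -
  interpret GN: finite_group "G\<lparr>carrier := N\<rparr>" by (rule finite_group_subgroup[OF N])
  obtain a where a: "card N = p ^ a" "a > 0" by (rule card_N_prime_power)
  have "\<exists>z\<in>N - {\<one>}. \<forall>g\<in>carrier (G\<lparr>carrier := N\<rparr>). g \<otimes> z \<otimes> inv g = z"
  proof (rule GN.p_group_fixed_point[OF prime_p])
    show "Coset.order (G\<lparr>carrier := N\<rparr>) = p ^ a" using a by (simp add: Coset.order_def)
    show "\<not> p dvd card (N - {\<one>})"
      using coprime_t_p finite_N N.one_closed by (simp add: t_def card_Diff_singleton)
    show "g \<otimes> z \<otimes> inv g \<in> N - {\<one>}" if "g \<in> carrier (G\<lparr>carrier := N\<rparr>)" "z \<in> N - {\<one>}" for g z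
      using that N_conj[of g z] conj_eq_one_iff[of g z] by auto
    show "(g \<otimes>\<^bsub>G\<lparr>carrier := N\<rparr>\<^esub> h) \<otimes> z \<otimes> inv (g \<otimes>\<^bsub>G\<lparr>carrier := N\<rparr>\<^esub> h) = g \<otimes> (h \<otimes> z \<otimes> inv h) \<otimes> inv g"
      if "g \<in> carrier (G\<lparr>carrier := N\<rparr>)" "h \<in> carrier (G\<lparr>carrier := N\<rparr>)" "z \<in> N - {\<one>}" for g h z
      using that by (simp add: inv_mult_group m_assoc)
  qed (use finite_N in auto)
  then obtain z where z: "z \<in> N" "z \<noteq> \<one>" "\<And>g. g \<in> N \<Longrightarrow> g \<otimes> z \<otimes> inv g = z" by auto
  have zc: "g \<otimes> z = z \<otimes> g" if "g \<in> N" for g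
    using z(3)[OF that] that z(1) by (metis N.mem_carrier inv_solve_right' m_closed)
  show ?thesis
  proof (cases "w = \<one>")
    case False
    then obtain g where g: "g \<in> carrier G" "w = g \<otimes> z \<otimes> inv g" using N_class[OF z(1,2) assms(2)] by blast
    define v' where "v' = inv g \<otimes> v \<otimes> g"
    have v': "v' \<in> N" using N_conj[of "inv g" v] g assms by (simp add: v'_def)
    have vv: "v = g \<otimes> v' \<otimes> inv g" using g assms by (simp add: v'_def m_assoc)
    have "v \<otimes> w = g \<otimes> (v' \<otimes> z) \<otimes> inv g" unfolding g(2) vv using g v' z by (simp add: m_assoc)
    also have "\<dots> = g \<otimes> (z \<otimes> v') \<otimes> inv g" using zc[OF v'] by simp
    also have "\<dots> = w \<otimes> v" unfolding g(2) vv using g v' z by (simp add: m_assoc)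
    finally show ?thesis .
  qed (use assms in simp)
qed

lemma comm_group_N: "comm_group (G\<lparr>carrier := N\<rparr>)"
proof -
  interpret GN: finite_group "G\<lparr>carrier := N\<rparr>" by (rule finite_group_subgroup[OF N])
  show ?thesis by (rule GN.group_comm_groupI) (use N_abelian in simp)
qed

text \<open>The product is \<open>(v \<otimes> g) [^] q\<close>. It commutes with
  \<open>v \<otimes> g\<close> and, lying in the abelian group \<open>N\<close>, with
  \<open>v\<close>; so it commutes with \<open>g\<close> and must be trivial.\<close>

lemma norm_trivial:
  assumes q: "prime q" "q \<noteq> p" and g: "g \<in> carrier G" "ord g = q" and v: "v \<in> N"
  shows "finprod (G\<lparr>carrier := N\<rparr>) (\<lambda>i. g [^] (i::nat) \<otimes> v \<otimes> inv (g [^] i)) {..<q} = \<one>"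
proof -
  interpret GN: comm_group "G\<lparr>carrier := N\<rparr>" by (rule comm_group_N)
  define P where "P = (\<lambda>k::nat. finprod (G\<lparr>carrier := N\<rparr>) (\<lambda>i. g [^] (i::nat) \<otimes> v \<otimes> inv (g [^] i)) {..<k})"
  have closed: "g [^] i \<otimes> v \<otimes> inv (g [^] i) \<in> N" for i :: nat using N_conj g v by simp
  have PN: "P k \<in> N" for k
    unfolding P_def using GN.finprod_closed[of "\<lambda>i. g [^] (i::nat) \<otimes> v \<otimes> inv (g [^] i)" "{..<k}"] closed by simp
  have vc: "v \<in> carrier G" using v by simp
  have pow: "(v \<otimes> g) [^] k = P k \<otimes> g [^] k" for k
  proof (induction k)
    case 0
    thus ?case by (simp add: P_def GN.finprod_empty[simplified])
  next
    case (Suc k)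
    have "P (Suc k) = (g [^] k \<otimes> v \<otimes> inv (g [^] k)) \<otimes> P k"
      unfolding P_def lessThan_Suc
      using GN.finprod_insert[of "{..<k}" k "\<lambda>i. g [^] i \<otimes> v \<otimes> inv (g [^] i)"] closed by simp
    hence "P (Suc k) = P k \<otimes> (g [^] k \<otimes> v \<otimes> inv (g [^] k))" using N_abelian[OF closed PN] by simp
    thus ?case using Suc PN[of k] g vc by (simp add: m_assoc)
  qed
  have gq: "g [^] q = \<one>" using pow_ord_eq_1[of g] g by simp
  define w where "w = (v \<otimes> g) [^] q"
  have w: "w = P q" unfolding w_def pow gq using PN[of q] by simp
  hence wN: "w \<in> N" using PN by simp
  have "w \<otimes> (v \<otimes> g) = (v \<otimes> g) \<otimes> w"
    unfolding w_def using group_commutes_pow[of "v \<otimes> g" "v \<otimes> g" q] vc g by simp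
  hence "v \<otimes> (w \<otimes> g) = v \<otimes> (g \<otimes> w)"
    using N_abelian[OF wN v] wN vc g by (simp add: m_assoc[symmetric])
  hence "w \<otimes> g = g \<otimes> w" using wN vc g by simp
  hence "w = \<one>" using no_commuting_q_element[OF q g wN] by simp
  thus ?thesis using w by (simp add: P_def)
qed

text \<open>If \<open>x\<close> and \<open>y\<close> generated a noncyclic group of order \<open>q\<^sup>2\<close>, multiplying the norms over the
  cyclic subgroups generated by \<open>x y\<^sup>j\<close> would give \<open>v\<^sup>q = 1\<close> for \<open>v \<in> N\<close>.\<close>

lemma comparable: 
  assumes q: "prime q" "q \<noteq> p"
  shows "comparable_elements q"
  unfolding comparable_elements_def
proof (intro ballI impI)
  fix x y assume x: "x \<in> carrier G" "x [^] q = \<one>" and y: "y \<in> carrier G" "y [^] q = \<one>" "y \<noteq> \<one>"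
    and xy: "x \<otimes> y = y \<otimes> x"
  have q0: "q > 0" using q(1) by (simp add: prime_gt_0_nat)
  have ordq: "ord g = q" if "g \<in> carrier G" "g [^] q = \<one>" "g \<noteq> \<one>" for g
  proof -
    have "ord g dvd q" using that pow_eq_id by blast
    thus ?thesis using q(1) that ord_eq_1[of g] prime_nat_iff by blast
  qed
  have ordy: "ord y = q" by (rule ordq[OF y])
  show "x \<in> range (\<lambda>j::nat. y [^] j)"
  proof (rule ccontr)
    assume no: "x \<notin> range (\<lambda>j::nat. y [^] j)"
    interpret Y: subgroup "range (\<lambda>j::nat. y [^] j)" G by (rule card_powers(1)[OF y(1)])
    interpret GN: comm_group "G\<lparr>carrier := N\<rparr>" by (rule comm_group_N)
    \<comment> \<open>For fixed \<open>j\<close> the conjugating elements are the powers of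
      \<open>x \<otimes> y [^] j\<close>; for fixed \<open>i > 0\<close> they are
      \<open>x [^] i\<close> times all powers of \<open>y\<close>; and \<open>i = 0\<close>
      contributes \<open>q\<close> copies of \<open>z0\<close>.\<close>
    define f where "f = (\<lambda>i j::nat. (x [^] i \<otimes> y [^] (i * j)) \<otimes> z0 \<otimes> inv (x [^] i \<otimes> y [^] (i * j)))"
    have f: "f i j \<in> N" for i j unfolding f_def using N_conj x y z0 by simp
    have xyp: "x [^] i \<otimes> y [^] j = y [^] j \<otimes> x [^] i" for i j :: nat
    proof -
      have "y \<otimes> x [^] i = x [^] i \<otimes> y" by (rule group_commutes_pow[OF xy x(1) y(1), symmetric])
      from group_commutes_pow[OF this, of j] show ?thesis using x y by simp
    qed
    have row: "finprod (G\<lparr>carrier := N\<rparr>) (\<lambda>i. f i j) {..<q} = \<one>" for j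
    proof -
      define g where "g = x \<otimes> y [^] j"
      have g: "g \<in> carrier G" using x y by (simp add: g_def)
      have comm: "x \<otimes> y [^] j = y [^] j \<otimes> x" using xyp[of 1 j] x by simp
      have gi: "g [^] i = x [^] i \<otimes> y [^] (i * j)" for i :: nat
        unfolding g_def using pow_mult_distrib[OF comm] x y by (simp add: nat_pow_pow mult.commute)
      have "g \<noteq> \<one>"
      proof
        assume "g = \<one>"
        hence "x = inv (y [^] j)" using x y by (simp add: g_def inv_equality[symmetric])
        thus False using no Y.m_inv_closed by blast
      qed
      moreover have "g [^] q = \<one>" unfolding gi using x y by (simp add: nat_pow_pow[symmetric])
      ultimately have "ord g = q" using ordq g by blast
      from norm_trivial[OF q g this z0(1)] show ?thesis by (simp add: f_def gi)
    qed
    have col: "finprod (G\<lparr>carrier := N\<rparr>) (f i) {..<q} = \<one>" if i: "0 < i" "i < q" for i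
    proof -
      have yi: "y [^] i \<in> carrier G" using y by simp
      have "y [^] i \<noteq> \<one>" using pow_eq_id[OF y(1), of i] ordy i by (auto dest: dvd_imp_le)
      moreover have "(y [^] i) [^] q = \<one>" using y by (metis mult.commute nat_pow_one nat_pow_pow)
      ultimately have o: "ord (y [^] i) = q" using ordq y by simp
      define v where "v = x [^] i \<otimes> z0 \<otimes> inv (x [^] i)"
      have v: "v \<in> N" unfolding v_def using N_conj x z0 by simp
      have "f i = (\<lambda>j. (y [^] i) [^] j \<otimes> v \<otimes> inv ((y [^] i) [^] j))"
        unfolding f_def v_def xyp using x y z0 by (simp add: nat_pow_pow inv_mult_group m_assoc)
      thus ?thesis using norm_trivial[OF q yi o v] by (simp only:)
    qed
    \<comment> \<open>The double product is evaluated in both orders: the inner products for fixed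
      \<open>j\<close> are all trivial, whereas those for fixed \<open>i\<close> leave
      \<open>z0 [^] q\<close>.\<close>
    have "finprod (G\<lparr>carrier := N\<rparr>) (\<lambda>i. finprod (G\<lparr>carrier := N\<rparr>) (f i) {..<q}) {..<q} =
        finprod (G\<lparr>carrier := N\<rparr>) (\<lambda>j. finprod (G\<lparr>carrier := N\<rparr>) (\<lambda>i. f i j) {..<q}) {..<q}"
      by (rule GN.finprod_swap) (use f in auto)
    also have "\<dots> = \<one>" using GN.finprod_one_eqI[of "{..<q}"] row by simp
    finally have 1: "finprod (G\<lparr>carrier := N\<rparr>) (\<lambda>i. finprod (G\<lparr>carrier := N\<rparr>) (f i) {..<q}) {..<q} = \<one>" .
    have fc: "finprod (G\<lparr>carrier := N\<rparr>) (f i) {..<q} \<in> N" for i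
      using GN.finprod_closed[of "f i" "{..<q}"] f by simp
    have "{..<q} = insert 0 {0<..<q}" using q0 by auto
    hence "finprod (G\<lparr>carrier := N\<rparr>) (\<lambda>i. finprod (G\<lparr>carrier := N\<rparr>) (f i) {..<q}) {..<q} =
        finprod (G\<lparr>carrier := N\<rparr>) (f 0) {..<q} \<otimes>
        finprod (G\<lparr>carrier := N\<rparr>) (\<lambda>i. finprod (G\<lparr>carrier := N\<rparr>) (f i) {..<q}) {0<..<q}"
      using GN.finprod_insert[of "{0<..<q}" 0 "\<lambda>i. finprod (G\<lparr>carrier := N\<rparr>) (f i) {..<q}"] fc by simp
    also have "finprod (G\<lparr>carrier := N\<rparr>) (\<lambda>i. finprod (G\<lparr>carrier := N\<rparr>) (f i) {..<q}) {0<..<q} = \<one>"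
      using GN.finprod_one_eqI[of "{0<..<q}" "\<lambda>i. finprod (G\<lparr>carrier := N\<rparr>) (f i) {..<q}"] col by simp
    also have "f 0 = (\<lambda>j. z0)" using z0 by (simp add: f_def fun_eq_iff)
    also have "finprod (G\<lparr>carrier := N\<rparr>) (\<lambda>j. z0) {..<q} = z0 [^] q"
      using GN.finprod_const[of z0 "{..<q}"] z0 by (simp add: nat_pow_def)
    finally have "z0 [^] q = \<one>" using 1 z0 by simp
    hence "p dvd q" using pow_eq_id[of z0 q] z0 by (simp add: p_def)
    thus False using q prime_p by (metis primes_dvd_imp_eq)
  qed
qed

text \<open>The order \<open>j\<close> of \<open>y\<close> modulo \<open>N\<close> divides
  \<open>m\<close>. If \<open>y [^] j\<close> is trivial, the powers of \<open>y\<close> meet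
  \<open>N\<close> only in the identity, so \<open>j\<close> divides
  \<open>u \<one> = m * t\<close>, and \<open>j\<close>, a power of \<open>p\<close>, is coprime to
  \<open>t\<close>. Otherwise the comparison of eigenvalues gives the divisibility directly.\<close>

lemma p_element_pow_m:
  assumes y: "y \<in> carrier G" "y [^] (p ^ i) = \<one>"
  shows "y [^] m \<in> N"
proof -
  have ex: "\<exists>j::nat. j > 0 \<and> y [^] j \<in> N"
    using y p_gt1 by (intro exI[of _ "p ^ i"]) auto
  define j where "j = (LEAST j::nat. j > 0 \<and> y [^] j \<in> N)"
  have j: "j > 0" "y [^] j \<in> N" using LeastI_ex[OF ex] by (auto simp: j_def)
  have min: "y [^] i \<notin> N" if "0 < i" "i < j" for i
    using not_less_Least[of i "\<lambda>j. j > 0 \<and> y [^] j \<in> N"] that by (auto simp: j_def)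
  have "y [^] (p ^ i) \<in> N" using y by simp
  hence "j dvd p ^ i" using period_dvd[OF y(1) j min] by simp
  have "j dvd m"
  proof (cases "y [^] j = \<one>")
    case True
    obtain c :: nat where c: "(\<Sum>i<j. cnj 1 ^ i * u (y [^] i)) = of_nat (j * c)"
      using Irr_multiplicity[OF u y(1) j(1) True, of 1] by auto
    have "(\<Sum>i<j. u (y [^] i)) = u \<one> + (\<Sum>i\<in>{..<j} - {0}. u (y [^] i))"
      using j by (subst sum.remove[of _ 0]) auto
    also have "(\<Sum>i\<in>{..<j} - {0}. u (y [^] i)) = 0"
      by (rule sum.neutral) (use min u_off y in auto)
    finally have "of_nat (m * t) = (of_nat (j * c) :: complex)" using c by (simp add: u_one_eq)
    hence "m * t = j * c" by (simp only: of_nat_eq_iff)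
    hence "j dvd m * t" by simp
    moreover have "coprime (p ^ i) t" using coprime_t_p prime_p by (simp add: prime_imp_coprime)
    hence "coprime j t" using \<open>j dvd p ^ i\<close> by (meson coprime_divisors dvd_refl)
    ultimately show ?thesis by (simp add: coprime_dvd_mult_left_iff)
  next
    case False
    obtain c :: int where "- u z0 = of_int (int j * c)" using u_period_dvd[OF y(1) j False min] by blast
    hence "(of_int (int m) :: complex) = of_int (int j * c)" by (simp add: u_z0)
    hence "int m = int j * c" by (simp only: of_int_eq_iff)
    thus ?thesis by (metis dvd_triv_left int_dvd_int_iff)
  qed
  then obtain k where "m = j * k" by blast
  thus ?thesis using pow_in_N[OF j(2)] y by (simp add: nat_pow_pow)
qed

end

section \<open>Comparing two such characters\<close>

lemma (in finite_group) pow_in_subgroup_coprime: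
  assumes S: "subgroup S G" and x: "x \<in> carrier G" "x [^] (l::nat) \<in> S" and l: "coprime l (Coset.order G)"
  shows "x \<in> S"
proof -
  interpret S: subgroup S G by (rule S)
  obtain k where "[l * k = 1] (mod Coset.order G)" using cong_solve_coprime_nat[OF l] by auto
  moreover have "ord x dvd Coset.order G" using ord_dvd_group_order x by blast
  ultimately have "[l * k = 1] (mod ord x)" by (rule cong_dvd_modulus_nat)
  hence "int (ord x) dvd int 1 - int (l * k)"
    by (metis cong_iff_dvd_diff cong_int_iff cong_sym)
  hence "x [^] int (l * k) = x [^] int 1" using int_pow_eq[OF x(1)] by blast
  hence "x [^] (l * k) = x" using x by (simp only: int_pow_int) simp
  moreover have "(x [^] l) [^] n \<in> S" for n :: nat using x by (induction n) auto
  ultimately show ?thesis using x by (metis nat_pow_pow)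
qed

text \<open>\<open>I\<close> indexes the common rows. As \<open>u\<close> and \<open>v\<close>
  vanish outside \<open>N\<close> and \<open>K\<close>, column orthogonality there survives the
  removal of the exceptional row, and the number \<open>c\<close> is the order of a centralizer. The
  assumptions are one-sided, with classes separated in \<open>G\<close> and norms and kernels taken
  in \<open>H\<close>; the locale is applied in both directions.\<close>

locale gagola_pair = A: gagola_character G u N + B: gagola_character H v K
  for G :: "('a, 'm) monoid_scheme" and u N and H :: "('b, 'n) monoid_scheme" and v K +
  fixes I :: "nat set" and \<chi> :: "nat \<Rightarrow> 'a \<Rightarrow> complex" and \<psi> :: "nat \<Rightarrow> 'b \<Rightarrow> complex"
  assumes \<chi>: "\<And>i. i \<in> I \<Longrightarrow> \<chi> i \<in> Irr G" and \<psi>: "\<And>i. i \<in> I \<Longrightarrow> \<psi> i \<in> Irr H"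
    and match_G: "\<And>x. x \<in> carrier G - N \<Longrightarrow> \<exists>y\<in>carrier H - K. \<forall>i\<in>I. \<chi> i x = \<psi> i y"
    and match_H: "\<And>y. y \<in> carrier H - K \<Longrightarrow> \<exists>x\<in>carrier G - N. \<forall>i\<in>I. \<chi> i x = \<psi> i y"
    and orth_G: "\<And>x x'. x \<in> carrier G - N \<Longrightarrow> x' \<in> carrier G - N \<Longrightarrow>
      \<nexists>g. g \<in> carrier G \<and> x' = g \<otimes>\<^bsub>G\<^esub> x \<otimes>\<^bsub>G\<^esub> inv\<^bsub>G\<^esub> g \<Longrightarrow> (\<Sum>i\<in>I. \<chi> i x * cnj (\<chi> i x')) = 0"
    and norm_H: "\<And>y. y \<in> carrier H - K \<Longrightarrow>
      \<exists>c::nat. c > 0 \<and> c dvd Coset.order H \<and> (\<Sum>i\<in>I. \<psi> i y * cnj (\<psi> i y)) = of_nat c"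
    and kernel_H: "\<And>i y z. i \<in> I \<Longrightarrow> y \<in> carrier H \<Longrightarrow> z \<in> K \<Longrightarrow> \<psi> i (y \<otimes>\<^bsub>H\<^esub> z) = \<psi> i y"
    and order_eq: "A.m\<^sup>2 * A.t = B.m\<^sup>2 * B.t"
begin

definition matching :: "'a \<Rightarrow> 'b \<Rightarrow> bool" where
  "matching x y \<longleftrightarrow> x \<in> carrier G - N \<and> y \<in> carrier H - K \<and> (\<forall>i\<in>I. \<chi> i x = \<psi> i y)"

lemma conjugate_if_equal:
  assumes "matching x y" "x' \<in> carrier G - N" "\<And>i. i \<in> I \<Longrightarrow> \<chi> i x' = \<chi> i x"
  shows "\<exists>g\<in>carrier G. x' = g \<otimes>\<^bsub>G\<^esub> x \<otimes>\<^bsub>G\<^esub> inv\<^bsub>G\<^esub> g"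
proof (rule ccontr)
  assume no: "\<not> ?thesis"
  obtain c :: nat where c: "c > 0" "(\<Sum>i\<in>I. \<psi> i y * cnj (\<psi> i y)) = of_nat c"
    using norm_H[of y] assms by (auto simp: matching_def)
  have "(\<Sum>i\<in>I. \<chi> i x * cnj (\<chi> i x')) = (\<Sum>i\<in>I. \<psi> i y * cnj (\<psi> i y))"
    using assms by (intro sum.cong refl) (auto simp: matching_def)
  moreover have "(\<Sum>i\<in>I. \<chi> i x * cnj (\<chi> i x')) = 0"
    using orth_G[of x x'] no assms by (auto simp: matching_def)
  ultimately show False using c by simp
qed

text \<open>Modulo a prime \<open>l\<close>, \<open>\<chi>(x\<^sup>l)\<close> is \<open>\<chi>(x)\<^sup>l\<close>. Hence, if \<open>x\<^sup>l\<close> and \<open>y\<^sup>l\<close> did not correspond, column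
  orthogonality would make \<open>l\<close> a divisor of the order of a centralizer.\<close>

lemma matching_prime_pow:
  assumes xy: "matching x y" and l: "prime l" "\<not> l dvd Coset.order G" "\<not> l dvd Coset.order H"
  shows "matching (x [^]\<^bsub>G\<^esub> l) (y [^]\<^bsub>H\<^esub> l)"
proof -
  define M where "M = Coset.order G * Coset.order H"
  define \<zeta> where "\<zeta> = cis (2 * pi / M)"
  have M: "M > 0" "Coset.order G dvd M" "Coset.order H dvd M" using A.order_pos B.order_pos by (auto simp: M_def)
  have \<zeta>: "\<zeta> ^ M = 1" using M by (simp add: \<zeta>_def DeMoivre)
  have x: "x \<in> carrier G" "x \<notin> N" and y: "y \<in> carrier H" "y \<notin> K" and eq: "\<And>i. i \<in> I \<Longrightarrow> \<chi> i x = \<psi> i y"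
    using xy by (auto simp: matching_def)
  have xl: "x [^]\<^bsub>G\<^esub> l \<in> carrier G - N"
    using A.pow_in_subgroup_coprime[OF A.N x(1), of l] x prime_imp_coprime[OF l(1,2)] by auto
  have yl: "y [^]\<^bsub>H\<^esub> l \<in> carrier H - K"
    using B.pow_in_subgroup_coprime[OF B.N y(1), of l] y prime_imp_coprime[OF l(1,3)] by auto
  \<comment> \<open>\<open>x1\<close> corresponds to the \<open>l\<close>-th power of
    \<open>y\<close>; it remains to show that it is conjugate to the \<open>l\<close>-th power of
    \<open>x\<close>.\<close>
  obtain x1 where x1: "x1 \<in> carrier G - N" "\<And>i. i \<in> I \<Longrightarrow> \<chi> i x1 = \<psi> i (y [^]\<^bsub>H\<^esub> l)"
    using match_H[OF yl] by blast
  obtain c :: nat where c: "c > 0" "c dvd Coset.order H" "(\<Sum>i\<in>I. \<psi> i (y [^]\<^bsub>H\<^esub> l) * cnj (\<psi> i (y [^]\<^bsub>H\<^esub> l))) = of_nat c"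
    using norm_H[OF yl] by blast
  have "\<exists>g. g \<in> carrier G \<and> x1 = g \<otimes>\<^bsub>G\<^esub> (x [^]\<^bsub>G\<^esub> l) \<otimes>\<^bsub>G\<^esub> inv\<^bsub>G\<^esub> g"
  proof (rule ccontr)
    assume "\<not> ?thesis"
    hence orth: "(\<Sum>i\<in>I. \<chi> i (x [^]\<^bsub>G\<^esub> l) * cnj (\<chi> i x1)) = 0" using orth_G[OF xl x1(1)] by blast
    \<comment> \<open>Both values are congruent modulo \<open>l\<close> to the \<open>l\<close>-th
      power of the common value of \<open>\<chi> i x\<close> and \<open>\<psi> i y\<close>.\<close>
    have "\<exists>w\<in>int_span \<zeta>. \<psi> i (y [^]\<^bsub>H\<^esub> l) - \<chi> i (x [^]\<^bsub>G\<^esub> l) = of_nat l * w" if i: "i \<in> I" for i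
    proof -
      obtain w where w: "w \<in> int_span \<zeta>" "\<chi> i x ^ l = \<chi> i (x [^]\<^bsub>G\<^esub> l) + of_nat l * w"
        using A.Irr_int_span(2)[OF \<chi>[OF i] x(1) M(2,1) l(1)] by (auto simp: \<zeta>_def)
      obtain w' where w': "w' \<in> int_span \<zeta>" "\<psi> i y ^ l = \<psi> i (y [^]\<^bsub>H\<^esub> l) + of_nat l * w'"
        using B.Irr_int_span(2)[OF \<psi>[OF i] y(1) M(3,1) l(1)] by (auto simp: \<zeta>_def)
      have "\<psi> i (y [^]\<^bsub>H\<^esub> l) - \<chi> i (x [^]\<^bsub>G\<^esub> l) = of_nat l * (w - w')"
        using w w' eq[OF i] by (simp add: algebra_simps)
      thus ?thesis using int_span_diff[OF w(1) w'(1)] by blast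
    qed
    then obtain w where w: "\<And>i. i \<in> I \<Longrightarrow> w i \<in> int_span \<zeta> \<and> \<psi> i (y [^]\<^bsub>H\<^esub> l) - \<chi> i (x [^]\<^bsub>G\<^esub> l) = of_nat l * w i"
      by metis
    have cnj: "cnj (\<chi> i x1) \<in> int_span \<zeta>" if "i \<in> I" for i
      using A.Irr_int_span(1)[OF \<chi>[OF that] _ M(2,1), of "inv\<^bsub>G\<^esub> x1"] A.Irr_inv[OF \<chi>[OF that], of x1] x1(1)
      by (auto simp: \<zeta>_def)
    \<comment> \<open>Subtracting an inner product that vanishes turns the centralizer order
      \<open>c\<close> into a multiple of \<open>l\<close>, although \<open>c\<close> divides the
      order of \<open>H\<close>.\<close>
    have "of_nat c = (\<Sum>i\<in>I. \<psi> i (y [^]\<^bsub>H\<^esub> l) * cnj (\<chi> i x1)) - (\<Sum>i\<in>I. \<chi> i (x [^]\<^bsub>G\<^esub> l) * cnj (\<chi> i x1))"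
      using c(3) orth x1(2) by simp
    also have "\<dots> = (\<Sum>i\<in>I. (\<psi> i (y [^]\<^bsub>H\<^esub> l) - \<chi> i (x [^]\<^bsub>G\<^esub> l)) * cnj (\<chi> i x1))"
      by (simp add: sum_subtractf left_diff_distrib)
    also have "\<dots> = of_nat l * (\<Sum>i\<in>I. w i * cnj (\<chi> i x1))"
      using w by (simp add: sum_distrib_left mult.assoc)
    finally have "of_int (int c) = of_int (int l) * (\<Sum>i\<in>I. w i * cnj (\<chi> i x1))" by simp
    moreover have "(\<Sum>i\<in>I. w i * cnj (\<chi> i x1)) \<in> int_span \<zeta>"
      using w cnj by (intro int_span_sum int_span_mult) auto
    ultimately have "int l dvd int c"
      using int_dvd_if_int_span[OF _ \<zeta> M(1)] l(1) by (metis of_nat_0_eq_iff not_prime_0)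
    thus False using c(2) l(3) by (auto dest: dvd_trans)
  qed
  then obtain g where g: "g \<in> carrier G" "x1 = g \<otimes>\<^bsub>G\<^esub> (x [^]\<^bsub>G\<^esub> l) \<otimes>\<^bsub>G\<^esub> inv\<^bsub>G\<^esub> g" by blast
  have "\<chi> i (x [^]\<^bsub>G\<^esub> l) = \<psi> i (y [^]\<^bsub>H\<^esub> l)" if "i \<in> I" for i
    using A.Irr_conj[OF \<chi>[OF that] g(1), of "x [^]\<^bsub>G\<^esub> l"] g(2) x1(2)[OF that] xl by simp
  thus ?thesis using xl yl by (simp add: matching_def)
qed

text \<open>The congruence handles one prime at a time, so \<open>k\<close> is split into primes,
  none of which divides a group order.\<close>

lemma matching_pow:
  assumes "matching x y" "coprime k (Coset.order G)" "coprime k (Coset.order H)" "k > 0"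
  shows "matching (x [^]\<^bsub>G\<^esub> k) (y [^]\<^bsub>H\<^esub> k)"
  using assms
proof (induction k arbitrary: x y rule: less_induct)
  case (less k)
  have c: "x \<in> carrier G" "y \<in> carrier H" using less.prems(1) by (auto simp: matching_def)
  show ?case
  proof (cases "k = 1")
    case True
    thus ?thesis using less.prems(1) c by simp
  next
    case False
    then obtain l where l: "prime l" "l dvd k" using prime_factor_nat by blast
    then obtain k' where k': "k = l * k'" by blast
    have nd: "\<not> l dvd Coset.order G" "\<not> l dvd Coset.order H"
      using less.prems(2,3) l by (meson coprime_common_divisor not_prime_unit)+
    have m: "matching (x [^]\<^bsub>G\<^esub> l) (y [^]\<^bsub>H\<^esub> l)" by (rule matching_prime_pow[OF less.prems(1) l(1) nd])
    have "k' < k" "k' > 0" using k' less.prems(4) l(1) prime_gt_1_nat by auto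
    moreover have "coprime k' (Coset.order G)" "coprime k' (Coset.order H)" using less.prems(2,3) k' by auto
    ultimately have "matching ((x [^]\<^bsub>G\<^esub> l) [^]\<^bsub>G\<^esub> k') ((y [^]\<^bsub>H\<^esub> l) [^]\<^bsub>H\<^esub> k')" using less.IH m by blast
    thus ?thesis using c k' by (simp add: A.nat_pow_pow B.nat_pow_pow)
  qed
qed

text \<open>The exponent is 1 modulo every prime dividing one of the orders, hence coprime to both.
  Its distance from 1 is a multiple of \<open>L * B.m\<close>, so on the side of \<open>H\<close> it
  moves \<open>y\<close> only within its coset of \<open>K\<close>.\<close>

lemma exists_conjugate_power:
  assumes ne: "A.p \<noteq> B.p" and mf: "B.m = B.p ^ f" "f > 0"
    and x: "x \<in> carrier G" "A.ord x = B.p ^ \<alpha>" and \<alpha>: "\<alpha> > f"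
  shows "\<exists>L. \<not> B.p dvd L \<and> (\<exists>g\<in>carrier G. g \<otimes>\<^bsub>G\<^esub> x \<otimes>\<^bsub>G\<^esub> inv\<^bsub>G\<^esub> g = x [^]\<^bsub>G\<^esub> (1 + B.p ^ (\<alpha> - 1) * L))"
proof -
  define q where "q = B.p"
  have q: "prime q" "q > 1" using B.prime_p B.p_gt1 by (simp_all add: q_def)
  define M where "M = Coset.order G * Coset.order H"
  have M: "M > 0" using A.order_pos B.order_pos by (auto simp: M_def)
  \<comment> \<open>\<open>L\<close> is the part of the product of both orders that is prime to
    \<open>q\<close>; raising to this power turns \<open>y\<close> into a
    \<open>q\<close>-element.\<close>
  obtain L where L: "M = q ^ multiplicity q M * L" "\<not> q dvd L"
    using multiplicity_decompose'[of M q thesis] M not_prime_unit[of q] q by blast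
  define \<kappa> where "\<kappa> = 1 + q ^ (\<alpha> - 1) * L"
  have xN: "x \<notin> N"
  proof
    assume "x \<in> N"
    moreover have "x \<noteq> \<one>\<^bsub>G\<^esub>" using x(2) q \<alpha> A.ord_eq_1[OF x(1)] by (auto simp: q_def[symmetric])
    ultimately have "A.p = q ^ \<alpha>" using A.ord_N x(2) by (simp add: q_def)
    hence "A.p dvd q ^ \<alpha>" by simp
    hence "A.p dvd q" using A.prime_p prime_dvd_power by blast
    thus False using ne A.prime_p q by (metis primes_dvd_imp_eq q_def)
  qed
  obtain y where xy: "matching x y" using match_G[of x] x xN by (auto simp: matching_def)
  hence y: "y \<in> carrier H" by (simp add: matching_def)
  have "coprime \<kappa> q"
  proof -
    have "q dvd q ^ (\<alpha> - 1) * L" using \<alpha> mf(2) by (simp add: dvd_power)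
    hence "\<not> q dvd \<kappa>" unfolding \<kappa>_def using q by (metis dvd_add_left_iff nat_dvd_1_iff_1 less_irrefl)
    thus ?thesis using q(1) by (metis coprime_commute prime_imp_coprime)
  qed
  moreover have "coprime \<kappa> L"
  proof (rule coprimeI)
    fix c assume "c dvd \<kappa>" "c dvd L"
    thus "is_unit c" unfolding \<kappa>_def using dvd_mult[of c L "q ^ (\<alpha> - 1)"] by (metis dvd_add_left_iff)
  qed
  ultimately have "coprime \<kappa> M" using L(1) by (metis coprime_mult_right_iff coprime_power_right_iff)
  hence cop: "coprime \<kappa> (Coset.order G)" "coprime \<kappa> (Coset.order H)" by (simp_all add: M_def)
  have m\<kappa>: "matching (x [^]\<^bsub>G\<^esub> \<kappa>) (y [^]\<^bsub>H\<^esub> \<kappa>)" by (rule matching_pow[OF xy cop]) (simp add: \<kappa>_def)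
  have "(y [^]\<^bsub>H\<^esub> L) [^]\<^bsub>H\<^esub> (q ^ multiplicity q M) = \<one>\<^bsub>H\<^esub>"
  proof -
    have "(y [^]\<^bsub>H\<^esub> L) [^]\<^bsub>H\<^esub> (q ^ multiplicity q M) = y [^]\<^bsub>H\<^esub> M"
      using y L(1) by (metis B.nat_pow_pow mult.commute)
    also have "\<dots> = (y [^]\<^bsub>H\<^esub> Coset.order H) [^]\<^bsub>H\<^esub> Coset.order G"
      using y by (simp add: B.nat_pow_pow M_def mult.commute)
    finally show ?thesis using B.pow_order[OF y] by simp
  qed
  hence "(y [^]\<^bsub>H\<^esub> L) [^]\<^bsub>H\<^esub> B.m \<in> K" using B.p_element_pow_m[of "y [^]\<^bsub>H\<^esub> L"] y by (simp add: q_def)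
  hence "((y [^]\<^bsub>H\<^esub> L) [^]\<^bsub>H\<^esub> (q ^ f)) [^]\<^bsub>H\<^esub> (q ^ (\<alpha> - 1 - f)) \<in> K" using B.pow_in_N mf by (simp add: q_def)
  moreover have "((y [^]\<^bsub>H\<^esub> L) [^]\<^bsub>H\<^esub> (q ^ f)) [^]\<^bsub>H\<^esub> (q ^ (\<alpha> - 1 - f)) = y [^]\<^bsub>H\<^esub> (q ^ (\<alpha> - 1) * L)"
  proof -
    have "q ^ (\<alpha> - 1) = q ^ f * q ^ (\<alpha> - 1 - f)" using \<alpha> by (simp flip: power_add)
    thus ?thesis using y by (simp add: B.nat_pow_pow mult_ac)
  qed
  ultimately have zK: "y [^]\<^bsub>H\<^esub> (q ^ (\<alpha> - 1) * L) \<in> K" by simp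
  have y\<kappa>: "y [^]\<^bsub>H\<^esub> \<kappa> = y \<otimes>\<^bsub>H\<^esub> y [^]\<^bsub>H\<^esub> (q ^ (\<alpha> - 1) * L)"
    unfolding \<kappa>_def using y by (metis B.nat_pow_Suc2 plus_1_eq_Suc)
  \<comment> \<open>The common characters are constant on cosets of \<open>K\<close>, so they do not
    separate the two powers of \<open>y\<close>, and hence not the corresponding powers of
    \<open>x\<close>.\<close>
  have "\<chi> i (x [^]\<^bsub>G\<^esub> \<kappa>) = \<chi> i x" if i: "i \<in> I" for i
    using m\<kappa> xy i kernel_H[OF i y zK] y\<kappa> by (simp add: matching_def)
  then obtain g where "g \<in> carrier G" "x [^]\<^bsub>G\<^esub> \<kappa> = g \<otimes>\<^bsub>G\<^esub> x \<otimes>\<^bsub>G\<^esub> inv\<^bsub>G\<^esub> g"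
    using conjugate_if_equal[OF xy, of "x [^]\<^bsub>G\<^esub> \<kappa>"] m\<kappa> by (auto simp: matching_def)
  thus ?thesis using L(2) by (intro exI[of _ L]) (auto simp: \<kappa>_def q_def)
qed

lemma m_eq_1:
  assumes ne: "A.p \<noteq> B.p"
  shows "B.m = 1"
proof -
  define q where "q = B.p"
  have q: "prime q" "q > 1" "q \<noteq> A.p" using B.prime_p B.p_gt1 ne by (auto simp: q_def)
  obtain f where f: "B.m = q ^ f"
    using prime_power_if_unique_prime_divisor[OF B.prime_p B.m_pos B.prime_dvd_m] by (auto simp: q_def)
  show ?thesis
  proof (rule ccontr)
    assume "B.m \<noteq> 1"
    hence f0: "f > 0" using f by (cases f) auto
    obtain a where a: "card N = A.p ^ a" by (rule A.card_N_prime_power)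
    \<comment> \<open>By \<open>order_eq\<close> the factor \<open>m^2 * t\<close> of the order of
      \<open>G\<close> can be taken from \<open>H\<close>, which exhibits its
      \<open>q\<close>-part.\<close>
    have "Coset.order G = q ^ (2 * f) * (B.t * (A.t + 1))"
      unfolding A.order_G order_eq f by (simp only: power_mult[symmetric] mult.assoc mult.commute[of f])
    moreover have "\<not> q dvd B.t * (A.t + 1)"
    proof
      assume "q dvd B.t * (A.t + 1)"
      hence "q dvd B.t \<or> q dvd A.t + 1" using prime_dvd_mult_iff[OF q(1)] by blast
      hence "q dvd A.p ^ a" using B.coprime_t_p a A.card_N by (auto simp: q_def)
      hence "q dvd A.p" using q(1) prime_dvd_power by blast
      thus False using q A.prime_p by (metis primes_dvd_imp_eq)
    qed
    ultimately have mult: "multiplicity q (Coset.order G) = 2 * f"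
      using q(2) by (intro multiplicity_decomposeI[where x' = "B.t * (A.t + 1)"]) auto
    obtain S where S: "subgroup S G" "card S = q ^ (2 * f)" using A.exists_sylow[OF q(1)] mult by metis
    have NC: "A.comparable_elements q" by (rule A.comparable[OF q(1,3)])
    interpret S: finite_group "G\<lparr>carrier := S\<rparr>" by (rule A.finite_group_subgroup[OF S(1)])
    have pow_S: "x [^]\<^bsub>G\<lparr>carrier := S\<rparr>\<^esub> n = x [^]\<^bsub>G\<^esub> n" for x and n :: nat by (simp add: nat_pow_def)
    have S_sub: "x \<in> carrier G" if "x \<in> S" for x using that subgroup.subset[OF S(1)] by blast
    have "S.comparable_elements q"
      using NC S_sub unfolding A.comparable_elements_def S.comparable_elements_def pow_S by simp
    then obtain x where x: "x \<in> S" "q ^ (2 * f) < S.ord x * S.ord x"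
      using S.exists_large_order[OF q(1), of "2 * f"] S(2) f0 by (auto simp: Coset.order_def)
    have xG: "x \<in> carrier G" using S_sub x by blast
    have ordS: "S.ord x = A.ord x"
      using S.ord_unique[of x "A.ord x"] x(1) A.pow_eq_id[OF xG] by (simp add: pow_S)
    obtain i where i: "A.ord x = q ^ i"
      using A.ord_prime_power[OF q(1) xG, of "2 * f"] A.pow_card_subgroup[OF S(1) x(1)] S(2) by metis
    have "q ^ (2 * f) < q ^ (2 * i)" using x(2) ordS i by (simp add: mult_2 power_add)
    hence "f < i" using q(2) by simp
    \<comment> \<open>The contradiction needs an element of maximal \<open>q\<close>-power order in
      all of \<open>G\<close>; its exponent is at least that of the element found in
      \<open>S\<close>.\<close>
    define E where "E = {i. \<exists>x\<in>carrier G. A.ord x = q ^ i}"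
    have "E \<subseteq> {..Coset.order G}"
    proof
      fix j assume "j \<in> E"
      then obtain x where "x \<in> carrier G" "A.ord x = q ^ j" by (auto simp: E_def)
      hence "q ^ j \<le> Coset.order G" using A.ord_le_group_order[OF A.fin] by metis
      moreover have "j < q ^ j" using q(2) by (simp add: power_gt_expt)
      ultimately show "j \<in> {..Coset.order G}" by simp
    qed
    hence finE: "finite E" by (rule finite_subset) simp
    define \<alpha> where "\<alpha> = Max E"
    have "i \<in> E" using xG i by (auto simp: E_def)
    hence "\<alpha> \<in> E" "i \<le> \<alpha>" unfolding \<alpha>_def using finE by (auto intro: Max_in)
    then obtain x' where x': "x' \<in> carrier G" "A.ord x' = q ^ \<alpha>" by (auto simp: E_def)
    have \<alpha>f: "\<alpha> > f" using \<open>f < i\<close> \<open>i \<le> \<alpha>\<close> by simp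
    obtain L g where L: "\<not> q dvd L" "g \<in> carrier G"
      "g \<otimes>\<^bsub>G\<^esub> x' \<otimes>\<^bsub>G\<^esub> inv\<^bsub>G\<^esub> g = x' [^]\<^bsub>G\<^esub> (1 + q ^ (\<alpha> - 1) * L)"
      using exists_conjugate_power[OF ne _ f0 x'(1) _ \<alpha>f] f x'(2) by (auto simp: q_def)
    show False
    proof (rule A.no_modular_conjugation[OF q(1) NC x' _ _ L(2,3,1)])
      show "2 \<le> \<alpha>" using \<alpha>f f0 by simp
      show "j \<le> \<alpha>" if "y \<in> carrier G" "A.ord y = q ^ j" for y j
        unfolding \<alpha>_def by (rule Max_ge[OF finE]) (use that in \<open>auto simp: E_def\<close>)
      \<comment> \<open>In this case \<open>f = 1\<close>, and the Sylow 2-subgroup has order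
        4.\<close>
      assume "q = 2" "\<alpha> = 2"
      hence "f = 1" using \<alpha>f f0 by simp
      show "\<not> 8 dvd Coset.order G"
      proof
        assume "8 dvd Coset.order G"
        hence "2 ^ 3 dvd Coset.order G" by simp
        hence "3 \<le> multiplicity 2 (Coset.order G)" using A.order_pos by (intro multiplicity_geI) auto
        thus False using mult \<open>q = 2\<close> \<open>f = 1\<close> by simp
      qed
    qed
  qed
qed

end

section \<open>Combinatorics of character tables\<close>

text \<open>The numerical data of a character table: \<open>w\<close> lists the class sizes, \<open>e\<close> is the column of the
  identity, \<open>i0\<close> the row of the trivial character and \<open>n\<close> the group order.\<close>

locale character_matrix =
  fixes k :: nat and X :: "nat \<Rightarrow> nat \<Rightarrow> complex" and w :: "nat \<Rightarrow> nat" and e i0 n :: nat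
  assumes e: "e < k" and i0: "i0 < k" and w_pos: "\<And>j. j < k \<Longrightarrow> w j > 0" and w_e: "w e = 1" and n: "n > 0"
    and row_orth: "\<And>i l. i < k \<Longrightarrow> l < k \<Longrightarrow>
      (\<Sum>j<k. of_nat (w j) * (X i j * cnj (X l j))) = (if i = l then of_nat n else 0)"
    and col_orth: "\<And>a b. a < k \<Longrightarrow> b < k \<Longrightarrow>
      (\<Sum>i<k. X i a * cnj (X i b)) = (if a = b then of_nat n / of_nat (w a) else 0)"
    and degree: "\<And>i. i < k \<Longrightarrow> \<exists>d::nat. d > 0 \<and> X i e = of_nat d"
    and bound: "\<And>i j. i < k \<Longrightarrow> j < k \<Longrightarrow> norm (X i j) \<le> Re (X i e)"
    and trivial: "\<And>j. j < k \<Longrightarrow> X i0 j = 1"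
begin

lemma degree_real: "i < k \<Longrightarrow> cnj (X i e) = X i e" "i < k \<Longrightarrow> X i e \<noteq> 0" "i < k \<Longrightarrow> Re (X i e) > 0"
  "i < k \<Longrightarrow> X i e = of_real (Re (X i e))"
  using degree by fastforce+

lemma sum_w: "(\<Sum>j<k. w j) = n"
proof -
  have "(\<Sum>j<k. of_nat (w j) * (X i0 j * cnj (X i0 j))) = (of_nat n :: complex)" using row_orth[OF i0 i0] by simp
  moreover have "(\<Sum>j<k. of_nat (w j) * (X i0 j * cnj (X i0 j))) = (of_nat (\<Sum>j<k. w j) :: complex)"
    by (simp add: trivial)
  ultimately show ?thesis by (simp only: of_nat_eq_iff)
qed

lemma row_orth_trivial:
  assumes "i < k" "i \<noteq> i0"
  shows "(\<Sum>j<k. of_nat (w j) * X i j) = 0"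
  using row_orth[OF assms(1) i0] assms(2) by (simp add: trivial)

lemma unique_trivial:
  assumes "i < k" "\<And>j. j < k \<Longrightarrow> X i j = 1"
  shows "i = i0"
proof (rule ccontr)
  assume "i \<noteq> i0"
  hence "(\<Sum>j<k. of_nat (w j) * X i j) = 0" by (rule row_orth_trivial[OF assms(1)])
  moreover have "(\<Sum>j<k. of_nat (w j) * X i j) = (of_nat (\<Sum>j<k. w j) :: complex)" by (simp add: assms)
  ultimately show False using sum_w n by simp
qed

text \<open>Two distinct columns of positive numbers cannot be orthogonal. This is how the identity
  column is recognized.\<close>

lemma positive_column:
  assumes "f < k" "\<And>i. i < k \<Longrightarrow> \<exists>d::nat. d > 0 \<and> X i f = of_nat d"
  shows "f = e"
proof (rule ccontr)
  assume "f \<noteq> e"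
  hence 0: "(\<Sum>i<k. X i e * cnj (X i f)) = 0" using col_orth[OF e assms(1)] by simp
  obtain c where c: "\<And>i. i < k \<Longrightarrow> c i > 0 \<and> X i f = of_nat (c i)" using assms(2) by metis
  obtain d where d: "\<And>i. i < k \<Longrightarrow> d i > 0 \<and> X i e = of_nat (d i)" using degree by metis
  have "(\<Sum>i<k. X i e * cnj (X i f)) = of_nat (\<Sum>i<k. d i * c i)"
    using c d by (simp add: of_nat_sum)
  hence "of_nat (\<Sum>i<k. d i * c i) = (0::complex)" unfolding 0 by (rule sym)
  hence "(\<Sum>i<k. d i * c i) = 0" by (simp only: of_nat_eq_0_iff)
  moreover have "d i0 * c i0 \<le> (\<Sum>i<k. d i * c i)" using i0 by (intro member_le_sum) auto
  ultimately have "d i0 * c i0 \<le> 0" by (simp only:)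
  thus False using c[OF i0] d[OF i0] by simp
qed

text \<open>By row orthogonality every vector is expanded in the columns with its inner products as
  coefficients; here only one coefficient survives, and it is the witness.\<close>

lemma proportional_column:
  assumes s: "s < k" and orth: "\<And>b. b < k \<Longrightarrow> b \<noteq> s \<Longrightarrow> (\<Sum>i<k. y i * cnj (X i b)) = 0"
  shows "\<exists>c. \<forall>i<k. y i = c * X i s"
proof (intro exI[of _ "of_nat (w s) / of_nat n * (\<Sum>l<k. y l * cnj (X l s))"] allI impI)
  fix i assume i: "i < k"
  have "of_nat n * y i = (\<Sum>l<k. (if i = l then of_nat n else 0) * y l)"
    using i by (simp add: if_distrib if_distribR sum.delta cong: if_cong)
  also have "\<dots> = (\<Sum>l<k. (\<Sum>b<k. of_nat (w b) * (X i b * cnj (X l b))) * y l)"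
    by (intro sum.cong refl) (use row_orth i in auto)
  also have "\<dots> = (\<Sum>l<k. \<Sum>b<k. of_nat (w b) * X i b * (y l * cnj (X l b)))"
    by (simp add: sum_distrib_left sum_distrib_right mult_ac)
  also have "\<dots> = (\<Sum>b<k. \<Sum>l<k. of_nat (w b) * X i b * (y l * cnj (X l b)))" by (rule sum.swap)
  also have "\<dots> = (\<Sum>b<k. of_nat (w b) * X i b * (\<Sum>l<k. y l * cnj (X l b)))" by (simp add: sum_distrib_left)
  also have "\<dots> = (\<Sum>b<k. if b = s then of_nat (w s) * X i s * (\<Sum>l<k. y l * cnj (X l s)) else 0)"
    by (intro sum.cong refl) (use orth in auto)
  also have "\<dots> = of_nat (w s) * X i s * (\<Sum>l<k. y l * cnj (X l s))" using s by (simp add: sum.delta)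
  finally show "y i = of_nat (w s) / of_nat n * (\<Sum>l<k. y l * cnj (X l s)) * X i s"
    using n by (simp add: field_simps)
qed

lemma degree_sum_pos:
  assumes "r \<noteq> i0"
  shows "(\<Sum>i\<in>{..<k} - {r}. X i e * X i e) = of_real (\<Sum>i\<in>{..<k} - {r}. (Re (X i e))\<^sup>2)"
    and "(\<Sum>i\<in>{..<k} - {r}. (Re (X i e))\<^sup>2) > 0"
proof -
  have "X i e * X i e = of_real ((Re (X i e))\<^sup>2)" if "i \<in> {..<k} - {r}" for i
    using degree_real(4)[of i] that by (metis DiffD1 lessThan_iff of_real_power power2_eq_square)
  thus "(\<Sum>i\<in>{..<k} - {r}. X i e * X i e) = of_real (\<Sum>i\<in>{..<k} - {r}. (Re (X i e))\<^sup>2)"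
    unfolding of_real_sum by (rule sum.cong[OF refl])
  have "(Re (X i0 e))\<^sup>2 \<le> (\<Sum>i\<in>{..<k} - {r}. (Re (X i e))\<^sup>2)"
    using assms i0 by (intro member_le_sum) auto
  thus "(\<Sum>i\<in>{..<k} - {r}. (Re (X i e))\<^sup>2) > 0" using trivial[OF e] by simp
qed

lemma split_row:
  assumes "r < k"
  shows "(\<Sum>i<k. f i :: complex) = f r + (\<Sum>i\<in>{..<k} - {r}. f i)"
  using assms by (intro sum.remove) auto

section \<open>Rows supported on the identity column and one further column\<close>

context
  fixes r f :: nat
  assumes r: "r < k" "r \<noteq> i0" and f: "f < k" "f \<noteq> e"
    and supp: "\<And>j. j < k \<Longrightarrow> j \<noteq> e \<Longrightarrow> j \<noteq> f \<Longrightarrow> X r j = 0"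
begin

lemma two_column_sum:
  assumes "\<And>j. j < k \<Longrightarrow> j \<noteq> e \<Longrightarrow> j \<noteq> f \<Longrightarrow> h j = (0::complex)"
  shows "(\<Sum>j<k. h j) = h e + h f"
proof -
  have "(\<Sum>j<k. h j) = (\<Sum>j\<in>{e, f}. h j)"
    by (rule sum.mono_neutral_right) (use e f assms in auto)
  thus ?thesis using f by simp
qed

lemma supp_f: "of_nat (w f) * X r f = - X r e"
  using row_orth_trivial[OF r] two_column_sum[of "\<lambda>j. of_nat (w j) * X r j"] supp w_e
  by (simp add: add_eq_0_iff minus_equation_iff)

text \<open>After removal of row \<open>r\<close>, the norm of column \<open>e\<close> and its inner
  product with column \<open>f\<close> are both \<open>d * d / t\<close>. Since each entry of column
  \<open>f\<close> is bounded by that of column \<open>e\<close>, equal sums force equal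
  entries.\<close>

lemma kernel_column:
  assumes i: "i < k" "i \<noteq> r"
  shows "X i f = X i e"
proof -
  define d where "d = Re (X r e)"
  define t where "t = real (w f)"
  have t: "t > 0" using w_pos[OF f(1)] by (simp add: t_def)
  have d: "X r e = of_real d" "d > 0" using degree_real(3,4)[OF r(1)] by (simp_all add: d_def)
  have rf: "X r f = of_real (- d / t)" using supp_f d(1) t by (simp add: t_def field_simps)
  have "of_nat n = X r e * cnj (X r e) + of_nat (w f) * (X r f * cnj (X r f))"
    using row_orth[OF r(1) r(1)] two_column_sum[of "\<lambda>j. of_nat (w j) * (X r j * cnj (X r j))"] supp w_e by simp
  also have "\<dots> = of_real (d * d + t * (d / t * (d / t)))" by (simp add: d rf t_def)
  finally have "real n = d * d + t * (d / t * (d / t))" by (metis of_real_eq_iff of_real_of_nat_eq)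
  hence n_eq: "real n = d * d + d * d / t" using t by (simp add: field_simps)
  define S where "S = {..<k} - {r}"
  have 1: "(\<Sum>i\<in>S. X i e * X i e) = of_real (d * d / t)"
  proof -
    have "of_nat n = (\<Sum>i<k. X i e * cnj (X i e))" using col_orth[OF e e] w_e by simp
    also have "\<dots> = X r e * cnj (X r e) + (\<Sum>i\<in>S. X i e * cnj (X i e))"
      unfolding S_def by (rule split_row[OF r(1)])
    also have "(\<Sum>i\<in>S. X i e * cnj (X i e)) = (\<Sum>i\<in>S. X i e * X i e)"
      by (intro sum.cong refl) (auto simp: S_def degree_real(1))
    finally have "(\<Sum>i\<in>S. X i e * X i e) = of_real (real n) - of_real (d * d)" by (simp add: d)
    thus ?thesis unfolding n_eq by simp
  qed
  have 2: "(\<Sum>i\<in>S. X i e * cnj (X i f)) = of_real (d * d / t)"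
  proof -
    have "0 = (\<Sum>i<k. X i e * cnj (X i f))" using col_orth[OF e f(1)] f by simp
    also have "\<dots> = X r e * cnj (X r f) + (\<Sum>i\<in>S. X i e * cnj (X i f))"
      unfolding S_def by (rule split_row[OF r(1)])
    finally show ?thesis by (simp add: d rf)
  qed
  have "(\<Sum>i\<in>S. Re (X i e * X i e - X i e * cnj (X i f))) = 0"
    using 1 2 by (simp only: Re_sum[symmetric] sum_subtractf) simp
  moreover have re: "Re (X i e * X i e - X i e * cnj (X i f)) = Re (X i e) * (Re (X i e) - Re (X i f))" if "i < k" for i
  proof -
    have "Im (X i e) = 0" using degree[OF that] by auto
    thus ?thesis by (simp add: algebra_simps)
  qed
  moreover have le: "Re (X i f) \<le> Re (X i e)" if "i < k" for i
    using bound[OF that f(1)] complex_Re_le_cmod[of "X i f"] by linarith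
  ultimately have "\<forall>i\<in>S. Re (X i e * X i e - X i e * cnj (X i f)) = 0"
    by (subst (asm) sum_nonneg_eq_0_iff) (auto simp: S_def degree_real(3) less_imp_le)
  hence "Re (X i e) * (Re (X i e) - Re (X i f)) = 0" using i re[OF i(1)] by (simp add: S_def)
  hence eq: "Re (X i f) = Re (X i e)" using degree_real(3)[OF i(1)] by simp
  hence "norm (X i f) \<le> Re (X i f)" using bound[OF i(1) f(1)] by simp
  hence "(Re (X i f))\<^sup>2 + (Im (X i f))\<^sup>2 \<le> (Re (X i f))\<^sup>2"
    using power_mono[of "norm (X i f)" "Re (X i f)" 2] by (simp add: cmod_power2)
  hence "Im (X i f) = 0" by simp
  moreover have "Im (X i e) = 0" using degree[OF i(1)] by auto
  ultimately show ?thesis using eq by (simp add: complex_eq_iff)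
qed

text \<open>Any other such column would have a positive inner product with column \<open>e\<close>,
  because row \<open>r\<close> contributes 0.\<close>

lemma column_outside_kernel:
  assumes j: "j < k" "\<And>i. i < k \<Longrightarrow> i \<noteq> r \<Longrightarrow> X i j = X i e"
  shows "j = e \<or> j = f"
proof (rule ccontr)
  assume ne: "\<not> ?thesis"
  have "0 = (\<Sum>i<k. X i e * cnj (X i j))" using col_orth[OF e j(1)] ne by auto
  also have "\<dots> = X r e * cnj (X r j) + (\<Sum>i\<in>{..<k} - {r}. X i e * cnj (X i j))"
    by (rule split_row[OF r(1)])
  also have "(\<Sum>i\<in>{..<k} - {r}. X i e * cnj (X i j)) = (\<Sum>i\<in>{..<k} - {r}. X i e * X i e)"
    by (intro sum.cong refl) (auto simp: j degree_real(1))
  finally have "of_real (\<Sum>i\<in>{..<k} - {r}. (Re (X i e))\<^sup>2) = (0::complex)"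
    using degree_sum_pos(1)[OF r(2)] supp[OF j(1)] ne by simp
  hence "(\<Sum>i\<in>{..<k} - {r}. (Re (X i e))\<^sup>2) = 0" by (simp only: of_real_eq_0_iff)
  thus False using degree_sum_pos(2)[OF r(2)] by simp
qed

end

end

section \<open>Two tables that agree outside one column or one row\<close>

locale character_matrices = A: character_matrix k X w e i0 n + B: character_matrix k Y w' e' i0' n'
  for k X w e i0 n Y w' e' i0' n'
begin

lemma column_case:
  assumes s: "s < k" and eq: "\<And>i j. i < k \<Longrightarrow> j < k \<Longrightarrow> j \<noteq> s \<Longrightarrow> X i j = Y i j"
  shows "\<exists>\<sigma> \<tau>. \<sigma> permutes {..<k} \<and> \<tau> permutes {..<k} \<and> (\<forall>i<k. \<forall>j<k. Y i j = X (\<sigma> i) (\<tau> j))"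
proof -
  have same: ?thesis if "\<And>i. i < k \<Longrightarrow> Y i s = X i s"
    using that eq by (intro exI[of _ id] conjI permutes_id) (metis id_apply)
  \<comment> \<open>If the identity columns were distinct, one of them would not be column
    \<open>s\<close>; it is common to both tables and would be a positive column in both.\<close>
  have ee: "e = e'"
  proof (rule ccontr)
    assume ne: "e \<noteq> e'"
    show False
    proof (cases "e' = s")
      case True
      hence "e = e'" using B.positive_column[OF A.e] A.degree eq[OF _ A.e] ne by metis
      thus False using ne by simp
    next
      case False
      hence "e' = e" using A.positive_column[OF B.e] B.degree eq[OF _ B.e] by metis
      thus False using ne by simp
    qed
  qed
  have orth: "(\<Sum>i<k. Y i s * cnj (X i b)) = 0" if "b < k" "b \<noteq> s" for b
  proof -
    have "(\<Sum>i<k. Y i s * cnj (X i b)) = (\<Sum>i<k. Y i s * cnj (Y i b))" using eq that by simp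
    thus ?thesis using B.col_orth[OF s that(1)] that(2) by auto
  qed
  obtain c where c: "\<And>i. i < k \<Longrightarrow> Y i s = c * X i s"
    using A.proportional_column[OF s, of "\<lambda>i. Y i s"] orth by blast
  show ?thesis
  proof (cases "s = e")
    case True
    \<comment> \<open>The two trivial rows show that \<open>c\<close> and its reciprocal are
      positive integers.\<close>
    obtain a :: nat where a: "Y i0 s = of_nat a" using B.degree[OF A.i0] True ee by auto
    obtain b :: nat where b: "X i0' s = of_nat b" using A.degree[OF B.i0] True by auto
    have "c = of_nat a" using c[OF A.i0] A.trivial[OF s] a by simp
    moreover have "1 = c * of_nat b" using c[OF B.i0] B.trivial[OF s] b by simp
    ultimately have "(of_nat (a * b) :: complex) = of_nat 1" by simp
    hence "a * b = 1" by (simp only: of_nat_eq_iff)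
    hence "c = 1" using \<open>c = of_nat a\<close> by simp
    thus ?thesis using c by (intro same) simp
  next
    case False
    \<comment> \<open>The common columns determine the group order and all class sizes but one; the
      last one follows from their sum.\<close>
    have colnorm: "(\<Sum>i<k. X i j * cnj (X i j)) = (\<Sum>i<k. Y i j * cnj (Y i j))" if "j < k" "j \<noteq> s" for j
      using eq that by simp
    have "(of_nat n :: complex) = of_nat n'"
      using colnorm[OF A.e] False A.col_orth[OF A.e A.e] B.col_orth[OF B.e B.e] A.w_e B.w_e ee by simp
    hence nn: "n = n'" by (simp only: of_nat_eq_iff)
    have ww: "w j = w' j" if j: "j < k" "j \<noteq> s" for j
    proof -
      have "(of_nat n :: complex) / of_nat (w j) = of_nat n / of_nat (w' j)"
        using colnorm[OF j] A.col_orth[OF j(1) j(1)] B.col_orth[OF j(1) j(1)] nn by simp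
      hence "(of_nat (w j) :: complex) = of_nat (w' j)"
        using A.w_pos[OF j(1)] B.w_pos[OF j(1)] A.n by (simp add: field_simps)
      thus ?thesis by (simp only: of_nat_eq_iff)
    qed
    have "w s + (\<Sum>j\<in>{..<k} - {s}. w j) = w' s + (\<Sum>j\<in>{..<k} - {s}. w' j)"
      using A.sum_w B.sum_w nn s sum.remove[of "{..<k}" s w] sum.remove[of "{..<k}" s w'] by simp
    moreover have "(\<Sum>j\<in>{..<k} - {s}. w j) = (\<Sum>j\<in>{..<k} - {s}. w' j)" using ww by (intro sum.cong) auto
    ultimately have ws: "w s = w' s" by simp
    have colX: "(\<Sum>i<k. X i s * cnj (X i s)) = of_nat n / of_nat (w s)" using A.col_orth[OF s s] by simp
    have "(\<Sum>i<k. Y i s * cnj (Y i s)) = of_nat n / of_nat (w s)" using B.col_orth[OF s s] nn ws by simp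
    moreover have "(\<Sum>i<k. Y i s * cnj (Y i s)) = c * cnj c * (\<Sum>i<k. X i s * cnj (X i s))"
      using c by (simp add: sum_distrib_left mult_ac)
    ultimately have "c * cnj c * (of_nat n / of_nat (w s)) = of_nat n / of_nat (w s)" using colX by simp
    hence c1: "c * cnj c = 1" using A.n A.w_pos[OF s] by simp
    show ?thesis
    proof (cases "i0 = i0'")
      case True
      hence "c = 1" using c[OF A.i0] A.trivial[OF s] B.trivial[OF s] by simp
      thus ?thesis using c by (intro same) simp
    next
      case ne: False
      \<comment> \<open>The row that is trivial in \<open>X\<close> is nontrivial in
        \<open>Y\<close>. Its orthogonality to the trivial row of \<open>Y\<close> makes
        \<open>c\<close> real and not positive, so \<open>c = - 1\<close>, and the class of column
        \<open>s\<close> contains half of the group.\<close>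
      have Yi0: "Y i0 j = (if j = s then c else 1)" if "j < k" for j
        using c[OF A.i0] eq[OF A.i0 that] A.trivial[OF that] by auto
      have "(\<Sum>j<k. of_nat (w' j) * Y i0 j) = of_nat (w' s) * c + (\<Sum>j\<in>{..<k} - {s}. of_nat (w' j))"
        using s Yi0 by (subst sum.remove[of _ s]) auto
      hence "of_nat (w' s) * c + of_nat (\<Sum>j\<in>{..<k} - {s}. w' j) = 0"
        using B.row_orth_trivial[OF A.i0 ne] by simp
      moreover define b where "b = (\<Sum>j\<in>{..<k} - {s}. w' j)"
      ultimately have cb: "c = of_real (- (real b / real (w' s)))"
        using B.w_pos[OF s] by (simp add: field_simps add_eq_0_iff)
      hence "(of_real ((real b / real (w' s))\<^sup>2) :: complex) = 1" using c1 by (simp add: power2_eq_square)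
      hence "(real b / real (w' s))\<^sup>2 = 1" by (simp only: of_real_eq_1_iff)
      hence b1: "real b / real (w' s) = 1" by (metis abs_of_nonneg divide_nonneg_nonneg of_nat_0_le_iff real_sqrt_abs real_sqrt_one)
      hence cm: "c = - 1" using cb by simp
      have "b = w' s" using b1 B.w_pos[OF s] by simp
      hence "n = 2 * w s"
        using B.sum_w nn s sum.remove[of "{..<k}" s w'] ws by (simp add: b_def)
      hence "(\<Sum>i<k. X i s * cnj (X i s)) = 2" using colX A.w_pos[OF s] by simp
      moreover have "X i s * cnj (X i s) = of_real ((norm (X i s))\<^sup>2)" for i by (rule complex_norm_square[symmetric])
      ultimately have "of_real (\<Sum>i<k. (norm (X i s))\<^sup>2) = (of_real 2 :: complex)" by simp
      hence sum2: "(\<Sum>i<k. (norm (X i s))\<^sup>2) = 2" by (simp only: of_real_eq_iff)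
      have Xi0: "X i0 s = 1" using A.trivial[OF s] .
      have Xi0': "X i0' s = - 1" using c[OF B.i0] B.trivial[OF s] cm by (simp add: minus_equation_iff)
      \<comment> \<open>The entries 1 and -1 already exhaust the squared norm 2 of column
        \<open>s\<close>; interchanging their rows turns \<open>X\<close> into
        \<open>Y\<close>.\<close>
      have zero: "X i s = 0" if i: "i < k" "i \<noteq> i0" "i \<noteq> i0'" for i
      proof -
        have "(\<Sum>i\<in>{i, i0, i0'}. (norm (X i s))\<^sup>2) \<le> (\<Sum>i<k. (norm (X i s))\<^sup>2)"
          using i A.i0 B.i0 by (intro sum_mono2) auto
        thus ?thesis using sum2 i ne Xi0 Xi0' by simp
      qed
      have "Y i j = X (transpose i0 i0' i) j" if ij: "i < k" "j < k" for i j
      proof (cases "j = s")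
        case True
        consider "i = i0" | "i = i0'" | "i \<noteq> i0" "i \<noteq> i0'" by blast
        thus ?thesis
        proof cases
          case 3
          thus ?thesis using True c[OF ij(1)] zero[OF ij(1)] by simp
        qed (use True c[OF ij(1)] cm Xi0 Xi0' in simp_all)
      next
        case False
        consider "i = i0" | "i = i0'" | "i \<noteq> i0" "i \<noteq> i0'" by blast
        thus ?thesis
        proof cases
          case 1
          thus ?thesis using False eq ij A.trivial B.trivial A.i0 B.i0 by (metis transpose_apply_first)
        next
          case 2
          thus ?thesis using False eq ij A.trivial B.trivial A.i0 B.i0 by (metis transpose_apply_second)
        next
          case 3
          thus ?thesis using False eq ij by simp
        qed
      qed
      moreover have "transpose i0 i0' permutes {..<k}" by (rule permutes_swap_id) (use A.i0 B.i0 in auto)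
      ultimately show ?thesis
        by (intro exI[of _ "transpose i0 i0'"] exI[of _ id]) (auto intro: permutes_id)
    qed
  qed
qed

text \<open>In the second alternative \<open>f\<close> and \<open>f'\<close> are the partners of the
  two identity columns: they coincide if \<open>e = e'\<close>, and otherwise \<open>f = e'\<close>
  and \<open>f' = e\<close>.\<close>

lemma row_case:
  assumes r: "r < k" and eq: "\<And>i j. i < k \<Longrightarrow> j < k \<Longrightarrow> i \<noteq> r \<Longrightarrow> X i j = Y i j"
  shows "(\<exists>\<sigma> \<tau>. \<sigma> permutes {..<k} \<and> \<tau> permutes {..<k} \<and> (\<forall>i<k. \<forall>j<k. Y i j = X (\<sigma> i) (\<tau> j))) \<or>
    (\<exists>f f'. r \<noteq> i0 \<and> r \<noteq> i0' \<and> f < k \<and> f' < k \<and> f \<noteq> e \<and> f' \<noteq> e' \<and> {e, f} = {e', f'} \<and>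
      (\<forall>j<k. j \<noteq> e \<longrightarrow> j \<noteq> f \<longrightarrow> X r j = 0 \<and> Y r j = 0) \<and>
      X r e * X r f = Y r e' * Y r f' \<and> X r e \<noteq> Y r e')" (is "?iso \<or> ?bad")
proof -
  have same: ?iso if "\<And>j. j < k \<Longrightarrow> Y r j = X r j"
    using that eq by (intro exI[of _ id] conjI permutes_id) (metis id_apply)
  show ?thesis
  proof (cases "r = i0 \<or> r = i0'")
    case True
    \<comment> \<open>A trivial row other than \<open>r\<close> would be trivial in both tables, and
      a table has only one.\<close>
    have "i0 = i0'"
    proof (rule ccontr)
      assume ne: "i0 \<noteq> i0'"
      show False
      proof (cases "r = i0")
        case True
        hence "X i0' j = 1" if "j < k" for j using eq[OF B.i0 that] ne B.trivial[OF that] by auto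
        thus False using A.unique_trivial[OF B.i0] ne by metis
      next
        case False
        hence "Y i0 j = 1" if "j < k" for j using eq[OF A.i0 that] A.trivial[OF that] by auto
        thus False using B.unique_trivial[OF A.i0] ne by metis
      qed
    qed
    hence "Y r j = X r j" if "j < k" for j using True A.trivial[OF that] B.trivial[OF that] by auto
    thus ?thesis using same by blast
  next
    case False
    hence r0: "r \<noteq> i0" "r \<noteq> i0'" by auto
    have prod: "X r a * cnj (X r b) = Y r a * cnj (Y r b)" if ab: "a < k" "b < k" "a \<noteq> b" for a b
    proof -
      have "X r a * cnj (X r b) + (\<Sum>i\<in>{..<k} - {r}. X i a * cnj (X i b)) = 0"
        using A.col_orth[OF ab(1,2)] ab(3) A.split_row[OF r, of "\<lambda>i. X i a * cnj (X i b)"] by simp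
      moreover have "Y r a * cnj (Y r b) + (\<Sum>i\<in>{..<k} - {r}. Y i a * cnj (Y i b)) = 0"
        using B.col_orth[OF ab(1,2)] ab(3) B.split_row[OF r, of "\<lambda>i. Y i a * cnj (Y i b)"] by simp
      moreover have "(\<Sum>i\<in>{..<k} - {r}. X i a * cnj (X i b)) = (\<Sum>i\<in>{..<k} - {r}. Y i a * cnj (Y i b))"
        using eq ab by (intro sum.cong) auto
      ultimately show ?thesis by (metis add_right_imp_eq)
    qed
    show ?thesis
    proof (cases "e = e'")
      case ee: True
      obtain d :: nat where d: "d > 0" "X r e = of_nat d" using A.degree[OF r] by blast
      obtain d' :: nat where d': "d' > 0" "Y r e = of_nat d'" using B.degree[OF r] ee by blast
      have prod_e: "of_nat d * X r b = of_nat d' * Y r b" if "b < k" "b \<noteq> e" for b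
        using arg_cong[OF prod[OF A.e that(1) that(2)[symmetric]], of cnj] d d' by simp
      show ?thesis
      proof (cases "d = d'")
        case True
        have "Y r j = X r j" if "j < k" for j
          using prod_e[OF that] d d' True by (cases "j = e") auto
        thus ?thesis using same by blast
      next
        case dd: False
        \<comment> \<open>Off the identity column row \<open>r\<close> of \<open>Y\<close> is
          \<open>d / d'\<close> times that of \<open>X\<close>. Products of two entries are thus
          scaled by a number different from 1, and yet they agree.\<close>
        have zero: "X r a * cnj (X r b) = 0" if ab: "a < k" "b < k" "a \<noteq> b" "a \<noteq> e" "b \<noteq> e" for a b
        proof -
          have "of_nat d * of_nat d * (X r a * cnj (X r b)) = (of_nat d * X r a) * cnj (of_nat d * X r b)" by simp
          also have "\<dots> = of_nat d' * of_nat d' * (Y r a * cnj (Y r b))"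
            unfolding prod_e[OF ab(1,4)] prod_e[OF ab(2,5)] by simp
          also have "\<dots> = of_nat d' * of_nat d' * (X r a * cnj (X r b))" using prod[OF ab(1-3)] by simp
          finally have "of_nat (d * d) * (X r a * cnj (X r b)) = of_nat (d' * d') * (X r a * cnj (X r b))" by simp
          moreover have "d * d \<noteq> d' * d'" using dd by (metis power2_eq_iff_nonneg power2_eq_square zero_le)
          ultimately show ?thesis by (metis mult_cancel_right of_nat_eq_iff)
        qed
        \<comment> \<open>Without a second nonzero entry the row could not be orthogonal to the
          trivial one.\<close>
        have "\<exists>f<k. f \<noteq> e \<and> X r f \<noteq> 0"
        proof (rule ccontr)
          assume "\<not> ?thesis"
          hence 0: "X r j = 0" if "j < k" "j \<noteq> e" for j using that by blast
          have "(\<Sum>j<k. of_nat (w j) * X r j) = of_nat (w e) * X r e + (\<Sum>j\<in>{..<k} - {e}. of_nat (w j) * X r j)"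
            using A.e by (intro sum.remove) auto
          also have "(\<Sum>j\<in>{..<k} - {e}. of_nat (w j) * X r j) = 0" using 0 by (intro sum.neutral) auto
          finally show False using A.row_orth_trivial[OF r r0(1)] A.w_e d by simp
        qed
        then obtain f where f: "f < k" "f \<noteq> e" "X r f \<noteq> 0" by blast
        have suppX: "X r j = 0" if "j < k" "j \<noteq> e" "j \<noteq> f" for j
          using zero[OF that(1) f(1) that(3,2) f(2)] f(3) by simp
        have suppY: "Y r j = 0" if "j < k" "j \<noteq> e" "j \<noteq> f" for j
          using prod_e[OF that(1,2)] suppX[OF that] d' by simp
        have "X r e * X r f = Y r e * Y r f" using prod_e[OF f(1,2)] d d' by simp
        hence ?bad using r0 f suppX suppY ee d d' dd by (intro exI[of _ f] exI[of _ f]) auto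
        thus ?thesis by blast
      qed
    next
      case ne: False
      \<comment> \<open>Each of the two columns is the identity column of one table, so in a common
        row each entry bounds the other.\<close>
      have kern: "X i e' = X i e" if i: "i < k" "i \<noteq> r" for i
      proof -
        obtain c :: nat where c: "Y i e' = of_nat c" using B.degree[OF i(1)] by blast
        obtain d :: nat where d: "X i e = of_nat d" using A.degree[OF i(1)] by blast
        have "norm (Y i e) = real d" "norm (X i e') = real c"
          using eq[OF i(1) A.e i(2)] eq[OF i(1) B.e i(2)] c d by (metis norm_of_nat)+
        hence "real d \<le> real c" "real c \<le> real d"
          using B.bound[OF i(1) A.e] A.bound[OF i(1) B.e] by (simp_all add: c d)
        hence "c = d" by simp
        thus ?thesis using c d eq[OF i(1) B.e i(2)] by simp
      qed
      define D where "D = (\<Sum>i\<in>{..<k} - {r}. (Re (X i e))\<^sup>2)"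
      have D: "D > 0" unfolding D_def by (rule A.degree_sum_pos(2)[OF r0(1)])
      have sumD: "(\<Sum>i\<in>{..<k} - {r}. X i e * cnj (X i e')) = of_real D"
      proof -
        have "(\<Sum>i\<in>{..<k} - {r}. X i e * cnj (X i e')) = (\<Sum>i\<in>{..<k} - {r}. X i e * X i e)"
          by (intro sum.cong refl) (auto simp: kern A.degree_real(1))
        thus ?thesis unfolding D_def using A.degree_sum_pos(1)[OF r0(1)] by simp
      qed
      have X_prod: "X r e * cnj (X r e') = - of_real D"
        using A.col_orth[OF A.e B.e] ne A.split_row[OF r, of "\<lambda>i. X i e * cnj (X i e')"] sumD
        by (simp add: add_eq_0_iff2)
      have Y_prod: "Y r e * cnj (Y r e') = - of_real D" using prod[OF A.e B.e ne] X_prod by simp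
      have X_prod': "X r e * X r e' = - of_real D"
        using arg_cong[OF X_prod, of cnj] A.degree_real(1)[OF r] by simp
      have Y_prod': "Y r e' * Y r e = - of_real D"
        using Y_prod B.degree_real(1)[OF r] by (simp add: mult.commute)
      have Yre: "Y r e \<noteq> 0" using Y_prod D by auto
      \<comment> \<open>Columns \<open>e\<close> and \<open>e'\<close> of \<open>X\<close> agree
        outside row \<open>r\<close>. Comparing their orthogonality to column \<open>b\<close>
        leaves only the contributions of row \<open>r\<close>.\<close>
      have supp: "X r b = 0 \<and> Y r b = 0" if b: "b < k" "b \<noteq> e" "b \<noteq> e'" for b
      proof -
        define T where "T = (\<Sum>i\<in>{..<k} - {r}. X i e * cnj (X i b))"
        have "X r e * cnj (X r b) + T = 0"
          using A.col_orth[OF A.e b(1)] b A.split_row[OF r, of "\<lambda>i. X i e * cnj (X i b)"] by (simp add: T_def)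
        moreover have "X r e' * cnj (X r b) + (\<Sum>i\<in>{..<k} - {r}. X i e' * cnj (X i b)) = 0"
          using A.col_orth[OF B.e b(1)] b A.split_row[OF r, of "\<lambda>i. X i e' * cnj (X i b)"] by simp
        moreover have "(\<Sum>i\<in>{..<k} - {r}. X i e' * cnj (X i b)) = T"
          unfolding T_def using kern by (intro sum.cong) auto
        ultimately have "X r e * cnj (X r b) = X r e' * cnj (X r b)" by (metis add_right_imp_eq)
        \<comment> \<open>Otherwise the square of a real number would be \<open>- D\<close>.\<close>
        moreover have "X r e \<noteq> X r e'"
        proof
          assume "X r e = X r e'"
          hence "of_real (Re (X r e) * Re (X r e)) = (of_real (- D) :: complex)"
            using X_prod' A.degree_real(4)[OF r] by (metis of_real_minus of_real_mult)
          hence "Re (X r e) * Re (X r e) = - D" by (simp only: of_real_eq_iff)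
          thus False using D by (metis neg_0_less_iff_less not_square_less_zero neg_less_0_iff_less)
        qed
        ultimately have X0: "X r b = 0" by auto
        hence "Y r e * cnj (Y r b) = 0" using prod[OF A.e b(1) b(2)[symmetric]] by simp
        thus ?thesis using X0 Yre by simp
      qed
      \<comment> \<open>Equality means that the tables differ by the exchange of columns
        \<open>e\<close> and \<open>e'\<close>.\<close>
      show ?thesis
      proof (cases "X r e = Y r e'")
        case True
        have "Y r e = X r e'" using X_prod' Y_prod' True A.degree_real(2)[OF r] by (metis mult_cancel_left)
        have "Y i j = X i (transpose e e' j)" if ij: "i < k" "j < k" for i j
        proof (cases "i = r")
          case True
          thus ?thesis using \<open>X r e = Y r e'\<close> \<open>Y r e = X r e'\<close> supp[OF ij(2)]
            by (cases "j = e"; cases "j = e'") simp_all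
        next
          case False
          thus ?thesis using eq[OF ij False] kern[OF ij(1) False]
            by (cases "j = e"; cases "j = e'") simp_all
        qed
        moreover have "transpose e e' permutes {..<k}" by (rule permutes_swap_id) (use A.e B.e in auto)
        ultimately have ?iso by (intro exI[of _ id] exI[of _ "transpose e e'"]) (auto intro: permutes_id)
        thus ?thesis by blast
      next
        case False
        hence ?bad using r0 ne A.e B.e supp X_prod' Y_prod' by (intro exI[of _ e'] exI[of _ e]) auto
        thus ?thesis by blast
      qed
    qed
  qed
qed

end

section \<open>Character tables of groups\<close>

locale char_table = finite_group G for G :: "('a, 'm) monoid_scheme" (structure) +
  fixes \<chi> :: "nat \<Rightarrow> 'a \<Rightarrow> complex" and g :: "nat \<Rightarrow> 'a" and k :: nat
  assumes \<chi>: "bij_betw \<chi> {..<k} (Irr G)" and g: "\<And>j. j < k \<Longrightarrow> g j \<in> carrier G"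
    and classes: "bij_betw (\<lambda>j. conjugacy_class G (g j)) {..<k} (conjugacy_classes G)"
begin

lemma \<chi>_Irr: "i < k \<Longrightarrow> \<chi> i \<in> Irr G"
  using \<chi> by (auto simp: bij_betw_def)

lemma conjugation_eq: "conjugation G = (\<lambda>g. \<lambda>h\<in>carrier G. g \<otimes> h \<otimes> inv g)"
  by (simp add: conjugation_def fun_eq_iff)

interpretation conj: group_action G "carrier G" "conjugation G"
  unfolding conjugation_eq by (rule action_by_conjugation)

lemma conjugacy_class_eq: "x \<in> carrier G \<Longrightarrow> conjugacy_class G x = {h \<otimes> x \<otimes> inv h | h. h \<in> carrier G}"
  by (simp add: conjugacy_class_def orbit_def conjugation_def)

lemma column_exists:
  assumes x: "x \<in> carrier G"
  obtains j where "j < k" "x \<in> conjugacy_class G (g j)"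
proof -
  have "conjugacy_class G x \<in> conjugacy_classes G"
    using x by (auto simp: conjugacy_class_def conjugacy_classes_def orbits_def)
  then obtain j where "j < k" "conjugacy_class G x = conjugacy_class G (g j)"
    using classes by (auto simp: bij_betw_def)
  moreover have "x \<in> conjugacy_class G x" unfolding conjugacy_class_def by (rule conj.orbit_refl[OF x])
  ultimately show ?thesis using that by auto
qed

lemma column_unique:
  assumes "i < k" "j < k" "x \<in> conjugacy_class G (g i)" "x \<in> conjugacy_class G (g j)"
  shows "i = j"
proof -
  have "conjugacy_class G (g i) \<in> orbits G (carrier G) (conjugation G)"
    "conjugacy_class G (g j) \<in> orbits G (carrier G) (conjugation G)"
    using classes assms(1,2) by (auto simp: bij_betw_def conjugacy_classes_def)
  hence "conjugacy_class G (g i) = conjugacy_class G (g j)"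
    using conj.disjoint_union assms(3,4) by blast
  thus ?thesis using classes assms(1,2) by (auto simp: bij_betw_def inj_on_def)
qed

lemma self_class: "j < k \<Longrightarrow> g j \<in> conjugacy_class G (g j)"
  unfolding conjugacy_class_def using conj.orbit_refl g by blast

lemma \<chi>_class: "i < k \<Longrightarrow> j < k \<Longrightarrow> x \<in> conjugacy_class G (g j) \<Longrightarrow> \<chi> i x = \<chi> i (g j)"
  using Irr_conj[OF \<chi>_Irr] g by (auto simp: conjugacy_class_eq)

definition w where "w j = card (conjugacy_class G (g j))"

lemma finite_class: "j < k \<Longrightarrow> finite (conjugacy_class G (g j))"
  using fin g by (auto simp: conjugacy_class_eq)

lemma w_pos: "j < k \<Longrightarrow> w j > 0"
  using self_class finite_class by (auto simp: w_def card_gt_0_iff)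

lemma w_dvd: "j < k \<Longrightarrow> w j dvd Coset.order G"
  using dvdI[OF card_class_centralizer[OF g, symmetric]] conjugacy_class_eq[OF g] by (simp add: w_def)

lemma class_sum:
  fixes F :: "'a \<Rightarrow> complex"
  assumes "\<And>j x. j < k \<Longrightarrow> x \<in> conjugacy_class G (g j) \<Longrightarrow> F x = F (g j)"
  shows "(\<Sum>x\<in>carrier G. F x) = (\<Sum>j<k. of_nat (w j) * F (g j))"
proof -
  have "(\<Sum>x\<in>carrier G. F x) = (\<Sum>C\<in>conjugacy_classes G. \<Sum>x\<in>C. F x)"
    unfolding conjugacy_classes_def by (rule conj.disjoint_sum[OF fin, symmetric])
  also have "\<dots> = (\<Sum>j<k. \<Sum>x\<in>conjugacy_class G (g j). F x)"
    by (rule sum.reindex_bij_betw[OF classes, symmetric])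
  also have "\<dots> = (\<Sum>j<k. of_nat (w j) * F (g j))"
    using assms by (intro sum.cong refl) (simp add: w_def)
  finally show ?thesis .
qed

lemma row_orthogonality:
  assumes il: "i < k" "l < k"
  shows "(\<Sum>j<k. of_nat (w j) * (\<chi> i (g j) * cnj (\<chi> l (g j)))) = (if i = l then of_nat (Coset.order G) else 0)"
proof -
  have "\<chi> i = \<chi> l \<longleftrightarrow> i = l" using \<chi> il by (auto simp: bij_betw_def inj_on_def)
  hence "(\<Sum>x\<in>carrier G. \<chi> i x * cnj (\<chi> l x)) = (if i = l then of_nat (Coset.order G) else 0)"
    using Irr_orthogonality[OF \<chi>_Irr \<chi>_Irr] il by simp
  moreover have "(\<Sum>x\<in>carrier G. \<chi> i x * cnj (\<chi> l x)) = (\<Sum>j<k. of_nat (w j) * (\<chi> i (g j) * cnj (\<chi> l (g j))))"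
    by (rule class_sum) (use \<chi>_class il in simp)
  ultimately show ?thesis by simp
qed

text \<open>Row orthogonality says \<open>P * Q = 1\<close> for two square matrices, and the column
  relations are the entries of \<open>Q * P = 1\<close>.\<close>

lemma column_orthogonality:
  assumes ab: "a < k" "b < k"
  shows "(\<Sum>i<k. \<chi> i (g a) * cnj (\<chi> i (g b))) = (if a = b then of_nat (Coset.order G) / of_nat (w a) else 0)"
proof -
  define o' where "o' = (of_nat (Coset.order G) :: complex)"
  have o': "o' \<noteq> 0" using order_pos by (simp add: o'_def)
  define P where "P = mat k k (\<lambda>(i, j). of_nat (w j) * \<chi> i (g j) / o')"
  define Q where "Q = mat k k (\<lambda>(j, l). cnj (\<chi> l (g j)))"
  have PQ: "P \<in> carrier_mat k k" "Q \<in> carrier_mat k k" by (simp_all add: P_def Q_def)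
  have "P * Q = 1\<^sub>m k"
  proof (rule eq_matI)
    fix i l assume "i < dim_row (1\<^sub>m k :: complex mat)" "l < dim_col (1\<^sub>m k :: complex mat)"
    hence il: "i < k" "l < k" by auto
    have "(P * Q) $$ (i, l) = (\<Sum>j<k. of_nat (w j) * \<chi> i (g j) / o' * cnj (\<chi> l (g j)))"
      by (subst index_mult_mat_sum[OF PQ il]) (simp add: P_def Q_def il)
    also have "\<dots> = (\<Sum>j<k. of_nat (w j) * (\<chi> i (g j) * cnj (\<chi> l (g j)))) / o'"
      by (simp add: sum_divide_distrib mult_ac)
    also have "\<dots> = (1\<^sub>m k) $$ (i, l)" using row_orthogonality[OF il] il o' by (simp add: o'_def)
    finally show "(P * Q) $$ (i, l) = (1\<^sub>m k) $$ (i, l)" .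
  qed (use PQ in auto)
  hence QP: "Q * P = 1\<^sub>m k" by (rule mat_mult_left_right_inverse[OF PQ])
  have "(Q * P) $$ (b, a) = (\<Sum>i<k. cnj (\<chi> i (g b)) * (of_nat (w a) * \<chi> i (g a) / o'))"
    by (subst index_mult_mat_sum[OF PQ(2,1) ab(2,1)]) (simp add: P_def Q_def ab)
  also have "\<dots> = of_nat (w a) / o' * (\<Sum>i<k. \<chi> i (g a) * cnj (\<chi> i (g b)))"
    by (simp add: sum_distrib_left mult_ac)
  finally have "of_nat (w a) / o' * (\<Sum>i<k. \<chi> i (g a) * cnj (\<chi> i (g b))) = (if a = b then 1 else 0)"
    using QP ab by auto
  thus ?thesis using o' w_pos[OF ab(1)] by (auto simp: o'_def field_simps split: if_splits)
qed

lemma character_matrix_table: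
  obtains e i0 where "g e = \<one>" "character_matrix k (\<lambda>i j. \<chi> i (g j)) w e i0 (Coset.order G)"
proof -
  obtain e where e: "e < k" "\<one> \<in> conjugacy_class G (g e)" by (rule column_exists[OF one_closed])
  then obtain h where h: "h \<in> carrier G" "h \<otimes> g e \<otimes> inv h = \<one>" using g[of e] by (auto simp: conjugacy_class_eq)
  hence ge: "g e = \<one>" using conj_eq_one_iff[of h "g e"] g[OF e(1)] by simp
  have "(\<lambda>g\<in>carrier G. 1) \<in> \<chi> ` {..<k}" using \<chi> trivial_Irr by (simp add: bij_betw_def)
  then obtain i0 where i0: "i0 \<in> {..<k}" "(\<lambda>g\<in>carrier G. 1) = \<chi> i0" by (rule imageE)
  have triv: "\<chi> i0 x = 1" if "x \<in> carrier G" for x using that by (simp flip: i0(2))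
  have "conjugacy_class G \<one> = {\<one>}"
  proof
    show "conjugacy_class G \<one> \<subseteq> {\<one>}"
      unfolding conjugacy_class_eq[OF one_closed] using conj_eq_one_iff by blast
    show "{\<one>} \<subseteq> conjugacy_class G \<one>"
      unfolding conjugacy_class_eq[OF one_closed] using conj_eq_one_iff one_closed by force
  qed
  hence "w e = 1" using ge by (simp add: w_def)
  hence "character_matrix k (\<lambda>i j. \<chi> i (g j)) w e i0 (Coset.order G)"
  proof (intro character_matrix.intro)
    show "e < k" "i0 < k" "w e = 1" "Coset.order G > 0" using e i0(1) order_pos \<open>w e = 1\<close> by auto
    show "\<exists>d::nat. d > 0 \<and> \<chi> i (g e) = of_nat d" if "i < k" for i
      using Irr_one[OF \<chi>_Irr[OF that]] ge by simp
    show "norm (\<chi> i (g j)) \<le> Re (\<chi> i (g e))" if "i < k" "j < k" for i j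
      using norm_Irr_le[OF \<chi>_Irr[OF that(1)] g[OF that(2)]] ge by simp
  qed (rule w_pos row_orthogonality column_orthogonality triv; (rule g)?; assumption)+
  thus ?thesis using that ge by blast
qed

text \<open>The common kernel of all irreducible characters except that of row \<open>r\<close>. For
  an exceptional row it is the subgroup \<open>N\<close>.\<close>

definition kernel where "kernel r = {x \<in> carrier G. \<forall>i<k. i \<noteq> r \<longrightarrow> \<chi> i x = \<chi> i \<one>}"

context
  fixes e i0 r f :: nat
  assumes ge: "g e = \<one>" and M: "character_matrix k (\<lambda>i j. \<chi> i (g j)) w e i0 (Coset.order G)"
    and r: "r < k" "r \<noteq> i0" and f: "f < k" "f \<noteq> e"
    and supp: "\<And>j. j < k \<Longrightarrow> j \<noteq> e \<Longrightarrow> j \<noteq> f \<Longrightarrow> \<chi> r (g j) = 0"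
begin

interpretation M: character_matrix k "\<lambda>i j. \<chi> i (g j)" w e i0 "Coset.order G" by (rule M)

lemma kernel_iff:
  assumes "j < k" "x \<in> conjugacy_class G (g j)"
  shows "x \<in> kernel r \<longleftrightarrow> j = e \<or> j = f"
proof -
  have out: "j = e \<or> j = f" if "\<And>i. i < k \<Longrightarrow> i \<noteq> r \<Longrightarrow> \<chi> i (g j) = \<chi> i (g e)"
    by (rule M.column_outside_kernel[OF r f _ assms(1)]) (simp_all add: supp that)
  have col: "\<chi> i (g f) = \<chi> i (g e)" if "i < k" "i \<noteq> r" for i
    by (rule M.kernel_column[OF r f _ that]) (simp add: supp)
  have "x \<in> carrier G" using assms g by (auto simp: conjugacy_class_eq)
  moreover have "\<chi> i x = \<chi> i (g j)" if "i < k" for i using \<chi>_class assms that by simp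
  ultimately show ?thesis
    using out col ge unfolding kernel_def by auto
qed

lemma subgroup_kernel: "subgroup (kernel r) G"
proof -
  have "kernel r = \<Inter> ((\<lambda>i. {z \<in> carrier G. \<chi> i z = \<chi> i \<one>}) ` ({..<k} - {r}))"
    using r(2) M.i0 by (auto simp: kernel_def)
  moreover have "subgroup \<dots> G"
    by (rule subgroups_Inter) (use r(2) M.i0 Irr_kernel(1)[OF \<chi>_Irr] in auto)
  ultimately show ?thesis by simp
qed

lemma kernel_minus_one: "kernel r - {\<one>} = conjugacy_class G (g f)"
proof (rule Set.set_eqI)
  fix x
  show "x \<in> kernel r - {\<one>} \<longleftrightarrow> x \<in> conjugacy_class G (g f)"
  proof (cases "x \<in> carrier G")
    case True
    obtain j where j: "j < k" "x \<in> conjugacy_class G (g j)" by (rule column_exists[OF True])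
    have "x = \<one> \<longleftrightarrow> j = e"
    proof
      assume "x = \<one>"
      thus "j = e" using column_unique[OF j(1) M.e j(2)] self_class[OF M.e] ge by simp
    next
      assume "j = e"
      thus "x = \<one>" using j(2) conj_eq_one_iff unfolding \<open>j = e\<close> ge conjugacy_class_eq[OF one_closed] by blast
    qed
    thus ?thesis using kernel_iff[OF j] column_unique[OF j(1) f(1) j(2)] j f by auto
  next
    case False
    thus ?thesis using f g by (auto simp: kernel_def conjugacy_class_eq)
  qed
qed

lemma gagola_character_kernel: "gagola_character G (\<chi> r) (kernel r)"
proof -
  interpret K: subgroup "kernel r" G by (rule subgroup_kernel)
  have finK: "finite (kernel r)" by (rule finite_subset[OF K.subset fin])
  show ?thesis
  proof (unfold_locales)
    show "\<chi> r \<in> Irr G" by (rule \<chi>_Irr[OF r(1)])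
    show "h \<otimes> z \<otimes> inv h \<in> kernel r" if "h \<in> carrier G" "z \<in> kernel r" for h z
    proof -
      have zc: "z \<in> carrier G" "\<And>i. i < k \<Longrightarrow> i \<noteq> r \<Longrightarrow> \<chi> i z = \<chi> i \<one>"
        using that(2) unfolding kernel_def by blast+
      have "\<chi> i (h \<otimes> z \<otimes> inv h) = \<chi> i \<one>" if "i < k" "i \<noteq> r" for i
        using Irr_conj[OF \<chi>_Irr[OF that(1)] \<open>h \<in> carrier G\<close> zc(1)] zc(2)[OF that] by simp
      moreover have "h \<otimes> z \<otimes> inv h \<in> carrier G" using that(1) zc(1) by simp
      ultimately show ?thesis unfolding kernel_def by blast
    qed
    show "\<exists>h\<in>carrier G. z' = h \<otimes> z \<otimes> inv h" if z: "z \<in> kernel r" "z \<noteq> \<one>" and z': "z' \<in> kernel r" "z' \<noteq> \<one>" for z z'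
    proof -
      have "z \<in> conjugacy_class G (g f)" "z' \<in> conjugacy_class G (g f)"
        using z z' kernel_minus_one by auto
      moreover have "z \<in> carrier G" using z by simp
      ultimately have "z' \<in> orbit G (conjugation G) z"
        unfolding conjugacy_class_def
        using conj.orbit_sym[of "g f" z] conj.orbit_trans[of z "g f" z'] g[OF f(1)] z' by simp
      thus ?thesis using \<open>z \<in> carrier G\<close> by (auto simp: orbit_def conjugation_def)
    qed
    show "kernel r \<noteq> {\<one>}" using kernel_minus_one self_class[OF f(1)] by auto
    show "\<chi> r x = 0" if x: "x \<in> carrier G" "x \<notin> kernel r" for x
    proof -
      obtain j where j: "j < k" "x \<in> conjugacy_class G (g j)" by (rule column_exists[OF x(1)])
      thus ?thesis using kernel_iff[OF j] x supp \<chi>_class[OF r(1) j] by auto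
    qed
    show "of_nat (card (kernel r) - 1) * \<chi> r z = - \<chi> r \<one>" if z: "z \<in> kernel r" "z \<noteq> \<one>" for z
    proof -
      have "card (kernel r) - 1 = w f"
        using kernel_minus_one finK K.one_closed by (simp add: w_def flip: kernel_minus_one)
      moreover have "\<chi> r z = \<chi> r (g f)"
        using \<chi>_class[OF r(1) f(1), of z] z kernel_minus_one by auto
      moreover have "of_nat (w f) * \<chi> r (g f) = - \<chi> r (g e)"
        by (rule M.supp_f[OF r f]) (simp add: supp)
      ultimately show ?thesis using ge by simp
    qed
  qed
qed

end

end

text \<open>\<open>{e, f} = {e', f'}\<close> puts the two kernels into the same two columns even if
  the identity columns differ, so the remaining columns of both tables correspond.\<close>

lemma pair_from_tables:
  fixes G :: "('a, 'm) monoid_scheme" and H :: "('b, 'n) monoid_scheme"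
  assumes TG: "char_table G \<chi> g k" and TH: "char_table H \<psi> h k"
    and ge: "g e = \<one>\<^bsub>G\<^esub>" "h e' = \<one>\<^bsub>H\<^esub>"
    and MG: "character_matrix k (\<lambda>i j. \<chi> i (g j)) (char_table.w G g) e i0 (Coset.order G)"
    and MH: "character_matrix k (\<lambda>i j. \<psi> i (h j)) (char_table.w H h) e' i0' (Coset.order H)"
    and r: "r < k" "r \<noteq> i0" "r \<noteq> i0'" and f: "f < k" "f \<noteq> e" "f' < k" "f' \<noteq> e'" "{e, f} = {e', f'}"
    and supp: "\<And>j. j < k \<Longrightarrow> j \<noteq> e \<Longrightarrow> j \<noteq> f \<Longrightarrow> \<chi> r (g j) = 0 \<and> \<psi> r (h j) = 0"
    and eq: "\<And>i j. i < k \<Longrightarrow> j < k \<Longrightarrow> i \<noteq> r \<Longrightarrow> \<chi> i (g j) = \<psi> i (h j)"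
    and prod: "\<chi> r (g e) * \<chi> r (g f) = \<psi> r (h e') * \<psi> r (h f')"
  shows "gagola_pair G (\<chi> r) (char_table.kernel G \<chi> k r) H (\<psi> r) (char_table.kernel H \<psi> k r) ({..<k} - {r}) \<chi> \<psi>"
proof -
  interpret TG: char_table G \<chi> g k by (rule TG)
  interpret TH: char_table H \<psi> h k by (rule TH)
  define N where "N = TG.kernel r"
  define K where "K = TH.kernel r"
  have suppG: "\<chi> r (g j) = 0" if "j < k" "j \<noteq> e" "j \<noteq> f" for j using supp that by blast
  have suppH: "\<psi> r (h j) = 0" if "j < k" "j \<noteq> e'" "j \<noteq> f'" for j using supp that f(5) by blast
  have kG: "x \<in> N \<longleftrightarrow> j = e \<or> j = f" if "j < k" "x \<in> conjugacy_class G (g j)" for j x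
    unfolding N_def by (rule TG.kernel_iff[OF ge(1) MG r(1,2) f(1,2) _ that]) (simp add: suppG)
  have kH: "x \<in> K \<longleftrightarrow> j = e' \<or> j = f'" if "j < k" "x \<in> conjugacy_class H (h j)" for j x
    unfolding K_def by (rule TH.kernel_iff[OF ge(2) MH r(1,3) f(3,4) _ that]) (simp add: suppH)
  interpret A: gagola_character G "\<chi> r" N
    unfolding N_def by (rule TG.gagola_character_kernel[OF ge(1) MG r(1,2) f(1,2)]) (simp add: suppG)
  interpret B: gagola_character H "\<psi> r" K
    unfolding K_def by (rule TH.gagola_character_kernel[OF ge(2) MH r(1,3) f(3,4)]) (simp add: suppH)
  have orth: "(\<Sum>i\<in>{..<k} - {r}. \<chi> i (g a) * cnj (\<chi> i (g b))) = (if a = b then of_nat (Coset.order G) / of_nat (TG.w a) else 0)"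
    if "a < k" "b < k" "a \<noteq> e" "a \<noteq> f" for a b
    using TG.column_orthogonality[OF that(1,2)] suppG[OF that(1,3,4)] r(1) sum.remove[of "{..<k}" r "\<lambda>i. \<chi> i (g a) * cnj (\<chi> i (g b))"] by simp
  have orthH: "(\<Sum>i\<in>{..<k} - {r}. \<psi> i (h a) * cnj (\<psi> i (h b))) = (if a = b then of_nat (Coset.order H) / of_nat (TH.w a) else 0)"
    if "a < k" "b < k" "a \<noteq> e'" "a \<noteq> f'" for a b
    using TH.column_orthogonality[OF that(1,2)] suppH[OF that(1,3,4)] r(1) sum.remove[of "{..<k}" r "\<lambda>i. \<psi> i (h a) * cnj (\<psi> i (h b))"] by simp
  have "gagola_pair G (\<chi> r) N H (\<psi> r) K ({..<k} - {r}) \<chi> \<psi>"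
  proof unfold_locales
    show "\<chi> i \<in> Irr G" "\<psi> i \<in> Irr H" if "i \<in> {..<k} - {r}" for i
      using that TG.\<chi>_Irr TH.\<chi>_Irr by auto
    show "\<exists>y\<in>carrier H - K. \<forall>i\<in>{..<k} - {r}. \<chi> i x = \<psi> i y" if x: "x \<in> carrier G - N" for x
    proof -
      obtain j where j: "j < k" "x \<in> conjugacy_class G (g j)" using TG.column_exists x by blast
      hence "j \<notin> {e', f'}" using kG[OF j] x f(5) by auto
      hence "h j \<in> carrier H - K" using kH[OF j(1) TH.self_class[OF j(1)]] TH.g j by auto
      moreover have "\<chi> i x = \<psi> i (h j)" if "i \<in> {..<k} - {r}" for i
        using TG.\<chi>_class[OF _ j, of i] eq[of i j] that j by auto
      ultimately show ?thesis by blast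
    qed
    show "\<exists>x\<in>carrier G - N. \<forall>i\<in>{..<k} - {r}. \<chi> i x = \<psi> i y" if y: "y \<in> carrier H - K" for y
    proof -
      obtain j where j: "j < k" "y \<in> conjugacy_class H (h j)" using TH.column_exists y by blast
      hence "j \<notin> {e, f}" using kH[OF j] y f(5) by auto
      hence "g j \<in> carrier G - N" using kG[OF j(1) TG.self_class[OF j(1)]] TG.g j by auto
      moreover have "\<chi> i (g j) = \<psi> i y" if "i \<in> {..<k} - {r}" for i
        using TH.\<chi>_class[OF _ j, of i] eq[of i j] that j by auto
      ultimately show ?thesis by blast
    qed
    show "(\<Sum>i\<in>{..<k} - {r}. \<chi> i x * cnj (\<chi> i x')) = 0"
      if x: "x \<in> carrier G - N" "x' \<in> carrier G - N" and no: "\<nexists>c. c \<in> carrier G \<and> x' = c \<otimes>\<^bsub>G\<^esub> x \<otimes>\<^bsub>G\<^esub> inv\<^bsub>G\<^esub> c" for x x'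
    proof -
      obtain a where a: "a < k" "x \<in> conjugacy_class G (g a)" using TG.column_exists x by blast
      obtain b where b: "b < k" "x' \<in> conjugacy_class G (g b)" using TG.column_exists x by blast
      have "a \<noteq> b"
      proof
        assume "a = b"
        then obtain c c' where c: "c \<in> carrier G" "x = c \<otimes>\<^bsub>G\<^esub> g a \<otimes>\<^bsub>G\<^esub> inv\<^bsub>G\<^esub> c" and
          c': "c' \<in> carrier G" "x' = c' \<otimes>\<^bsub>G\<^esub> g a \<otimes>\<^bsub>G\<^esub> inv\<^bsub>G\<^esub> c'"
          using a b TG.g by (auto simp: TG.conjugacy_class_eq)
        have "x' = (c' \<otimes>\<^bsub>G\<^esub> inv\<^bsub>G\<^esub> c) \<otimes>\<^bsub>G\<^esub> x \<otimes>\<^bsub>G\<^esub> inv\<^bsub>G\<^esub> (c' \<otimes>\<^bsub>G\<^esub> inv\<^bsub>G\<^esub> c)"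
          unfolding c(2) c'(2) using c(1) c'(1) TG.g[OF a(1)]
          by (simp add: TG.inv_mult_group TG.m_assoc)
        moreover have "c' \<otimes>\<^bsub>G\<^esub> inv\<^bsub>G\<^esub> c \<in> carrier G" using c(1) c'(1) by simp
        ultimately show False using no by (elim notE) (intro exI conjI)
      qed
      moreover have "a \<noteq> e" "a \<noteq> f" using kG[OF a] x by auto
      moreover have "(\<Sum>i\<in>{..<k} - {r}. \<chi> i x * cnj (\<chi> i x')) = (\<Sum>i\<in>{..<k} - {r}. \<chi> i (g a) * cnj (\<chi> i (g b)))"
        using TG.\<chi>_class[OF _ a] TG.\<chi>_class[OF _ b] by (intro sum.cong) auto
      ultimately show ?thesis using orth[OF a(1) b(1)] by simp
    qed
    show "\<exists>c::nat. c > 0 \<and> c dvd Coset.order H \<and> (\<Sum>i\<in>{..<k} - {r}. \<psi> i y * cnj (\<psi> i y)) = of_nat c"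
      if y: "y \<in> carrier H - K" for y
    proof -
      obtain a where a: "a < k" "y \<in> conjugacy_class H (h a)" using TH.column_exists y by blast
      have ne: "a \<noteq> e'" "a \<noteq> f'" using kH[OF a] y by auto
      obtain c where c: "Coset.order H = TH.w a * c" using TH.w_dvd[OF a(1)] by blast
      have "(\<Sum>i\<in>{..<k} - {r}. \<psi> i y * cnj (\<psi> i y)) = (\<Sum>i\<in>{..<k} - {r}. \<psi> i (h a) * cnj (\<psi> i (h a)))"
        using TH.\<chi>_class[OF _ a] by (intro sum.cong) auto
      also have "\<dots> = of_nat c" using orthH[OF a(1) a(1) ne] c TH.w_pos[OF a(1)] by simp
      finally show ?thesis using c TH.order_pos by (intro exI[of _ c]) auto
    qed
    show "\<psi> i (y \<otimes>\<^bsub>H\<^esub> z) = \<psi> i y" if "i \<in> {..<k} - {r}" "y \<in> carrier H" "z \<in> K" for i y z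
      using TH.Irr_kernel(2)[OF TH.\<chi>_Irr, of i y z] that by (auto simp: K_def TH.kernel_def)
    have ek: "e < k" "e' < k" by (rule character_matrix.e[OF MG], rule character_matrix.e[OF MH])
    have "g f \<noteq> \<one>\<^bsub>G\<^esub>"
      using TG.column_unique[OF f(1) ek(1) TG.self_class[OF f(1)]] TG.self_class[OF ek(1)] ge(1) f(2) by metis
    hence "\<chi> r (g f) = - of_nat A.m"
      using A.u_N[of "g f"] A.u_z0 kG[OF f(1) TG.self_class[OF f(1)]] by simp
    moreover have "h f' \<noteq> \<one>\<^bsub>H\<^esub>"
      using TH.column_unique[OF f(3) ek(2) TH.self_class[OF f(3)]] TH.self_class[OF ek(2)] ge(2) f(4) by metis
    hence "\<psi> r (h f') = - of_nat B.m"
      using B.u_N[of "h f'"] B.u_z0 kH[OF f(3) TH.self_class[OF f(3)]] by simp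
    \<comment> \<open>The two entries of an exceptional row are \<open>m * t\<close> and
      \<open>- m\<close>, so \<open>prod\<close> becomes the equation
      \<open>order_eq\<close>.\<close>
    ultimately have "(of_nat (A.m * A.t * A.m) :: complex) = of_nat (B.m * B.t * B.m)"
      using prod ge A.u_one_eq B.u_one_eq by simp
    hence "A.m * A.t * A.m = B.m * B.t * B.m" by (simp only: of_nat_eq_iff)
    thus "A.m\<^sup>2 * A.t = B.m\<^sup>2 * B.t" by (simp add: power2_eq_square mult_ac)
  qed
  thus ?thesis by (simp add: N_def K_def)
qed

text \<open>\<open>m\<close> is a power of \<open>p\<close> and \<open>t\<close> is prime to
  \<open>p\<close>, so the common number \<open>m^2 * t\<close> has \<open>p\<close>-part
  \<open>m^2\<close>.\<close>

lemma (in gagola_pair) equal_m_if_equal_p: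
  assumes "A.p = B.p"
  shows "A.m = B.m"
proof -
  define p where "p = A.p"
  have p: "prime p" using A.prime_p by (simp add: p_def)
  obtain a where a: "A.m = p ^ a"
    using prime_power_if_unique_prime_divisor[OF p A.m_pos] A.prime_dvd_m by (auto simp: p_def)
  obtain b where b: "B.m = p ^ b"
    using prime_power_if_unique_prime_divisor[OF p B.m_pos] B.prime_dvd_m assms by (auto simp: p_def)
  have "multiplicity p (A.m\<^sup>2 * A.t) = 2 * a"
    by (rule multiplicity_decomposeI[of _ _ _ A.t])
      (use A.coprime_t_p p in \<open>auto simp: a p_def power_mult[symmetric] mult.commute\<close>)
  moreover have "multiplicity p (B.m\<^sup>2 * B.t) = 2 * b"
    by (rule multiplicity_decomposeI[of _ _ _ B.t])
      (use B.coprime_t_p p assms in \<open>auto simp: b p_def power_mult[symmetric] mult.commute\<close>)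
  ultimately show ?thesis using order_eq a b by simp
qed

text \<open>The pairing is used in both directions: for different primes, one direction gives
  \<open>m = 1\<close> for \<open>H\<close> and the other for \<open>G\<close>. Equal
  \<open>m\<close> then forces equal \<open>t\<close>, hence equal degrees
  \<open>m * t\<close>.\<close>

lemma exceptional_row_impossible:
  fixes G :: "('a, 'm) monoid_scheme" and H :: "('b, 'n) monoid_scheme"
  assumes TG: "char_table G \<chi> g k" and TH: "char_table H \<psi> h k"
    and ge: "g e = \<one>\<^bsub>G\<^esub>" "h e' = \<one>\<^bsub>H\<^esub>"
    and MG: "character_matrix k (\<lambda>i j. \<chi> i (g j)) (char_table.w G g) e i0 (Coset.order G)"
    and MH: "character_matrix k (\<lambda>i j. \<psi> i (h j)) (char_table.w H h) e' i0' (Coset.order H)"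
    and r: "r < k" "r \<noteq> i0" "r \<noteq> i0'" and f: "f < k" "f \<noteq> e" "f' < k" "f' \<noteq> e'" "{e, f} = {e', f'}"
    and supp: "\<And>j. j < k \<Longrightarrow> j \<noteq> e \<Longrightarrow> j \<noteq> f \<Longrightarrow> \<chi> r (g j) = 0 \<and> \<psi> r (h j) = 0"
    and eq: "\<And>i j. i < k \<Longrightarrow> j < k \<Longrightarrow> i \<noteq> r \<Longrightarrow> \<chi> i (g j) = \<psi> i (h j)"
    and prod: "\<chi> r (g e) * \<chi> r (g f) = \<psi> r (h e') * \<psi> r (h f')"
  shows "\<chi> r (g e) = \<psi> r (h e')"
proof -
  define N where "N = char_table.kernel G \<chi> k r"
  define K where "K = char_table.kernel H \<psi> k r"
  interpret P: gagola_pair G "\<chi> r" N H "\<psi> r" K "{..<k} - {r}" \<chi> \<psi>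
    unfolding N_def K_def
    by (rule pair_from_tables[OF TG TH ge MG MH r f]) (use supp eq prod in auto)
  interpret Q: gagola_pair H "\<psi> r" K G "\<chi> r" N "{..<k} - {r}" \<psi> \<chi>
    unfolding N_def K_def
  proof (rule pair_from_tables[OF TH TG ge(2,1) MH MG r(1,3,2) f(3,4,1,2) f(5)[symmetric]])
    show "\<psi> r (h j) = 0 \<and> \<chi> r (g j) = 0" if "j < k" "j \<noteq> e'" "j \<noteq> f'" for j
      using supp[of j] that f(5) by blast
  qed (use eq prod in auto)
  have "P.A.m = P.B.m"
    using P.equal_m_if_equal_p P.m_eq_1 Q.m_eq_1 by (cases "P.A.p = P.B.p") auto
  moreover have "P.A.m > 0" by (rule P.A.m_pos)
  ultimately have "P.A.t = P.B.t" using P.order_eq by simp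
  thus ?thesis using P.A.u_one_eq P.B.u_one_eq \<open>P.A.m = P.B.m\<close> ge by simp
qed

theorem theorem1:
  fixes G :: "('a, 'm) monoid_scheme" and H :: "('b, 'n) monoid_scheme"
    and X Y :: "complex mat" and k :: nat
  assumes "group G" and "finite (carrier G)"
    and "group H" and "finite (carrier H)"
    and "card (conjugacy_classes G) = k" and "card (conjugacy_classes H) = k"
    and "is_character_table G X" and "is_character_table H Y"
    and "(\<exists>r<k. \<forall>i<k. \<forall>j<k. i \<noteq> r \<longrightarrow> X $$ (i, j) = Y $$ (i, j)) \<or>
         (\<exists>s<k. \<forall>i<k. \<forall>j<k. j \<noteq> s \<longrightarrow> X $$ (i, j) = Y $$ (i, j))"
  shows "\<exists>\<sigma> \<tau>. \<sigma> permutes {..<k} \<and> \<tau> permutes {..<k} \<and>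
           Y = mat k k (\<lambda>(i, j). X $$ (\<sigma> i, \<tau> j))"
proof -
  obtain \<chi> g where G: "bij_betw \<chi> {..<k} (Irr G)" "\<forall>j<k. g j \<in> carrier G"
    "bij_betw (\<lambda>j. conjugacy_class G (g j)) {..<k} (conjugacy_classes G)" and X: "X = mat k k (\<lambda>(i, j). \<chi> i (g j))"
    using assms(5,7) by (auto simp: is_character_table_def)
  obtain \<psi> h where H: "bij_betw \<psi> {..<k} (Irr H)" "\<forall>j<k. h j \<in> carrier H"
    "bij_betw (\<lambda>j. conjugacy_class H (h j)) {..<k} (conjugacy_classes H)" and Y: "Y = mat k k (\<lambda>(i, j). \<psi> i (h j))"
    using assms(6,8) by (auto simp: is_character_table_def)
  interpret TG: char_table G \<chi> g k
    using assms(1,2) G by (simp add: char_table_def finite_group_def finite_group_axioms_def char_table_axioms_def)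
  interpret TH: char_table H \<psi> h k
    using assms(3,4) H by (simp add: char_table_def finite_group_def finite_group_axioms_def char_table_axioms_def)
  obtain e i0 where ge: "g e = \<one>\<^bsub>G\<^esub>" and MG: "character_matrix k (\<lambda>i j. \<chi> i (g j)) TG.w e i0 (Coset.order G)"
    by (rule TG.character_matrix_table)
  obtain e' i0' where he: "h e' = \<one>\<^bsub>H\<^esub>" and MH: "character_matrix k (\<lambda>i j. \<psi> i (h j)) TH.w e' i0' (Coset.order H)"
    by (rule TH.character_matrix_table)
  interpret MM: character_matrices k "\<lambda>i j. \<chi> i (g j)" TG.w e i0 "Coset.order G"
    "\<lambda>i j. \<psi> i (h j)" TH.w e' i0' "Coset.order H"
    by (rule character_matrices.intro[OF MG MH])
  have "\<exists>\<sigma> \<tau>. \<sigma> permutes {..<k} \<and> \<tau> permutes {..<k} \<and> (\<forall>i<k. \<forall>j<k. \<psi> i (h j) = \<chi> (\<sigma> i) (g (\<tau> j)))"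
    using assms(9)
  proof
    assume "\<exists>s<k. \<forall>i<k. \<forall>j<k. j \<noteq> s \<longrightarrow> X $$ (i, j) = Y $$ (i, j)"
    then obtain s where s: "s < k" "\<And>i j. i < k \<Longrightarrow> j < k \<Longrightarrow> j \<noteq> s \<Longrightarrow> \<chi> i (g j) = \<psi> i (h j)"
      by (auto simp: X Y)
    show ?thesis by (rule MM.column_case[OF s])
  next
    assume "\<exists>r<k. \<forall>i<k. \<forall>j<k. i \<noteq> r \<longrightarrow> X $$ (i, j) = Y $$ (i, j)"
    then obtain r where r: "r < k" and eq: "\<And>i j. i < k \<Longrightarrow> j < k \<Longrightarrow> i \<noteq> r \<Longrightarrow> \<chi> i (g j) = \<psi> i (h j)"
      by (auto simp: X Y)
    from MM.row_case[OF r eq] show ?thesis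
    proof
      assume "\<exists>f f'. r \<noteq> i0 \<and> r \<noteq> i0' \<and> f < k \<and> f' < k \<and> f \<noteq> e \<and> f' \<noteq> e' \<and> {e, f} = {e', f'} \<and>
        (\<forall>j<k. j \<noteq> e \<longrightarrow> j \<noteq> f \<longrightarrow> \<chi> r (g j) = 0 \<and> \<psi> r (h j) = 0) \<and>
        \<chi> r (g e) * \<chi> r (g f) = \<psi> r (h e') * \<psi> r (h f') \<and> \<chi> r (g e) \<noteq> \<psi> r (h e')"
      then obtain f f' where bad: "r \<noteq> i0" "r \<noteq> i0'" "f < k" "f \<noteq> e" "f' < k" "f' \<noteq> e'" "{e, f} = {e', f'}"
        "\<And>j. j < k \<Longrightarrow> j \<noteq> e \<Longrightarrow> j \<noteq> f \<Longrightarrow> \<chi> r (g j) = 0 \<and> \<psi> r (h j) = 0"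
        "\<chi> r (g e) * \<chi> r (g f) = \<psi> r (h e') * \<psi> r (h f')" "\<chi> r (g e) \<noteq> \<psi> r (h e')"
        by blast
      have "\<chi> r (g e) = \<psi> r (h e')"
        by (rule exceptional_row_impossible[OF TG.char_table_axioms TH.char_table_axioms ge he MG MH r bad(1-7)])
          (use bad(8,9) eq in auto)
      thus ?thesis using bad(10) by simp
    qed
  qed
  then obtain \<sigma> \<tau> where perm: "\<sigma> permutes {..<k}" "\<tau> permutes {..<k}"
    "\<And>i j. i < k \<Longrightarrow> j < k \<Longrightarrow> \<psi> i (h j) = \<chi> (\<sigma> i) (g (\<tau> j))" by blast
  have "\<sigma> i < k" "\<tau> i < k" if "i < k" for i
    using permutes_in_image[OF perm(1), of i] permutes_in_image[OF perm(2), of i] that by auto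
  hence "Y = mat k k (\<lambda>(i, j). X $$ (\<sigma> i, \<tau> j))"
    by (intro eq_matI) (auto simp: X Y perm(3))
  thus ?thesis using perm(1,2) by blast
qed

end
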